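(* Let $\mathbf{A} = (A_n) \in \mathcal{S}_{L^\infty(\mathbb{T}), AP(\mathbb{Z})}(\mathbb{Z}^+)$. Then $$\lim_{n \to \infty} \frac{\lambda_1 (A_n) + \dots + \lambda_n (A_n)}{n} = M(D_{ap}(W(\mathbf{A}))).$$
   Context: $\mathbb{Z}^+$ denotes the non-negative integers; $P$ is the orthogonal projection of $l^2(\mathbb{Z})$ onto $l^2(\mathbb{Z}^+)$ and $P_n$ the orthogonal projection onto $l^2(\{0,1,\dots,n-1\})$. For $a \in L^\infty(\mathbb{T})$ ($\mathbb{T}$ the complex unit circle) with Fourier coefficients $a_j$, the Laurent operator $L(a)$ on $l^2(\mathbb{Z})$ has matrix $(a_{i-j})_{i,j\in\mathbb{Z}}$, and $T(a) := PL(a)P$ on $l^2(\mathbb{Z}^+)$ is the Toeplitz operator. A function $b\in l^\infty(\mathbb{Z})$ is almost periodic, $b \in AP(\mathbb{Z})$, if the set of its translates $n\mapsto b(n+k)$, $k\in\mathbb{Z}$, is relatively compact in $l^\infty(\mathbb{Z})$; functions are identified with multiplication operators. $\mathcal{A}_{L^\infty(\mathbb{T}), AP(\mathbb{Z})}(\mathbb{Z}^+)$ is the smallest closed $C^*$-subalgebra of $L(l^2(\mathbb{Z}^+))$ containing all $T(a)$, $a\in L^\infty(\mathbb{T})$, and all $PbP$, $b\in AP(\mathbb{Z})$. $\mathcal{F}^{\mathcal{P}}$ is the $C^*$-algebra of all sequences $\mathbf{A}=(A_n)_{n\in\mathbb{N}}$ of operators $A_n:\operatorname{im}P_n\to\operatorname{im}P_n$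 for which the strong limits of $A_nP_n$ and $A_n^*P_n$ on $l^2(\mathbb{Z}^+)$ exist, with entrywise operations and involution and norm $\sup_n\|A_n\|$. $W(\mathbf{A})$ denotes the strong limit of $A_nP_n$. $\mathcal{S}_{L^\infty(\mathbb{T}), AP(\mathbb{Z})}(\mathbb{Z}^+)$ is the smallest closed $C^*$-subalgebra of $\mathcal{F}^{\mathcal{P}}$ containing all sequences $(P_nAP_n)$ with $A\in \mathcal{A}_{L^\infty(\mathbb{T}), AP(\mathbb{Z})}(\mathbb{Z}^+)$; for $\mathbf{A}$ in it, $W(\mathbf{A})\in\mathcal{A}_{L^\infty(\mathbb{T}), AP(\mathbb{Z})}(\mathbb{Z}^+)$. For $A\in L(l^2(\mathbb{Z}^+))$ with matrix $(a_{ij})_{i,j\ge0}$, $D(A)$ is the sequence $(a_{ii})_{i\ge0}$. For each $A\in\mathcal{A}_{L^\infty(\mathbb{T}), AP(\mathbb{Z})}(\mathbb{Z}^+)$ there is a unique $f\in AP(\mathbb{Z})$ such that $D(A)-f|_{\mathbb{Z}^+}$ tends to $0$ at $+\infty$; one sets $D_{ap}(A):=f$. For $f\in AP(\mathbb{Z})$, the mean value is $M(f):=\lim_{n\to\infty}\frac1n\sum_{r=0}^{n-1}f(r)$ (the limit exists). $\lambda_1(B),\dots,\lambda_n(B)$ are the eigenvalues of an $n\times n$ matrix $B$, counted with algebraic multiplicity. *)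

theory Defs
  imports
    "HOL-Analysis.Analysis"
    "Jordan_Normal_Form.Spectral_Radius"
begin

section \<open>The Hilbert spaces of square-summable families\<close>

typedef 'a ell2 = "{x :: 'a \<Rightarrow> complex. (\<lambda>i. (cmod (x i))\<^sup>2) summable_on UNIV}"
  morphisms coord Abs_ell2
  by (rule exI[of _ "\<lambda>_. 0"]) auto

setup_lifting type_definition_ell2

lemma ell2_summable_add:
  fixes x y :: "'a \<Rightarrow> complex"
  assumes "(\<lambda>i. (cmod (x i))\<^sup>2) summable_on A" "(\<lambda>i. (cmod (y i))\<^sup>2) summable_on A"
  shows "(\<lambda>i. (cmod (x i + y i))\<^sup>2) summable_on A"
proof (rule summable_on_comparison_test)
  show "(\<lambda>i. 2 * (cmod (x i))\<^sup>2 + 2 * (cmod (y i))\<^sup>2) summable_on A"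
    by (intro summable_on_add summable_on_cmult_right assms)
  show "(cmod (x i + y i))\<^sup>2 \<le> 2 * (cmod (x i))\<^sup>2 + 2 * (cmod (y i))\<^sup>2" for i
  proof -
    have "(cmod (x i + y i))\<^sup>2 \<le> (cmod (x i) + cmod (y i))\<^sup>2"
      by (simp add: norm_triangle_ineq power_mono)
    also have "\<dots> \<le> 2 * (cmod (x i))\<^sup>2 + 2 * (cmod (y i))\<^sup>2"
      using sum_squares_bound[of "cmod (x i)" "cmod (y i)"] by (simp add: power2_sum)
    finally show ?thesis .
  qed
qed auto

lemma ell2_summable_mult:
  fixes x y :: "'a \<Rightarrow> complex"
  assumes "(\<lambda>i. (cmod (x i))\<^sup>2) summable_on A" "(\<lambda>i. (cmod (y i))\<^sup>2) summable_on A"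
  shows "(\<lambda>i. cnj (x i) * y i) summable_on A"
proof (rule abs_summable_summable, rule summable_on_comparison_test)
  show "(\<lambda>i. (cmod (x i))\<^sup>2 + (cmod (y i))\<^sup>2) summable_on A"
    by (intro summable_on_add assms)
  show "norm (cnj (x i) * y i) \<le> (cmod (x i))\<^sup>2 + (cmod (y i))\<^sup>2" for i
  proof -
    have "2 * cmod (x i) * cmod (y i) \<le> (cmod (x i))\<^sup>2 + (cmod (y i))\<^sup>2"
      using sum_squares_bound[of "cmod (x i)" "cmod (y i)"] by simp
    moreover have "0 \<le> cmod (x i) * cmod (y i)" by simp
    ultimately have "cmod (x i) * cmod (y i) \<le> (cmod (x i))\<^sup>2 + (cmod (y i))\<^sup>2" by linarith
    then show ?thesis by (simp add: norm_mult)
  qed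
qed auto

lemma ell2_summable_cmult:
  fixes x :: "'a \<Rightarrow> complex"
  assumes "(\<lambda>i. (cmod (x i))\<^sup>2) summable_on A"
  shows "(\<lambda>i. (cmod (c * x i))\<^sup>2) summable_on A"
  using assms by (simp add: norm_mult power_mult_distrib summable_on_cmult_right)

lift_definition cscale :: "complex \<Rightarrow> 'a ell2 \<Rightarrow> 'a ell2" is "\<lambda>c x i. c * x i"
  by (rule ell2_summable_cmult)

lift_definition cinner :: "'a ell2 \<Rightarrow> 'a ell2 \<Rightarrow> complex"
  is "\<lambda>x y. \<Sum>\<^sub>\<infinity>i. cnj (x i) * y i" .

lemma Re_cnj_mult_self: "Re (cnj z * z) = (cmod z)\<^sup>2"
  by (subst cmod_power2) (simp add: power2_eq_square)

lemma cinner_summable: "(\<lambda>i. cnj (coord x i) * coord y i) summable_on UNIV"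
  using coord[of x] coord[of y] by (intro ell2_summable_mult) auto

instantiation ell2 :: (type) real_inner
begin

lift_definition zero_ell2 :: "'a ell2" is "\<lambda>_. 0" by simp
lift_definition plus_ell2 :: "'a ell2 \<Rightarrow> 'a ell2 \<Rightarrow> 'a ell2" is "\<lambda>x y i. x i + y i"
  by (rule ell2_summable_add)
lift_definition uminus_ell2 :: "'a ell2 \<Rightarrow> 'a ell2" is "\<lambda>x i. - x i" by simp
lift_definition minus_ell2 :: "'a ell2 \<Rightarrow> 'a ell2 \<Rightarrow> 'a ell2" is "\<lambda>x y i. x i - y i"
  subgoal for x y using ell2_summable_add[of x UNIV "\<lambda>i. - y i"] by simp
  done
lift_definition scaleR_ell2 :: "real \<Rightarrow> 'a ell2 \<Rightarrow> 'a ell2" is "\<lambda>r x i. of_real r * x i"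
  by (rule ell2_summable_cmult)
definition inner_ell2 :: "'a ell2 \<Rightarrow> 'a ell2 \<Rightarrow> real" where "inner_ell2 x y = Re (cinner x y)"
definition norm_ell2 :: "'a ell2 \<Rightarrow> real" where "norm_ell2 x = sqrt (Re (cinner x x))"
definition dist_ell2 :: "'a ell2 \<Rightarrow> 'a ell2 \<Rightarrow> real" where "dist_ell2 x y = norm (x - y)"
definition sgn_ell2 :: "'a ell2 \<Rightarrow> 'a ell2" where "sgn_ell2 x = inverse (norm x) *\<^sub>R x"
definition uniformity_ell2 :: "('a ell2 \<times> 'a ell2) filter"
  where "uniformity_ell2 = (INF e\<in>{0<..}. principal {(x, y). dist x y < e})"
definition open_ell2 :: "'a ell2 set \<Rightarrow> bool"
  where "open_ell2 U = (\<forall>x\<in>U. eventually (\<lambda>(x', y). x' = x \<longrightarrow> y \<in> U) uniformity)"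

instance
proof
  fix x y z :: "'a ell2" and r s :: real
  show "x + y + z = x + (y + z)" by transfer (simp add: add.assoc)
  show "x + y = y + x" by transfer (simp add: add.commute)
  show "0 + x = x" by transfer simp
  show "- x + x = 0" by transfer simp
  show "x - y = x + - y" by transfer simp
  show "r *\<^sub>R (x + y) = r *\<^sub>R x + r *\<^sub>R y" by transfer (simp add: distrib_left)
  show "(r + s) *\<^sub>R x = r *\<^sub>R x + s *\<^sub>R x" by transfer (simp add: distrib_right)
  show "r *\<^sub>R s *\<^sub>R x = (r * s) *\<^sub>R x" by transfer (simp add: mult.assoc)
  show "1 *\<^sub>R x = x" by transfer simp
  show "sgn x = inverse (norm x) *\<^sub>R x" by (rule sgn_ell2_def)
  show "dist x y = norm (x - y)" by (rule dist_ell2_def)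
  show "uniformity = (INF e\<in>{0<..}. principal {(x :: 'a ell2, y). dist x y < e})"
    by (rule uniformity_ell2_def)
  show "open U = (\<forall>x\<in>U. eventually (\<lambda>(x', y). x' = x \<longrightarrow> y \<in> U) uniformity)"
    for U :: "'a ell2 set" by (rule open_ell2_def)
  show "norm x = sqrt (inner x x)" by (simp add: norm_ell2_def inner_ell2_def)
  have "cinner x y = cnj (cinner y x)"
    by (simp add: cinner.rep_eq mult.commute flip: infsum_cnj)
  then show "inner x y = inner y x" by (simp add: inner_ell2_def)
  have "cinner (x + y) z = cinner x z + cinner y z"
    by (simp add: cinner.rep_eq plus_ell2.rep_eq distrib_right infsum_add cinner_summable)
  then show "inner (x + y) z = inner x z + inner y z" by (simp add: inner_ell2_def)
  have "cinner (r *\<^sub>R x) y = of_real r * cinner x y"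
    by (simp add: cinner.rep_eq scaleR_ell2.rep_eq mult.assoc infsum_cmult_right')
  then show "inner (r *\<^sub>R x) y = r * inner x y" by (simp add: inner_ell2_def)
  have sq: "inner x x = (\<Sum>\<^sub>\<infinity>i. (cmod (coord x i))\<^sup>2)"
    unfolding inner_ell2_def cinner.rep_eq
    by (subst infsum_Re[OF cinner_summable, symmetric])
       (simp only: Re_cnj_mult_self)
  show "0 \<le> inner x x" unfolding sq by (rule infsum_nonneg) simp
  show "inner x x = 0 \<longleftrightarrow> x = 0"
  proof
    assume "inner x x = 0"
    then have "coord x i = 0" for i
      using nonneg_infsum_le_0D[of "\<lambda>i. (cmod (coord x i))\<^sup>2" UNIV i] coord[of x] by (simp add: sq)
    then show "x = 0" by (intro coord_inject[THEN iffD1]) (auto simp: zero_ell2.rep_eq)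
  next
    assume "x = 0" then show "inner x x = 0" unfolding sq by (simp add: zero_ell2.rep_eq)
  qed
qed

end

lemma norm_ell2_sq: "(norm x)\<^sup>2 = (\<Sum>\<^sub>\<infinity>i. (cmod (coord x i))\<^sup>2)"
proof -
  have "(norm x)\<^sup>2 = Re (\<Sum>\<^sub>\<infinity>i. cnj (coord x i) * coord x i)"
    by (simp only: power2_norm_eq_inner inner_ell2_def cinner.rep_eq)
  also have "\<dots> = (\<Sum>\<^sub>\<infinity>i. (cmod (coord x i))\<^sup>2)"
    by (subst infsum_Re[OF cinner_summable, symmetric]) (simp only: Re_cnj_mult_self)
  finally show ?thesis .
qed

lemma norm_cscale: "norm (cscale c x) = cmod c * norm x"
proof -
  have "(norm (cscale c x))\<^sup>2 = (cmod c * norm x)\<^sup>2"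
    by (simp add: norm_ell2_sq cscale.rep_eq norm_mult power_mult_distrib infsum_cmult_right')
  then show ?thesis by (simp add: power2_eq_iff_nonneg)
qed

lemma bounded_linear_cscale: "bounded_linear (cscale c)"
proof (rule bounded_linear_intro[where K = "cmod c"])
  show "cscale c (x + y) = cscale c x + cscale c y" for x y :: "'a ell2"
    by transfer (simp add: distrib_left)
  show "cscale c (r *\<^sub>R x) = r *\<^sub>R cscale c x" for r and x :: "'a ell2"
    by transfer (simp add: mult.left_commute)
qed (simp add: norm_cscale mult.commute)


section \<open>Operators\<close>

(* The type \<Rightarrow>\<^sub>L consists of the bounded real-linear operators; L(l^2) is the
   subset of the complex-linear ones. *)
definition complex_linear :: "('a ell2 \<Rightarrow>\<^sub>L 'b ell2) \<Rightarrow> bool" where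
  "complex_linear T \<longleftrightarrow> (\<forall>c x. T (cscale c x) = cscale c (T x))"

definition is_adjoint :: "('b ell2 \<Rightarrow>\<^sub>L 'a ell2) \<Rightarrow> ('a ell2 \<Rightarrow>\<^sub>L 'b ell2) \<Rightarrow> bool" where
  "is_adjoint R T \<longleftrightarrow> (\<forall>x y. cinner (R y) x = cinner y (T x))"

definition cscale_op :: "complex \<Rightarrow> ('a ell2 \<Rightarrow>\<^sub>L 'b ell2) \<Rightarrow> ('a ell2 \<Rightarrow>\<^sub>L 'b ell2)" where
  "cscale_op c T = Blinfun (\<lambda>x. cscale c (T x))"

lemma cscale_op_apply: "cscale_op c T x = cscale c (T x)"
  unfolding cscale_op_def
  by (subst bounded_linear_Blinfun_apply)
     (auto intro: bounded_linear_compose[OF bounded_linear_cscale blinfun.bounded_linear_right])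

definition closed_star_subalgebra :: "('a ell2 \<Rightarrow>\<^sub>L 'a ell2) set \<Rightarrow> bool" where
  "closed_star_subalgebra S \<longleftrightarrow>
     S \<subseteq> Collect complex_linear \<and> 0 \<in> S \<and> closed S \<and>
     (\<forall>A\<in>S. \<forall>B\<in>S. A + B \<in> S \<and> A o\<^sub>L B \<in> S) \<and>
     (\<forall>c. \<forall>A\<in>S. cscale_op c A \<in> S) \<and>
     (\<forall>A\<in>S. \<forall>R. is_adjoint R A \<longrightarrow> R \<in> S)"

lift_definition unit_vector :: "'a \<Rightarrow> 'a ell2" is "\<lambda>j i. if i = j then 1 else 0"
proof -
  fix j :: 'a
  have "(\<lambda>i. (cmod (if i = j then 1 else 0))\<^sup>2) summable_on {j}" by simp
  then show "(\<lambda>i. (cmod (if i = j then 1 else 0))\<^sup>2) summable_on UNIV"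
    by (rule summable_on_cong_neutral[THEN iffD1, rotated -1]) auto
qed

definition entry :: "('a ell2 \<Rightarrow>\<^sub>L 'a ell2) \<Rightarrow> 'a \<Rightarrow> 'a \<Rightarrow> complex" where
  "entry T i j = coord (T (unit_vector j)) i"

lift_definition extend :: "nat ell2 \<Rightarrow> int ell2" is "\<lambda>x i. if i \<ge> 0 then x (nat i) else 0"
proof -
  fix x :: "nat \<Rightarrow> complex" assume "(\<lambda>i. (cmod (x i))\<^sup>2) summable_on UNIV"
  then have "(\<lambda>i. (cmod (x (nat i)))\<^sup>2) summable_on (int ` UNIV)"
    by (subst summable_on_reindex) (auto simp: o_def)
  then show "(\<lambda>i. (cmod (if i \<ge> 0 then x (nat i) else 0))\<^sup>2) summable_on UNIV"
    by (rule summable_on_cong_neutral[THEN iffD1, rotated -1]) (auto simp: image_iff, metis nat_0_le)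
qed

lift_definition restr :: "int ell2 \<Rightarrow> nat ell2" is "\<lambda>x i. x (int i)"
proof -
  fix x :: "int \<Rightarrow> complex" assume "(\<lambda>i. (cmod (x i))\<^sup>2) summable_on UNIV"
  then have "(\<lambda>i. (cmod (x i))\<^sup>2) summable_on (int ` UNIV)"
    by (rule summable_on_subset_banach) simp
  then show "(\<lambda>i. (cmod (x (int i)))\<^sup>2) summable_on UNIV"
    by (subst (asm) summable_on_reindex) (auto simp: o_def)
qed

(* PTP as an operator on l^2(Z^+): the inclusion of l^2(Z^+) into l^2(Z) is extension by zero. *)
definition compression :: "(int ell2 \<Rightarrow>\<^sub>L int ell2) \<Rightarrow> (nat ell2 \<Rightarrow>\<^sub>L nat ell2)" where
  "compression T = Blinfun (\<lambda>x. restr (T (extend x)))"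

lemma bounded_linear_extend: "bounded_linear extend"
proof (rule bounded_linear_intro[where K = 1])
  show "extend (x + y) = extend x + extend y" for x y by transfer auto
  show "extend (r *\<^sub>R x) = r *\<^sub>R extend x" for r x by transfer auto
  show "norm (extend x) \<le> norm x * 1" for x
  proof -
    have "(norm (extend x))\<^sup>2 = (\<Sum>\<^sub>\<infinity>i\<in>range int. (cmod (coord x (nat i)))\<^sup>2)"
      unfolding norm_ell2_sq extend.rep_eq
      by (rule infsum_cong_neutral) (auto simp: image_iff, metis nat_0_le)
    also have "\<dots> = (norm x)\<^sup>2"
      unfolding norm_ell2_sq by (subst infsum_reindex) (auto simp: o_def)
    finally show ?thesis by (simp add: power2_eq_iff_nonneg)
  qed
qed

lemma bounded_linear_restr: "bounded_linear restr"
proof (rule bounded_linear_intro[where K = 1])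
  show "restr (x + y) = restr x + restr y" for x y by transfer auto
  show "restr (r *\<^sub>R x) = r *\<^sub>R restr x" for r x by transfer auto
  show "norm (restr x) \<le> norm x * 1" for x
  proof -
    have s: "(\<lambda>i. (cmod (coord x i))\<^sup>2) summable_on UNIV" using coord[of x] by simp
    have "(norm (restr x))\<^sup>2 = (\<Sum>\<^sub>\<infinity>i\<in>range int. (cmod (coord x i))\<^sup>2)"
      unfolding norm_ell2_sq restr.rep_eq by (subst infsum_reindex) (auto simp: o_def)
    also have "\<dots> \<le> (norm x)\<^sup>2"
      unfolding norm_ell2_sq
      by (rule infsum_mono_neutral) (auto intro: summable_on_subset_banach[OF s] s)
    finally show ?thesis by (simp add: power2_le_iff_abs_le)
  qed
qed

lemma compression_apply: "compression T x = restr (T (extend x))"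
  unfolding compression_def
  by (subst bounded_linear_Blinfun_apply)
     (auto intro!: bounded_linear_compose[OF bounded_linear_restr]
        bounded_linear_compose[OF blinfun.bounded_linear_right bounded_linear_extend])


section \<open>The algebra generated by Toeplitz operators and almost periodic multiplications\<close>

(* A function on the unit circle is integrated along t |-> cis t, 0 \<le> t \<le> 2 pi. *)
definition Linf_circle :: "(complex \<Rightarrow> complex) set" where
  "Linf_circle = {a. (\<lambda>t. a (cis t)) \<in> borel_measurable (lebesgue_on {0..2*pi}) \<and>
                     (\<exists>C. AE t in lebesgue_on {0..2*pi}. cmod (a (cis t)) \<le> C)}"

definition fourier_coeff :: "(complex \<Rightarrow> complex) \<Rightarrow> int \<Rightarrow> complex" where
  "fourier_coeff a j =
     (LINT t|lebesgue_on {0..2*pi}. a (cis t) * cis (- (of_int j * t))) / (2 * pi)"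

(* For a in L^\<infinity> the sums converge and define a bounded operator on l^2(Z), whose
   (i,j) entry is the Fourier coefficient with index i - j. *)
definition laurent :: "(complex \<Rightarrow> complex) \<Rightarrow> (int ell2 \<Rightarrow>\<^sub>L int ell2)" where
  "laurent a =
     Blinfun (\<lambda>x. Abs_ell2 (\<lambda>i. \<Sum>\<^sub>\<infinity>j. fourier_coeff a (i - j) * coord x j))"

definition toeplitz :: "(complex \<Rightarrow> complex) \<Rightarrow> (nat ell2 \<Rightarrow>\<^sub>L nat ell2)" where
  "toeplitz a = compression (laurent a)"

(* As int carries the discrete topology, the type int \<Rightarrow>\<^sub>C complex is l^\<infinity>(Z)
   with the supremum norm. *)
setup_lifting type_definition_bcontfun

lift_definition translate :: "int \<Rightarrow> (int \<Rightarrow>\<^sub>C complex) \<Rightarrow> (int \<Rightarrow>\<^sub>C complex)"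
  is "\<lambda>k b n. b (n + k)"
proof -
  fix k :: int and b :: "int \<Rightarrow> complex" assume "b \<in> bcontfun"
  then have "bounded (range b)" by (simp add: bcontfun_def)
  then have "bounded (range (\<lambda>n. b (n + k)))" by (rule bounded_subset) auto
  then show "(\<lambda>n. b (n + k)) \<in> bcontfun" by (simp add: bcontfun_def)
qed

definition AP :: "(int \<Rightarrow>\<^sub>C complex) set" where
  "AP = {b. compact (closure (range (\<lambda>k. translate k b)))}"

lift_definition mult_fun :: "(int \<Rightarrow>\<^sub>C complex) \<Rightarrow> int ell2 \<Rightarrow> int ell2" is "\<lambda>b x i. b i * x i"
proof -
  fix b x :: "int \<Rightarrow> complex"
  assume "b \<in> bcontfun" and s: "(\<lambda>i. (cmod (x i))\<^sup>2) summable_on UNIV"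
  then obtain C where C: "\<And>i. cmod (b i) \<le> C" by (auto simp: bcontfun_def bounded_iff)
  show "(\<lambda>i. (cmod (b i * x i))\<^sup>2) summable_on UNIV"
  proof (rule summable_on_comparison_test)
    show "(\<lambda>i. C\<^sup>2 * (cmod (x i))\<^sup>2) summable_on UNIV" by (rule summable_on_cmult_right[OF s])
    show "(cmod (b i * x i))\<^sup>2 \<le> C\<^sup>2 * (cmod (x i))\<^sup>2" for i
      using C[of i] by (simp add: norm_mult power_mult_distrib mult_right_mono power_mono)
  qed auto
qed

definition mult_op :: "(int \<Rightarrow>\<^sub>C complex) \<Rightarrow> (int ell2 \<Rightarrow>\<^sub>L int ell2)" where
  "mult_op b = Blinfun (mult_fun b)"

lemma mult_op_apply: "mult_op b x = mult_fun b x"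
proof -
  have "bounded_linear (mult_fun b)"
  proof (rule bounded_linear_intro[where K = "norm b"])
    show "mult_fun b (x + y) = mult_fun b x + mult_fun b y" for x y
      by transfer (simp add: distrib_left)
    show "mult_fun b (r *\<^sub>R x) = r *\<^sub>R mult_fun b x" for r x
      by transfer (simp add: mult.left_commute)
    show "norm (mult_fun b x) \<le> norm x * norm b" for x
    proof -
      have s: "(\<lambda>i. (cmod (coord y i))\<^sup>2) summable_on UNIV" for y :: "int ell2"
        using coord[of y] by simp
      have "(norm (mult_fun b x))\<^sup>2 \<le> (\<Sum>\<^sub>\<infinity>i. (norm b)\<^sup>2 * (cmod (coord x i))\<^sup>2)"
        unfolding norm_ell2_sq
      proof (rule infsum_mono)
        show "(cmod (coord (mult_fun b x) i))\<^sup>2 \<le> (norm b)\<^sup>2 * (cmod (coord x i))\<^sup>2" for i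
          using norm_bounded[of b i]
          by (simp add: mult_fun.rep_eq norm_mult power_mult_distrib mult_right_mono power_mono)
      qed (auto intro: s summable_on_cmult_right)
      also have "\<dots> = (norm x * norm b)\<^sup>2"
        by (simp add: norm_ell2_sq power_mult_distrib infsum_cmult_right' mult.commute)
      finally show ?thesis by (rule power2_le_imp_le) simp
    qed
  qed
  then show ?thesis by (simp add: mult_op_def bounded_linear_Blinfun_apply)
qed

definition alg_A :: "(nat ell2 \<Rightarrow>\<^sub>L nat ell2) set" where
  "alg_A = closed_star_subalgebra hull
     (toeplitz ` Linf_circle \<union> (\<lambda>b. compression (mult_op b)) ` AP)"


section \<open>Sequences of finite matrices\<close>

(* An operator on im P_n is its n x n matrix with respect to the standard basis; for such a
   matrix A, mat_op A is A P_n. *)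
lift_definition mat_op :: "complex mat \<Rightarrow> nat ell2 \<Rightarrow> nat ell2"
  is "\<lambda>A x i. if i < dim_row A then \<Sum>j<dim_col A. A $$ (i, j) * x j else 0"
proof -
  fix A :: "complex mat" and x :: "nat \<Rightarrow> complex"
  have "(\<lambda>i. (cmod (if i < dim_row A then \<Sum>j<dim_col A. A $$ (i, j) * x j else 0))\<^sup>2)
      summable_on {..<dim_row A}" by simp
  then show "(\<lambda>i. (cmod (if i < dim_row A then \<Sum>j<dim_col A. A $$ (i, j) * x j else 0))\<^sup>2)
      summable_on UNIV"
    by (rule summable_on_cong_neutral[THEN iffD1, rotated -1]) auto
qed

definition strong_limit :: "(nat \<Rightarrow> complex mat) \<Rightarrow> (nat ell2 \<Rightarrow>\<^sub>L nat ell2) \<Rightarrow> bool" where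
  "strong_limit A T \<longleftrightarrow> (\<forall>x. (\<lambda>n. mat_op (A n) x) \<longlonglongrightarrow> T x)"

definition alg_F :: "(nat \<Rightarrow> complex mat) set" where
  "alg_F = {A. (\<forall>n. A n \<in> carrier_mat n n) \<and>
               (\<exists>T. strong_limit A T) \<and> (\<exists>T. strong_limit (\<lambda>n. mat_adjoint (A n)) T)}"

definition W :: "(nat \<Rightarrow> complex mat) \<Rightarrow> (nat ell2 \<Rightarrow>\<^sub>L nat ell2)" where
  "W A = (THE T. strong_limit A T)"

(* The supremum is finite on alg_F by the uniform boundedness principle; taking it in ennreal
   avoids the junk value of an unbounded real supremum. *)
definition seq_norm :: "(nat \<Rightarrow> complex mat) \<Rightarrow> ennreal" where
  "seq_norm A = (SUP n. ennreal (onorm (mat_op (A n))))"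

definition closed_star_subalgebra_F :: "(nat \<Rightarrow> complex mat) set \<Rightarrow> bool" where
  "closed_star_subalgebra_F S \<longleftrightarrow>
     S \<subseteq> alg_F \<and> (\<lambda>n. 0\<^sub>m n n) \<in> S \<and>
     (\<forall>A\<in>alg_F. (\<forall>e>0. \<exists>B\<in>S. seq_norm (\<lambda>n. A n - B n) < e) \<longrightarrow> A \<in> S) \<and>
     (\<forall>A\<in>S. \<forall>B\<in>S. (\<lambda>n. A n + B n) \<in> S \<and> (\<lambda>n. A n * B n) \<in> S) \<and>
     (\<forall>c. \<forall>A\<in>S. (\<lambda>n. c \<cdot>\<^sub>m A n) \<in> S) \<and>
     (\<forall>A\<in>S. (\<lambda>n. mat_adjoint (A n)) \<in> S)"

definition finite_section :: "(nat ell2 \<Rightarrow>\<^sub>L nat ell2) \<Rightarrow> nat \<Rightarrow> complex mat" where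
  "finite_section T n = mat n n (\<lambda>(i, j). entry T i j)"

definition alg_S :: "(nat \<Rightarrow> complex mat) set" where
  "alg_S = closed_star_subalgebra_F hull (finite_section ` alg_A)"


section \<open>Almost periodic part of the diagonal, mean value, eigenvalues\<close>

definition D_ap :: "(nat ell2 \<Rightarrow>\<^sub>L nat ell2) \<Rightarrow> (int \<Rightarrow>\<^sub>C complex)" where
  "D_ap T = (THE f. f \<in> AP \<and> (\<lambda>i. entry T i i - f (int i)) \<longlonglongrightarrow> 0)"

definition mean :: "(int \<Rightarrow>\<^sub>C complex) \<Rightarrow> complex" where
  "mean f = lim (\<lambda>n. (\<Sum>r<n. f (int r)) / of_nat n)"

definition eigenvalues :: "complex mat \<Rightarrow> complex multiset" where
  "eigenvalues B = proots (char_poly B)"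

end

theory Submission
  imports Defs
begin

text \<open>
  The columns of an operator \<open>T\<close> in the algebra are, uniformly far out, \<open>\<epsilon>\<close>-close to the columns of a band
  operator with almost periodic diagonals. This property survives products without any norm bound
  on the band operator (approximate the right factor first), and for \<open>T(a)\<close> it only uses that the
  Fourier coefficients of \<open>a\<close> are square summable. It has two consequences: the main diagonal of \<open>T\<close> is
  almost periodic up to a null sequence, and \<open>(1 - P\<^sub>n) T P\<^sub>n\<close> has squared Hilbert-Schmidt norm \<open>o(n)\<close>.
  By the latter, \<open>P\<^sub>n T S P\<^sub>n - (P\<^sub>n T P\<^sub>n) (P\<^sub>n S P\<^sub>n)\<close> has squared Hilbert-Schmidt norm \<open>o(n)\<close>, hence so
  has \<open>A\<^sub>n - P\<^sub>n W(A) P\<^sub>n\<close> for every sequence in the algebra, and by the Cauchy-Schwarz inequality the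
  normalised traces of \<open>A\<^sub>n\<close> and \<open>P\<^sub>n W(A) P\<^sub>n\<close> have the same limit.
\<close>


section \<open>Almost periodic sequences\<close>

text \<open>A Toeplitz operator with discontinuous symbol is not a norm limit of band operators, so
  approximation in operator norm has to be given up; in a single column it survives, because a
  column only sees the l^2-size of the Fourier coefficients. There are two prices. The approximating
  bands need not stay bounded as operators when the tolerance shrinks (Fourier partial sums of a
  bounded function can be unbounded). And the condition is not symmetric, so it is imposed on an
  operator and on its adjoint. The Hilbert-Schmidt norm is the matching notion for matrices: it adds
  up over columns, so a column error \<open>e\<close> costs \<open>n * e^2\<close>, which the factor
  \<open>1 / n\<close> in front of the trace turns into \<open>e^2\<close>. Since both algebras are
  hulls, no element is ever described: it suffices that the operators in question, and the sequences
  close to the finite sections of their own limit, form closed star-algebras containing the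
  generators.\<close>

lemma translate_apply [simp]: "translate k b n = b (n + k)"
  by (simp add: translate.rep_eq)

lemma translate_0 [simp]: "translate 0 f = f"
  by (rule bcontfun_eqI) simp

lemma translate_translate [simp]: "translate k (translate l f) = translate (k + l) f"
  by (rule bcontfun_eqI) (simp add: add.assoc)

lemma translate_add: "translate k (f + g) = translate k f + translate k g"
  by (rule bcontfun_eqI) (simp add: plus_bcontfun.rep_eq)

lemma translate_diff: "translate k (f - g) = translate k f - translate k g"
  by (rule bcontfun_eqI) (simp add: minus_bcontfun.rep_eq)

lemma norm_translate_le: "norm (translate k f) \<le> norm f"
  by (rule norm_bound) (simp add: norm_bounded)

lemma norm_translate [simp]: "norm (translate k f) = norm f"
  using norm_translate_le[of k f] norm_translate_le[of "- k" "translate k f"] by simp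

lemma bounded_bcontfun_int: "f \<in> bcontfun \<longleftrightarrow> bounded (range f)" for f :: "int \<Rightarrow> complex"
  by (simp add: bcontfun_def)

lift_definition bmult :: "(int \<Rightarrow>\<^sub>C complex) \<Rightarrow> (int \<Rightarrow>\<^sub>C complex) \<Rightarrow> (int \<Rightarrow>\<^sub>C complex)"
  is "\<lambda>f g n. f n * g n"
proof -
  fix f g :: "int \<Rightarrow> complex" assume "f \<in> bcontfun" "g \<in> bcontfun"
  then obtain C D where C: "\<And>n. cmod (f n) \<le> C" and D: "\<And>n. cmod (g n) \<le> D"
    by (auto simp: bounded_bcontfun_int bounded_iff)
  have "cmod (f n * g n) \<le> C * D" for n
    unfolding norm_mult by (rule mult_mono[OF C D]) (use C[of n] norm_ge_zero[of "f n"] in linarith, simp)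
  then show "(\<lambda>n. f n * g n) \<in> bcontfun"
    by (auto simp: bounded_bcontfun_int bounded_iff)
qed

lift_definition bcnj :: "(int \<Rightarrow>\<^sub>C complex) \<Rightarrow> (int \<Rightarrow>\<^sub>C complex)" is "\<lambda>f n. cnj (f n)"
  by (auto simp: bounded_bcontfun_int bounded_iff)

lemma bmult_apply [simp]: "bmult f g n = f n * g n"
  by (simp add: bmult.rep_eq)

lemma bcnj_apply [simp]: "bcnj f n = cnj (f n)"
  by (simp add: bcnj.rep_eq)

lemma bounded_bilinear_bmult: "bounded_bilinear bmult"
proof
  show "\<exists>K. \<forall>a b. norm (bmult a b) \<le> norm a * norm b * K"
    by (intro exI[of _ 1] allI norm_bound)
      (simp add: norm_mult mult_mono norm_bounded)
qed (auto intro!: bcontfun_eqI simp: plus_bcontfun.rep_eq scaleR_bcontfun.rep_eq algebra_simps)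

lemma bounded_linear_bcnj: "bounded_linear bcnj"
  by (rule bounded_linear_intro[where K = 1])
    (auto intro!: bcontfun_eqI norm_bound simp: plus_bcontfun.rep_eq scaleR_bcontfun.rep_eq norm_bounded)

lemma bounded_linear_translate: "bounded_linear (translate k)"
  by (rule bounded_linear_intro[where K = 1])
    (auto intro!: bcontfun_eqI simp: plus_bcontfun.rep_eq scaleR_bcontfun.rep_eq)

text \<open>The library proves completeness of \<^typ>\<open>'a \<Rightarrow>\<^sub>C 'b\<close> only for metric spaces \<^typ>\<open>'a\<close>,
  which \<^typ>\<open>int\<close> is not declared to be.\<close>
lemma convergent_bcontfun_int:
  fixes X :: "nat \<Rightarrow> (int \<Rightarrow>\<^sub>C complex)"
  assumes "Cauchy X"
  shows "convergent X"
proof -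
  have "uniformly_Cauchy_on UNIV (\<lambda>n. apply_bcontfun (X n))"
    using assms unfolding uniformly_Cauchy_on_def Cauchy_def by (metis dist_fun_lt_imp_dist_val_lt)
  then obtain g where "uniform_limit UNIV X g sequentially"
    using Cauchy_uniformly_convergent unfolding uniformly_convergent_on_def by blast
  then obtain l where "X \<longlonglongrightarrow> l"
    by (rule uniform_limit_bcontfunE[OF _ sequentially_bot])
  then show ?thesis by (rule convergentI)
qed

text \<open>The continuous image of the product of the two compact orbit closures is compact, and
  since \<open>\<phi>\<close> commutes with translation it contains every translate of
  \<open>\<phi> f g\<close>. Unary operations are treated as a \<open>\<phi>\<close> that ignores
  its second argument.\<close>

lemma AP_image2:
  assumes f: "f \<in> AP" and g: "g \<in> AP" and cont: "continuous_on UNIV (\<lambda>(x, y). \<phi> x y)"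
    and comm: "\<And>k. translate k (\<phi> f g) = \<phi> (translate k f) (translate k g)"
  shows "\<phi> f g \<in> AP"
proof -
  let ?K = "closure (range (\<lambda>k. translate k f)) \<times> closure (range (\<lambda>k. translate k g))"
  have c: "compact ((\<lambda>(x, y). \<phi> x y) ` ?K)"
  proof (rule compact_continuous_image)
    show "continuous_on ?K (\<lambda>(x, y). \<phi> x y)" by (rule continuous_on_subset[OF cont subset_UNIV])
    show "compact ?K" using f g unfolding AP_def mem_Collect_eq by (rule compact_Times)
  qed
  have "range (\<lambda>k. translate k (\<phi> f g)) \<subseteq> (\<lambda>(x, y). \<phi> x y) ` ?K"
  proof (rule image_subsetI)
    fix k
    have "translate k f \<in> closure (range (\<lambda>k. translate k f))" for f
      by (rule subsetD[OF closure_subset]) (rule rangeI)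
    then have "(translate k f, translate k g) \<in> ?K" by (intro SigmaI)
    then show "translate k (\<phi> f g) \<in> (\<lambda>(x, y). \<phi> x y) ` ?K"
      by (rule rev_image_eqI) (simp only: comm prod.case)
  qed
  then have "closure (range (\<lambda>k. translate k (\<phi> f g))) \<subseteq> (\<lambda>(x, y). \<phi> x y) ` ?K"
    by (intro closure_minimal compact_imp_closed c)
  then show ?thesis
    unfolding AP_def mem_Collect_eq using compact_Int_closed[OF c closed_closure] by (metis inf.absorb2)
qed

lemma AP_add: "f \<in> AP \<Longrightarrow> g \<in> AP \<Longrightarrow> f + g \<in> AP"
  by (rule AP_image2[where \<phi> = plus])
    (simp_all add: split_def translate_add continuous_on_add continuous_on_fst continuous_on_snd continuous_on_id)

lemma AP_diff: "f \<in> AP \<Longrightarrow> g \<in> AP \<Longrightarrow> f - g \<in> AP"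
  by (rule AP_image2[where \<phi> = minus])
    (simp_all add: split_def translate_diff continuous_on_diff continuous_on_fst continuous_on_snd continuous_on_id)

lemma AP_bmult: "f \<in> AP \<Longrightarrow> g \<in> AP \<Longrightarrow> bmult f g \<in> AP"
proof (rule AP_image2[where \<phi> = bmult])
  show "continuous_on UNIV (\<lambda>(x, y). bmult x y)"
    unfolding split_def
    by (intro bounded_bilinear.continuous_on[OF bounded_bilinear_bmult] continuous_on_fst continuous_on_snd
        continuous_on_id)
qed (auto intro: bcontfun_eqI)

lemma AP_bcnj: "f \<in> AP \<Longrightarrow> bcnj f \<in> AP"
proof (rule AP_image2[where \<phi> = "\<lambda>f _. bcnj f"])
  show "continuous_on UNIV (\<lambda>(x, y). bcnj x)"
    unfolding split_def
    by (intro bounded_linear.continuous_on[OF bounded_linear_bcnj] continuous_on_fst continuous_on_id)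
qed (auto intro: bcontfun_eqI)

lemma AP_translate: "f \<in> AP \<Longrightarrow> translate k f \<in> AP"
proof (rule AP_image2[where \<phi> = "\<lambda>f _. translate k f"])
  show "continuous_on UNIV (\<lambda>(x, y). translate k x)"
    unfolding split_def
    by (intro bounded_linear.continuous_on[OF bounded_linear_translate] continuous_on_fst continuous_on_id)
qed (simp_all add: add.commute)

lemma AP_const: "const_bcontfun c \<in> AP"
proof -
  have "translate k (const_bcontfun c) = const_bcontfun c" for k
    by (rule bcontfun_eqI) (simp add: const_bcontfun.rep_eq)
  then show ?thesis by (simp add: AP_def)
qed

text \<open>Compactness is completeness plus total boundedness, and the centres of a finite net can
  be taken among the translates themselves. Later arguments use this form to exchange an arbitrary
  translation for one of finitely many.\<close>

lemma AP_iff: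
  "b \<in> AP \<longleftrightarrow> (\<forall>e>0. \<exists>K. finite K \<and> (\<forall>n. \<exists>k\<in>K. norm (translate n b - translate k b) < e))"
  (is "_ \<longleftrightarrow> ?R")
proof
  assume "b \<in> AP"
  then have c: "compact (closure (range (\<lambda>k. translate k b)))" by (simp add: AP_def)
  show ?R
  proof (intro allI impI)
    fix e :: real assume e: "e > 0"
    have cover: "closure (range (\<lambda>k. translate k b)) \<subseteq> (\<Union>k\<in>UNIV. ball (translate k b) e)"
    proof
      fix x assume "x \<in> closure (range (\<lambda>k. translate k b))"
      then obtain k where "dist (translate k b) x < e"
        using e unfolding closure_approachable by auto
      then show "x \<in> (\<Union>k\<in>UNIV. ball (translate k b) e)" by auto
    qed
    obtain K where K: "finite K" "closure (range (\<lambda>k. translate k b)) \<subseteq> (\<Union>k\<in>K. ball (translate k b) e)"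
      by (rule compactE_image[OF c _ cover]) auto
    have "\<exists>k\<in>K. norm (translate n b - translate k b) < e" for n
    proof -
      have "translate n b \<in> closure (range (\<lambda>k. translate k b))"
        by (rule subsetD[OF closure_subset]) (rule rangeI)
      then have "translate n b \<in> (\<Union>k\<in>K. ball (translate k b) e)" using K(2) by blast
      then show ?thesis by (auto simp: dist_norm norm_minus_commute)
    qed
    with K(1) show "\<exists>K. finite K \<and> (\<forall>n. \<exists>k\<in>K. norm (translate n b - translate k b) < e)" by blast
  qed
next
  assume R: ?R
  have "\<exists>K. finite K \<and> closure (range (\<lambda>k. translate k b)) \<subseteq> (\<Union>x\<in>K. ball x e)" if e: "e > 0" for e
  proof -
    from R e obtain K where K: "finite K" "\<And>n. \<exists>k\<in>K. norm (translate n b - translate k b) < e / 2"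
      by (meson half_gt_zero)
    \<comment> \<open>Closed balls of half the radius: their finite union is closed, hence contains
      the closure of the orbit and not just the orbit.\<close>
    let ?U = "\<Union>k\<in>K. cball (translate k b) (e / 2)"
    have "closure (range (\<lambda>k. translate k b)) \<subseteq> ?U"
    proof (rule closure_minimal)
      show "range (\<lambda>k. translate k b) \<subseteq> ?U"
      proof clarify
        fix n from K(2)[of n] obtain k where "k \<in> K" "norm (translate n b - translate k b) < e / 2" ..
        then show "translate n b \<in> ?U" by (auto simp: dist_norm norm_minus_commute intro!: bexI[of _ k])
      qed
      show "closed ?U" using K(1) by auto
    qed
    also have "?U \<subseteq> (\<Union>x\<in>(\<lambda>k. translate k b) ` K. ball x e)" using e by fastforce
    finally show ?thesis using K(1) by (intro exI[of _ "(\<lambda>k. translate k b) ` K"]) simp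
  qed
  moreover have "complete (closure (range (\<lambda>k. translate k b)))"
  proof (rule completeI)
    fix X assume X: "\<forall>i. X i \<in> closure (range (\<lambda>k. translate k b))" "Cauchy X"
    from convergent_bcontfun_int[OF X(2)] obtain l where "X \<longlonglongrightarrow> l" by (auto simp: convergent_def)
    with X(1) show "\<exists>l\<in>closure (range (\<lambda>k. translate k b)). X \<longlonglongrightarrow> l"
      using closed_sequentially[OF closed_closure] by blast
  qed
  ultimately show "b \<in> AP"
    unfolding AP_def mem_Collect_eq compact_eq_totally_bounded by blast
qed

lemma AP_netE:
  assumes "b \<in> AP" "e > 0"
  obtains K where "finite K" "\<And>n. \<exists>k\<in>K. norm (translate n b - translate k b) < e"
  using assms(1)[unfolded AP_iff, rule_format, OF assms(2)] that by auto

text \<open>Translations are isometries, so a net for \<open>g\<close> also serves a nearby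
  \<open>f\<close>, at the cost of twice their distance.\<close>

lemma closed_AP: "closed AP"
proof -
  have "f \<in> AP" if *: "\<And>e. e > 0 \<Longrightarrow> \<exists>g\<in>AP. norm (g - f) < e" for f
    unfolding AP_iff
  proof (intro allI impI)
    fix e :: real assume e: "e > 0"
    then obtain g where g: "g \<in> AP" "norm (g - f) < e / 3" using *[of "e / 3"] by auto
    obtain K where K: "finite K" "\<And>n. \<exists>k\<in>K. norm (translate n g - translate k g) < e / 3"
      using AP_netE[OF g(1), of "e / 3"] e by auto
    have "\<exists>k\<in>K. norm (translate n f - translate k f) < e" for n
    proof -
      from K(2)[of n] obtain k where k: "k \<in> K" "norm (translate n g - translate k g) < e / 3" ..
      have eq: "translate n f - translate k f =
        translate k (g - f) - translate n (g - f) + (translate n g - translate k g)"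
        by (simp add: translate_diff)
      have "norm (translate n f - translate k f) \<le>
        norm (translate k (g - f)) + norm (translate n (g - f)) + norm (translate n g - translate k g)"
        unfolding eq by (intro norm_triangle_le add_mono norm_triangle_ineq4 order_refl)
      also have "\<dots> < e" using g(2) k(2) by simp
      finally show ?thesis using k(1) by blast
    qed
    with K(1) show "\<exists>K. finite K \<and> (\<forall>n. \<exists>k\<in>K. norm (translate n f - translate k f) < e)" by blast
  qed
  then show ?thesis
    by (metis closure_approachable closure_subset_eq dist_norm subsetI)
qed

text \<open>Arbitrarily large almost periods exist by pigeonhole: infinitely many forward translates
  lie near the same net point, and the difference of two such indices is an almost period because
  translation is isometric.\<close>

lemma AP_recurrent:
  assumes f: "f \<in> AP" and e: "e > 0"
  shows "\<exists>p\<ge>N. norm (translate (int p) f - f) < e"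
proof -
  obtain K where K: "finite K" "\<And>n. \<exists>k\<in>K. norm (translate n f - translate k f) < e / 2"
    using AP_netE[OF f, of "e / 2"] e by auto
  then obtain \<kappa> where \<kappa>: "\<And>n. \<kappa> n \<in> K" "\<And>n. norm (translate n f - translate (\<kappa> n) f) < e / 2"
    by metis
  have "finite ((\<lambda>n. \<kappa> (int n)) ` UNIV)" using \<kappa>(1) K(1) by (meson finite_subset image_subsetI)
  then obtain a where "infinite {b\<in>UNIV. \<kappa> (int b) = \<kappa> (int a)}"
    using pigeonhole_infinite[OF infinite_UNIV_nat] by blast
  then obtain b where b: "\<kappa> (int b) = \<kappa> (int a)" "b \<ge> a + N"
    by (auto simp: infinite_nat_iff_unbounded_le)
  have "translate (int (b - a)) f - f = translate (- int a) (translate (int b) f - translate (int a) f)"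
    using b(2) by (simp add: translate_diff of_nat_diff)
  then have "norm (translate (int (b - a)) f - f) = norm (translate (int b) f - translate (int a) f)"
    by simp
  also have "\<dots> < e"
    using norm_triangle_ineq4[of "translate (int b) f - translate (\<kappa> (int a)) f" "translate (int a) f - translate (\<kappa> (int a)) f"]
      \<kappa>(2)[of "int a"] \<kappa>(2)[of "int b"] b(1) by simp
  finally show ?thesis using b(2) by (intro exI[of _ "b - a"]) simp
qed

text \<open>An almost period carries any integer far to the right while hardly changing the value of
  \<open>f\<close> there. Hence an almost periodic function is determined by its behaviour at
  +\<infinity>, which makes \<open>D_ap\<close> well defined.\<close>

lemma AP_norm_le:
  assumes f: "f \<in> AP" and ev: "\<forall>\<^sub>F n in sequentially. cmod (f (int n)) \<le> c"
  shows "norm f \<le> c"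
proof (rule norm_bound)
  fix m
  obtain N where N: "\<And>n. n \<ge> N \<Longrightarrow> cmod (f (int n)) \<le> c" using ev by (auto simp: eventually_sequentially)
  show "norm (f m) \<le> c"
  proof (rule field_le_epsilon)
    fix e :: real assume "e > 0"
    \<comment> \<open>The summand \<open>nat (- m)\<close> ensures \<open>m + p \<ge> N\<close> also
      for negative \<open>m\<close>.\<close>
    then obtain p where p: "p \<ge> N + nat (- m)" "norm (translate (int p) f - f) < e"
      using AP_recurrent[OF f] by blast
    have "0 \<le> m + int p" "N \<le> nat (m + int p)" using p(1) by linarith+
    then have "cmod (f (m + int p)) \<le> c" using N[of "nat (m + int p)"] by simp
    moreover have "cmod (f (m + int p) - f m) \<le> e"
      using norm_bounded[of "translate (int p) f - f" m] p(2) by (simp add: minus_bcontfun.rep_eq)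
    ultimately show "norm (f m) \<le> c + e"
      using norm_triangle_ineq4[of "f (m + int p)" "f (m + int p) - f m"] by simp
  qed
qed

section \<open>Mean values of almost periodic sequences\<close>

lemma sum_shift_diff_le:
  fixes f :: "int \<Rightarrow>\<^sub>C complex"
  shows "cmod ((\<Sum>r<n. f (int r + k)) - (\<Sum>r<n. f (int r))) \<le> 2 * norm f * of_int \<bar>k\<bar>"
proof -
  define S where "S l = (\<Sum>r<n. f (int r + l))" for l
  \<comment> \<open>Moving the window of summation by one place exchanges only its two end terms;
    \<open>\<bar>k\<bar>\<close> such moves give a bound that does not depend on
    \<open>n\<close>.\<close>
  have step: "cmod (S (l + 1) - S l) \<le> 2 * norm f" for l
  proof -
    have eq: "int (Suc r) + l = int r + (l + 1)" for r by simp
    have "S (l + 1) - S l = (\<Sum>r<n. f (int (Suc r) + l) - f (int r + l))"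
      unfolding S_def sum_subtractf eq ..
    also have "\<dots> = f (int n + l) - f (int 0 + l)" by (rule sum_lessThan_telescope)
    finally show ?thesis
      using norm_triangle_ineq4[of "f (int n + l)" "f l"] norm_bounded[of f "int n + l"] norm_bounded[of f l]
      by simp
  qed
  have "cmod (S k - S 0) \<le> 2 * norm f * of_int \<bar>k\<bar>"
  proof (induction k rule: int_induct[where k = 0])
    case (step1 i)
    have "cmod (S (i + 1) - S 0) \<le> 2 * norm f + 2 * norm f * of_int \<bar>i\<bar>"
      using norm_triangle_mono[OF step[of i] step1(2)] by simp
    also have "\<dots> = 2 * norm f * of_int \<bar>i + 1\<bar>" using step1(1) by (simp add: distrib_left)
    finally show ?case .
  next
    case (step2 i)
    have "cmod (S (i - 1) - S 0) \<le> 2 * norm f + 2 * norm f * of_int \<bar>i\<bar>"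
      using norm_triangle_mono[OF step[of "i - 1"] step2(2)] norm_triangle_ineq4[of "S i - S 0" "S i - S (i - 1)"]
        step[of "i - 1"] step2(2) by simp
    also have "\<dots> = 2 * norm f * of_int \<bar>i - 1\<bar>" using step2(1) by (simp add: algebra_simps)
    finally show ?case .
  qed simp
  then show ?thesis by (simp add: S_def)
qed

text \<open>The partial sums \<open>g\<close> are nearly additive: \<open>g (m + n)\<close> and
  \<open>g m + g n\<close> differ by at most \<open>n * e + C\<close>, with \<open>C\<close>
  depending on \<open>e\<close> alone. As for subadditive sequences, this makes
  \<open>g (q * n)\<close> close to \<open>q * g n\<close>, so the average over \<open>n\<close>
  terms is close to the one over any multiple of \<open>n\<close>.\<close>

lemma AP_mean_convergent:
  assumes f: "f \<in> AP"
  shows "convergent (\<lambda>n. (\<Sum>r<n. f (int r)) / of_nat n)"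
proof -
  define g where "g n = (\<Sum>r<n. f (int r))" for n
  have quasi: "\<exists>C. \<forall>m n. cmod (g (m + n) - g m - g n) \<le> real n * e + C" if e: "e > 0" for e
  proof -
    obtain K where K: "finite K" "\<And>n. \<exists>k\<in>K. norm (translate n f - translate k f) < e"
      using AP_netE[OF f e] by blast
    \<comment> \<open>The window starting at \<open>m\<close> is replaced by one starting at some
      \<open>k \<in> K\<close>, and that one by the window starting at 0. Summing over the finite
      set \<open>K\<close> bounds the second cost by one constant for all \<open>m\<close> and
      \<open>n\<close>.\<close>
    define C where "C = (\<Sum>k\<in>K. 2 * norm f * of_int \<bar>k\<bar>)"
    have "cmod (g (m + n) - g m - g n) \<le> real n * e + C" for m n
    proof -
      obtain k where k: "k \<in> K" "norm (translate (int m) f - translate k f) < e" using K(2) by blast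
      have "g (m + n) = g m + (\<Sum>r<n. f (int r + int m))"
        unfolding g_def by (induction n) (simp_all add: add.assoc add.commute[of "int m"])
      then have "g (m + n) - g m - g n = (\<Sum>r<n. f (int r + int m) - f (int r + k)) +
          ((\<Sum>r<n. f (int r + k)) - (\<Sum>r<n. f (int r)))"
        by (simp add: g_def sum_subtractf)
      also have "cmod \<dots> \<le> (\<Sum>r<n. e) + 2 * norm f * of_int \<bar>k\<bar>"
      proof (intro norm_triangle_mono sum_shift_diff_le sum_norm_le)
        show "cmod (f (int r + int m) - f (int r + k)) \<le> e" for r
          using norm_bounded[of "translate (int m) f - translate k f" "int r"] k(2)
          by (simp add: minus_bcontfun.rep_eq)
      qed
      also have "2 * norm f * of_int \<bar>k\<bar> \<le> C"
        unfolding C_def using K(1) k(1) by (intro member_le_sum) auto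
      finally show ?thesis by simp
    qed
    then show ?thesis by blast
  qed
  have "Cauchy (\<lambda>n. g n / of_nat n)"
  proof (rule metric_CauchyI)
    fix e :: real assume e: "e > 0"
    then obtain C where C: "\<And>m n. cmod (g (m + n) - g m - g n) \<le> real n * (e / 8) + C"
      using quasi[of "e / 8"] by auto
    have C0: "C \<ge> 0" using C[of 0 0] by (simp add: g_def)
    have mult: "cmod (g (q * n) - of_nat q * g n) \<le> real q * (real n * (e / 8) + C)" for q n
    proof (induction q)
      case (Suc q)
      have "g (Suc q * n) - of_nat (Suc q) * g n = (g (q * n + n) - g (q * n) - g n) + (g (q * n) - of_nat q * g n)"
        by (simp add: algebra_simps)
      also have "cmod \<dots> \<le> (real n * (e / 8) + C) + real q * (real n * (e / 8) + C)"
        by (intro norm_triangle_mono C Suc)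
      finally show ?case by (simp add: distrib_right)
    qed (simp add: g_def)
    have avg: "cmod (g (q * n) / of_nat (q * n) - g n / of_nat n) \<le> e / 8 + C / real n"
      if "q > 0" "n > 0" for q n
    proof -
      have "g (q * n) / of_nat (q * n) - g n / of_nat n = (g (q * n) - of_nat q * g n) / of_nat (q * n)"
        using that by (simp add: field_simps)
      also have "cmod \<dots> = cmod (g (q * n) - of_nat q * g n) / (real q * real n)"
        by (simp add: norm_divide norm_mult)
      also have "\<dots> \<le> real q * (real n * (e / 8) + C) / (real q * real n)"
        by (intro divide_right_mono mult) simp
      also have "\<dots> = e / 8 + C / real n" using that by (simp add: field_simps)
      finally show ?thesis .
    qed
    obtain N where N: "real N > 8 * C / e" using reals_Archimedean2 by blast
    have small: "n > 0 \<and> C / real n < e / 8" if "n \<ge> Suc N" for n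
    proof -
      have "8 * C / e < real n" using N that by linarith
      then show ?thesis using e that by (simp add: field_simps)
    qed
    show "\<exists>M. \<forall>m\<ge>M. \<forall>n\<ge>M. dist (g m / of_nat m) (g n / of_nat n) < e"
    proof (intro exI allI impI)
      fix m n assume "Suc N \<le> m" "Suc N \<le> n"
      then have mn: "m > 0" "C / real m < e / 8" "n > 0" "C / real n < e / 8" using small by auto
      \<comment> \<open>Both averages are compared with the average over \<open>m * n\<close> terms;
        each comparison costs less than \<open>e / 8 + e / 8\<close>.\<close>
      have "dist (g m / of_nat m) (g n / of_nat n) \<le>
        cmod (g (m * n) / of_nat (m * n) - g n / of_nat n) + cmod (g (n * m) / of_nat (n * m) - g m / of_nat m)"
        unfolding dist_norm using norm_triangle_ineq4[of "g (m * n) / of_nat (m * n) - g n / of_nat n"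
          "g (n * m) / of_nat (n * m) - g m / of_nat m"] by (simp add: mult.commute)
      also have "\<dots> \<le> (e / 8 + C / real n) + (e / 8 + C / real m)"
        by (intro add_mono avg mn)
      also have "\<dots> < e" using mn e by linarith
      finally show "dist (g m / of_nat m) (g n / of_nat n) < e" .
    qed
  qed
  then show ?thesis unfolding g_def by (rule Cauchy_convergent)
qed


section \<open>The space of square-summable families and adjoints\<close>

lemma coord_simps [simp]:
  "coord 0 i = 0" "coord (x + y) i = coord x i + coord y i" "coord (x - y) i = coord x i - coord y i"
  "coord (- x) i = - coord x i" "coord (cscale c x) i = c * coord x i"
  "coord (r *\<^sub>R x) i = of_real r * coord x i"
  by (simp_all add: zero_ell2.rep_eq plus_ell2.rep_eq minus_ell2.rep_eq uminus_ell2.rep_eq cscale.rep_eq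
      scaleR_ell2.rep_eq)

lemma coord_unit_vector [simp]: "coord (unit_vector j) i = (if i = j then 1 else 0)"
  by (simp add: unit_vector.rep_eq)

lemma coord_sum [simp]: "coord (\<Sum>a\<in>A. f a) i = (\<Sum>a\<in>A. coord (f a) i)"
  by (induction A rule: infinite_finite_induct) simp_all

lemma ell2_eqI: "(\<And>i. coord x i = coord y i) \<Longrightarrow> x = y"
  by (rule coord_inject[THEN iffD1]) (rule ext)

lemma summable_coord: "(\<lambda>i. (cmod (coord x i))\<^sup>2) summable_on A"
  by (rule summable_on_subset_banach[OF _ subset_UNIV]) (use coord[of x] in simp)

lemma sum_coord_le_norm:
  assumes "finite F"
  shows "(\<Sum>i\<in>F. (cmod (coord x i))\<^sup>2) \<le> (norm x)\<^sup>2"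
  unfolding norm_ell2_sq using assms by (intro finite_sum_le_infsum summable_coord) auto

lemma cmod_coord_le: "cmod (coord x i) \<le> norm x"
  using sum_coord_le_norm[of "{i}" x] by (simp add: power2_le_iff_abs_le)

lemma norm_ell2_leI:
  assumes "\<And>F. finite F \<Longrightarrow> (\<Sum>i\<in>F. (cmod (coord x i))\<^sup>2) \<le> C\<^sup>2" "0 \<le> C"
  shows "norm x \<le> C"
proof -
  have "(norm x)\<^sup>2 \<le> C\<^sup>2"
    unfolding norm_ell2_sq by (intro infsum_le_finite_sums summable_coord) (use assms in auto)
  then show ?thesis using assms(2) by (simp add: power2_le_iff_abs_le)
qed

lemma summable_on_square_boundedI:
  fixes f :: "'a \<Rightarrow> complex"
  assumes "\<And>F. finite F \<Longrightarrow> (\<Sum>i\<in>F. (cmod (f i))\<^sup>2) \<le> C"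
  shows "(\<lambda>i. (cmod (f i))\<^sup>2) summable_on UNIV"
  by (rule nonneg_bdd_above_summable_on) (use assms in \<open>auto intro!: bdd_aboveI[of _ C]\<close>)

lemma norm_ell2_finite_support:
  assumes "finite F" "\<And>i. i \<notin> F \<Longrightarrow> coord x i = 0"
  shows "(norm x)\<^sup>2 = (\<Sum>i\<in>F. (cmod (coord x i))\<^sup>2)"
proof -
  have "(norm x)\<^sup>2 = (\<Sum>\<^sub>\<infinity>i\<in>F. (cmod (coord x i))\<^sup>2)"
    unfolding norm_ell2_sq by (rule infsum_cong_neutral) (use assms in auto)
  then show ?thesis using assms(1) by simp
qed

lemma norm_unit_vector [simp]: "norm (unit_vector i) = 1"
  using norm_ell2_finite_support[of "{i}" "unit_vector i"] by (simp add: abs_square_eq_1)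

lemma scaleR_eq_cscale: "r *\<^sub>R x = cscale (of_real r) x"
  by (rule ell2_eqI) simp

lemma cscale_add_right: "cscale c (x + y) = cscale c x + cscale c y"
  by (rule ell2_eqI) (simp add: distrib_left)

lemma cscale_diff_right: "cscale c (x - y) = cscale c x - cscale c y"
  by (rule ell2_eqI) (simp add: right_diff_distrib)

lemma cscale_cscale [simp]: "cscale c (cscale d x) = cscale (c * d) x"
  by (rule ell2_eqI) (simp add: mult.assoc)

lemma cscale_0 [simp]: "cscale 0 x = 0" "cscale c 0 = 0"
  by (auto intro: ell2_eqI)

lemma cinner_commute: "cinner x y = cnj (cinner y x)"
  by (simp add: cinner.rep_eq mult.commute flip: infsum_cnj)

lemma cinner_add_right: "cinner x (y + z) = cinner x y + cinner x z"
  by (simp add: cinner.rep_eq distrib_left infsum_add cinner_summable)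

lemma cinner_scale_right [simp]: "cinner x (cscale c y) = c * cinner x y"
  by (simp add: cinner.rep_eq mult.left_commute infsum_cmult_right')

lemma cinner_scale_left [simp]: "cinner (cscale c x) y = cnj c * cinner x y"
  by (simp add: cinner.rep_eq mult.assoc infsum_cmult_right')

lemma cinner_add_left: "cinner (x + y) z = cinner x z + cinner y z"
  by (simp add: cinner.rep_eq distrib_right infsum_add cinner_summable)

lemma cinner_zero [simp]: "cinner x 0 = 0" "cinner 0 x = 0"
  by (simp_all add: cinner.rep_eq)

lemma cinner_diff_left: "cinner (x - y) z = cinner x z - cinner y z"
  using cinner_add_left[of "x - y" y z] by simp

lemma cinner_diff_right: "cinner x (y - z) = cinner x y - cinner x z"
  using cinner_add_right[of x "y - z" z] by simp

lemma cinner_sum_left: "cinner (\<Sum>a\<in>A. f a) y = (\<Sum>a\<in>A. cinner (f a) y)"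
  by (induction A rule: infinite_finite_induct) (simp_all add: cinner_add_left)

lemma cinner_self: "cinner x x = of_real ((norm x)\<^sup>2)"
proof -
  have "Im (cinner x x) = 0" using cinner_commute[of x x] by (simp add: complex_eq_iff)
  moreover have "Re (cinner x x) = (norm x)\<^sup>2" by (simp add: power2_norm_eq_inner inner_ell2_def)
  ultimately show ?thesis by (simp add: complex_eq_iff)
qed

lemma cinner_unit_vector_left [simp]: "cinner (unit_vector i) x = coord x i"
proof -
  have "cinner (unit_vector i) x = (\<Sum>\<^sub>\<infinity>j\<in>{i}. coord x j)"
    unfolding cinner.rep_eq by (rule infsum_cong_neutral) auto
  then show ?thesis by simp
qed

text \<open>The real inner product is the real part of \<open>cinner\<close>. Multiplying
  \<open>y\<close> by the unimodular \<open>u\<close> makes \<open>cinner x y\<close> real and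
  nonnegative, so the real Cauchy-Schwarz inequality bounds its modulus.\<close>

lemma norm_cinner_le: "cmod (cinner x y) \<le> norm x * norm y"
proof (cases "cinner x y = 0")
  case False
  define u where "u = cnj (cinner x y) / cmod (cinner x y)"
  have u: "cmod u = 1" using False by (simp add: u_def norm_divide)
  have "cinner x (cscale u y) = of_real (cmod (cinner x y))"
    using False complex_norm_square[of "cinner x y"] by (simp add: u_def power2_eq_square field_simps)
  then have "cmod (cinner x y) = inner x (cscale u y)" by (simp add: inner_ell2_def)
  also have "\<dots> \<le> norm x * norm (cscale u y)" by (rule norm_cauchy_schwarz)
  finally show ?thesis by (simp add: norm_cscale u)
qed simp

lemma bounded_linear_cinner_right: "bounded_linear (cinner x)"
proof (rule bounded_linear_intro[where K = "norm x"])
  show "cinner x (r *\<^sub>R y) = r *\<^sub>R cinner x y" for r y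
    by (simp add: scaleR_eq_cscale scaleR_conv_of_real)
  show "norm (cinner x y) \<le> norm y * norm x" for y
    using norm_cinner_le[of x y] by (simp add: mult.commute)
qed (rule cinner_add_right)

section \<open>The projections onto the first \<open>n\<close> coordinates\<close>

lift_definition trunc :: "nat \<Rightarrow> nat ell2 \<Rightarrow> nat ell2" is "\<lambda>n x i. if i < n then x i else 0"
proof -
  fix n :: nat and x :: "nat \<Rightarrow> complex"
  assume "(\<lambda>i. (cmod (x i))\<^sup>2) summable_on UNIV"
  then show "(\<lambda>i. (cmod (if i < n then x i else 0))\<^sup>2) summable_on UNIV"
    by (rule summable_on_comparison_test) auto
qed

lemma coord_trunc [simp]: "coord (trunc n x) i = (if i < n then coord x i else 0)"
  by (simp add: trunc.rep_eq)

lemma norm_trunc_sq: "(norm (trunc n x))\<^sup>2 = (\<Sum>i<n. (cmod (coord x i))\<^sup>2)"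
  by (subst norm_ell2_finite_support[of "{..<n}"]) auto

lemma norm_trunc_le: "norm (trunc n x) \<le> norm x"
  by (rule norm_ell2_leI) (auto intro: order_trans[OF sum_mono sum_coord_le_norm])

lemma norm_diff_trunc_le: "norm (x - trunc n x) \<le> norm x"
  by (rule norm_ell2_leI) (auto intro: order_trans[OF sum_mono sum_coord_le_norm])

lemma norm_sq_trunc: "(norm x)\<^sup>2 = (norm (trunc n x))\<^sup>2 + (norm (x - trunc n x))\<^sup>2"
proof -
  have "(norm x)\<^sup>2 = (\<Sum>\<^sub>\<infinity>i. (cmod (coord (trunc n x) i))\<^sup>2 + (cmod (coord (x - trunc n x) i))\<^sup>2)"
    unfolding norm_ell2_sq by (rule infsum_cong) auto
  also have "\<dots> = (norm (trunc n x))\<^sup>2 + (norm (x - trunc n x))\<^sup>2"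
    unfolding norm_ell2_sq by (intro infsum_add summable_coord)
  finally show ?thesis .
qed

lemma trunc_tendsto: "(\<lambda>n. trunc n x) \<longlonglongrightarrow> x"
proof -
  have "((\<lambda>i. (cmod (coord x i))\<^sup>2) has_sum (norm x)\<^sup>2) UNIV"
    unfolding norm_ell2_sq by (rule has_sum_infsum[OF summable_coord])
  then have "(\<lambda>n. (norm (trunc n x))\<^sup>2) \<longlonglongrightarrow> (norm x)\<^sup>2"
    unfolding norm_trunc_sq using has_sum_imp_sums sums_def by blast
  then have "(\<lambda>n. (norm x)\<^sup>2 - (norm (trunc n x))\<^sup>2) \<longlonglongrightarrow> (norm x)\<^sup>2 - (norm x)\<^sup>2"
    by (rule tendsto_diff[OF tendsto_const])
  moreover have "(norm x)\<^sup>2 - (norm (trunc n x))\<^sup>2 = (norm (trunc n x - x))\<^sup>2" for n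
    using norm_sq_trunc[of x n] by (simp add: norm_minus_commute)
  ultimately have "(\<lambda>n. (norm (trunc n x - x))\<^sup>2) \<longlonglongrightarrow> 0" by (simp only: diff_self)
  then have "(\<lambda>n. sqrt ((norm (trunc n x - x))\<^sup>2)) \<longlonglongrightarrow> sqrt 0"
    by (rule tendsto_real_sqrt)
  then have "(\<lambda>n. norm (trunc n x - x)) \<longlonglongrightarrow> 0" by simp
  then show ?thesis by (rule LIM_zero_cancel[OF tendsto_norm_zero_cancel])
qed

lemma trunc_eq_sum: "trunc n x = (\<Sum>i<n. cscale (coord x i) (unit_vector i))"
  by (rule ell2_eqI) (simp add: if_distrib[of "\<lambda>c. _ * c"] sum.delta cong: if_cong)

section \<open>Adjoints of bounded complex-linear operators\<close>

lemma complex_linear_sum: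
  assumes "complex_linear T"
  shows "T (\<Sum>a\<in>A. cscale (c a) (f a)) = (\<Sum>a\<in>A. cscale (c a) (T (f a)))"
  using assms by (simp add: blinfun.sum_right complex_linear_def)

text \<open>The coordinates of the adjoint vector are forced to be \<open>c y i\<close>. Their
  square sum over a finite \<open>F\<close> equals \<open>cinner (T z) y\<close> for the vector
  \<open>z\<close> with these very coordinates, and the norm of \<open>z\<close> is the square root
  of that sum; dividing by it bounds the root by \<open>norm T * norm y\<close>.\<close>

lemma adjoint_exists:
  fixes T :: "nat ell2 \<Rightarrow>\<^sub>L nat ell2"
  assumes T: "complex_linear T"
  shows "\<exists>R. is_adjoint R T"
proof -
  define c where "c y i = cinner (T (unit_vector i)) y" for y i
  have bound: "(\<Sum>i\<in>F. (cmod (c y i))\<^sup>2) \<le> (norm T * norm y)\<^sup>2" if F: "finite F" for F y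
  proof -
    let ?S = "\<Sum>i\<in>F. (cmod (c y i))\<^sup>2"
    define z where "z = (\<Sum>i\<in>F. cscale (c y i) (unit_vector i))"
    have "coord z i = (if i \<in> F then c y i else 0)" for i
      unfolding z_def using F by (simp add: if_distrib[of "\<lambda>c. _ * c"] sum.delta cong: if_cong)
    then have z: "(norm z)\<^sup>2 = ?S"
      by (subst norm_ell2_finite_support[OF F]) auto
    have "cinner (T z) y = (\<Sum>i\<in>F. cnj (c y i) * c y i)"
      unfolding z_def complex_linear_sum[OF T] by (simp add: cinner_sum_left c_def)
    also have "\<dots> = of_real ?S"
      unfolding of_real_sum complex_norm_square by (simp add: mult.commute)
    finally have "?S = cmod (cinner (T z) y)"
      by (simp only: norm_of_real) (simp add: sum_nonneg)
    also have "\<dots> \<le> norm T * norm z * norm y"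
      by (rule order_trans[OF norm_cinner_le mult_right_mono[OF norm_blinfun]]) simp
    finally have "norm z * norm z \<le> (norm T * norm y) * norm z"
      using z by (simp add: power2_eq_square mult_ac)
    then have "norm z \<le> norm T * norm y"
      by (cases "norm z = 0") (simp_all add: mult_le_cancel_right)
    then show ?thesis unfolding z[symmetric] by (rule power_mono) simp
  qed
  define R where "R y = Abs_ell2 (c y)" for y
  have coord_R: "coord (R y) i = c y i" for y i
    unfolding R_def by (subst Abs_ell2_inverse) (auto intro: summable_on_square_boundedI bound)
  have "bounded_linear R"
  proof (rule bounded_linear_intro[where K = "norm T"])
    show "R (x + y) = R x + R y" for x y
      by (rule ell2_eqI) (simp add: coord_R c_def cinner_add_right)
    show "R (r *\<^sub>R x) = r *\<^sub>R R x" for r x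
      by (rule ell2_eqI)
        (simp add: coord_R c_def linear_scale[OF bounded_linear.linear[OF bounded_linear_cinner_right]]
          scaleR_conv_of_real)
    show "norm (R x) \<le> norm x * norm T" for x
      using bound[of _ x] by (intro norm_ell2_leI) (simp_all add: coord_R mult.commute)
  qed
  then have R: "blinfun_apply (Blinfun R) = R" by (rule bounded_linear_Blinfun_apply)
  \<comment> \<open>The identity holds by construction on unit vectors, by linearity on truncations,
    and by continuity everywhere.\<close>
  have "cinner (R y) x = cinner y (T x)" for x y
  proof (rule LIMSEQ_unique)
    show "(\<lambda>n. cinner (R y) (trunc n x)) \<longlonglongrightarrow> cinner (R y) x"
      by (intro bounded_linear.tendsto[OF bounded_linear_cinner_right] trunc_tendsto)
    have "cinner (R y) (trunc n x) = cinner y (T (trunc n x))" for n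
    proof -
      have "cinner (R y) (unit_vector i) = cinner y (T (unit_vector i))" for i
        by (subst (1 2) cinner_commute) (simp add: coord_R c_def)
      then have "cinner (trunc n x) (R y) = cinner (T (trunc n x)) y"
        unfolding trunc_eq_sum complex_linear_sum[OF T]
        by (simp add: cinner_sum_left coord_R c_def)
      then show ?thesis by (subst (1 2) cinner_commute) simp
    qed
    then show "(\<lambda>n. cinner (R y) (trunc n x)) \<longlonglongrightarrow> cinner y (T x)"
      using bounded_linear.tendsto[OF bounded_linear_cinner_right
          bounded_linear.tendsto[OF blinfun.bounded_linear_right trunc_tendsto[of x]], of y T]
      by simp
  qed
  then show ?thesis by (intro exI[of _ "Blinfun R"]) (simp add: is_adjoint_def R)
qed

lemma is_adjoint_unique:
  assumes "is_adjoint R T" "is_adjoint R' T"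
  shows "R = R'"
proof (rule blinfun_eqI)
  fix y
  have "cinner (R y - R' y) (R y - R' y) = 0"
    using assms by (simp add: is_adjoint_def cinner_diff_left)
  then show "R y = R' y" by (simp add: cinner_self)
qed

lemma is_adjoint_sym: "is_adjoint R T \<Longrightarrow> is_adjoint T R"
  unfolding is_adjoint_def by (metis cinner_commute)

lemma is_adjoint_add: "is_adjoint R T \<Longrightarrow> is_adjoint R' T' \<Longrightarrow> is_adjoint (R + R') (T + T')"
  by (simp add: is_adjoint_def blinfun.add_left cinner_add_left cinner_add_right)

lemma is_adjoint_diff: "is_adjoint R T \<Longrightarrow> is_adjoint R' T' \<Longrightarrow> is_adjoint (R - R') (T - T')"
  by (simp add: is_adjoint_def blinfun.diff_left cinner_diff_left cinner_diff_right)

lemma is_adjoint_compose: "is_adjoint R T \<Longrightarrow> is_adjoint R' T' \<Longrightarrow> is_adjoint (R' o\<^sub>L R) (T o\<^sub>L T')"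
  by (simp add: is_adjoint_def)

lemma is_adjoint_cscale_op: "is_adjoint R T \<Longrightarrow> is_adjoint (cscale_op (cnj c) R) (cscale_op c T)"
  by (simp add: is_adjoint_def cscale_op_apply)

lemma is_adjoint_0: "is_adjoint 0 0"
  by (simp add: is_adjoint_def)

text \<open>Elements of \<open>\<Rightarrow>\<^sub>L\<close> are only real-linear, but being an
  adjoint for the complex inner product forces complex linearity. In this way strong limits of
  matrix sequences are recognised as complex-linear.\<close>

lemma complex_linear_adjoint:
  assumes "is_adjoint R T"
  shows "complex_linear R"
  unfolding complex_linear_def
proof (intro allI)
  fix c x
  let ?d = "R (cscale c x) - cscale c (R x)"
  have "cinner ?d ?d = 0" using assms by (simp add: is_adjoint_def cinner_diff_left)
  then show "R (cscale c x) = cscale c (R x)" by (simp add: cinner_self)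
qed

lemma norm_adjoint_le:
  assumes "is_adjoint R T"
  shows "norm R \<le> norm T"
proof (rule norm_blinfun_bound)
  fix y
  have "norm (R y) * norm (R y) = cmod (cinner (R y) (R y))"
    by (simp add: cinner_self power2_eq_square norm_mult)
  also have "\<dots> = cmod (cinner y (T (R y)))" using assms by (simp add: is_adjoint_def)
  also have "\<dots> \<le> norm y * norm (T (R y))" by (rule norm_cinner_le)
  also have "\<dots> \<le> norm y * (norm T * norm (R y))" by (intro mult_left_mono norm_blinfun) simp
  finally have "norm (R y) * norm (R y) \<le> (norm T * norm y) * norm (R y)" by (simp add: mult_ac)
  then show "norm (R y) \<le> norm T * norm y"
    by (cases "norm (R y) = 0") (simp_all add: mult_le_cancel_right)
qed simp

lemma entry_adjoint:
  assumes "is_adjoint R T"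
  shows "entry R i j = cnj (entry T j i)"
proof -
  have "entry R i j = cinner (unit_vector i) (R (unit_vector j))" by (simp add: entry_def)
  also have "\<dots> = cinner (T (unit_vector i)) (unit_vector j)"
    using is_adjoint_sym[OF assms] by (simp add: is_adjoint_def)
  also have "\<dots> = cnj (entry T j i)" by (subst cinner_commute) (simp add: entry_def)
  finally show ?thesis .
qed


section \<open>Operators with asymptotically almost periodic columns\<close>

text \<open>The column families \<open>j \<mapsto> B e\<^sub>j\<close> of the band operators \<open>B\<close> with almost periodic diagonals. The
  index \<open>nat (int j + k)\<close> is truncated at 0, which affects only finitely many \<open>j\<close>.\<close>
inductive_set ap_bands :: "(nat \<Rightarrow> nat ell2) set" where
  zero: "(\<lambda>_. 0) \<in> ap_bands"
| add: "v \<in> ap_bands \<Longrightarrow> b \<in> AP \<Longrightarrow>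
    (\<lambda>j. v j + cscale (b (int j)) (unit_vector (nat (int j + k)))) \<in> ap_bands"

lemma ap_bands_add:
  assumes "v \<in> ap_bands" "w \<in> ap_bands"
  shows "(\<lambda>j. v j + w j) \<in> ap_bands"
  using assms(2)
proof induction
  case (add w b k)
  then show ?case using ap_bands.add[of "\<lambda>j. v j + w j" b k] by (simp add: add.assoc)
qed (simp add: assms(1))

lemma filterlim_nat_shift: "filterlim (\<lambda>j. nat (int j + k)) sequentially sequentially"
  unfolding filterlim_at_top
proof
  fix Z
  show "\<forall>\<^sub>F j in sequentially. Z \<le> nat (int j + k)"
    using eventually_ge_at_top[of "Z + nat \<bar>k\<bar>"] by eventually_elim linarith
qed

text \<open>The rule for multiplying a band by a weighted shift: a band with coefficient
  \<open>c\<close> and offset \<open>l\<close>, read at column \<open>j + k\<close>, has coefficient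
  \<open>translate k c\<close> and offset \<open>k + l\<close>. The equality is only eventual
  because \<open>nat\<close> cuts off negative indices.\<close>

lemma ap_bands_shift:
  assumes "v \<in> ap_bands" "b \<in> AP"
  shows "\<exists>w\<in>ap_bands. \<forall>\<^sub>F j in sequentially. cscale (b (int j)) (v (nat (int j + k))) = w j"
  using assms(1)
proof induction
  case zero
  show ?case using ap_bands.zero by (intro bexI[of _ "\<lambda>_. 0"]) simp_all
next
  case (add v c l)
  then obtain w where w: "w \<in> ap_bands"
    "\<forall>\<^sub>F j in sequentially. cscale (b (int j)) (v (nat (int j + k))) = w j" by blast
  let ?d = "bmult b (translate k c)"
  let ?w = "\<lambda>j. w j + cscale (?d (int j)) (unit_vector (nat (int j + (k + l))))"
  have "?w \<in> ap_bands" by (intro ap_bands.add w AP_bmult AP_translate assms add)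
  moreover have "\<forall>\<^sub>F j in sequentially. cscale (b (int j)) (v (nat (int j + k)) +
      cscale (c (int (nat (int j + k)))) (unit_vector (nat (int (nat (int j + k)) + l)))) = ?w j"
    using w(2) eventually_ge_at_top[of "nat \<bar>k\<bar>"]
  proof eventually_elim
    case (elim j)
    then have "int (nat (int j + k)) = int j + k" by linarith
    then show ?case using elim(1) by (simp add: cscale_add_right add.assoc)
  qed
  ultimately show ?case by (intro bexI[of _ ?w])
qed

lemma ap_bands_diagonal:
  assumes "v \<in> ap_bands"
  shows "\<exists>f\<in>AP. \<forall>\<^sub>F j in sequentially. coord (v j) j = f (int j)"
  using assms
proof induction
  case zero
  show ?case using AP_const[of 0] by (intro bexI[of _ "const_bcontfun 0"]) (simp_all add: zero_bcontfun.rep_eq)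
next
  case (add v b k)
  then obtain f where f: "f \<in> AP" "\<forall>\<^sub>F j in sequentially. coord (v j) j = f (int j)" by blast
  show ?case
  proof (cases "k = 0")
    case True
    with f add(2) show ?thesis by (intro bexI[of _ "f + b"] AP_add) (auto simp: plus_bcontfun.rep_eq)
  next
    case False
    \<comment> \<open>An offset \<open>k \<noteq> 0\<close> misses the diagonal, except that for
      negative \<open>k\<close> the cut-off sends column 0 to row 0; large \<open>j\<close> avoid
      this.\<close>
    have "\<forall>\<^sub>F j in sequentially. coord (v j + cscale (b (int j)) (unit_vector (nat (int j + k)))) j = f (int j)"
      using f(2) eventually_ge_at_top[of "Suc (nat \<bar>k\<bar>)"]
    proof eventually_elim
      case (elim j)
      then have "j \<noteq> nat (int j + k)" using False by linarith
      then show ?case using elim(1) by simp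
    qed
    with f(1) show ?thesis by blast
  qed
qed

text \<open>Only the part below the diagonal is controlled, since that is what leaves the first
  \<open>n\<close> rows in \<open>(1 - P_n) T P_n\<close>. An offset \<open>k\<close> reaches at
  most \<open>\<bar>k\<bar>\<close> rows below the diagonal.\<close>

lemma ap_bands_width:
  assumes "v \<in> ap_bands"
  shows "\<exists>m. \<forall>j i. i > j + m \<longrightarrow> coord (v j) i = 0"
  using assms
proof induction
  case (add v b k)
  then obtain m where m: "\<And>j i. i > j + m \<Longrightarrow> coord (v j) i = 0" by blast
  have "coord (v j + cscale (b (int j)) (unit_vector (nat (int j + k)))) i = 0"
    if "i > j + (m + nat \<bar>k\<bar>)" for i j
  proof -
    have "i > j + m" "i \<noteq> nat (int j + k)" using that by linarith+
    then show ?thesis using m by simp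
  qed
  then show ?case by blast
qed simp

text \<open>The band \<open>v\<close> may depend on \<open>e\<close> in any way. As the condition is
  asymptotic in \<open>j\<close>, a compact operator satisfies it with \<open>v = 0\<close>: its
  columns tend to 0.\<close>

definition ap_columns :: "(nat ell2 \<Rightarrow>\<^sub>L nat ell2) \<Rightarrow> bool" where
  "ap_columns T \<longleftrightarrow>
     (\<forall>e>0. \<exists>v\<in>ap_bands. \<forall>\<^sub>F j in sequentially. norm (T (unit_vector j) - v j) \<le> e)"

section \<open>Closure properties of the column condition\<close>

lemma ap_columnsD:
  assumes "ap_columns T" "e > 0"
  obtains v where "v \<in> ap_bands" "\<forall>\<^sub>F j in sequentially. norm (T (unit_vector j) - v j) \<le> e"
  using assms by (auto simp: ap_columns_def)

lemma ap_columns_0: "ap_columns 0"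
  unfolding ap_columns_def using ap_bands.zero by (auto intro!: bexI[of _ "\<lambda>_. 0"])

lemma ap_columns_add:
  assumes "ap_columns T" "ap_columns S"
  shows "ap_columns (T + S)"
  unfolding ap_columns_def
proof (intro allI impI)
  fix e :: real assume "e > 0"
  then have e: "e / 2 > 0" by simp
  obtain v where v: "v \<in> ap_bands" "\<forall>\<^sub>F j in sequentially. norm (T (unit_vector j) - v j) \<le> e / 2"
    by (rule ap_columnsD[OF assms(1) e])
  obtain w where w: "w \<in> ap_bands" "\<forall>\<^sub>F j in sequentially. norm (S (unit_vector j) - w j) \<le> e / 2"
    by (rule ap_columnsD[OF assms(2) e])
  have "\<forall>\<^sub>F j in sequentially. norm ((T + S) (unit_vector j) - (v j + w j)) \<le> e"
    using v(2) w(2)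
  proof eventually_elim
    case (elim j)
    have "(T + S) (unit_vector j) - (v j + w j) = (T (unit_vector j) - v j) + (S (unit_vector j) - w j)"
      by (simp add: blinfun.add_left)
    then show ?case using norm_triangle_mono[OF elim] by (simp only: field_sum_of_halves)
  qed
  then show "\<exists>v\<in>ap_bands. \<forall>\<^sub>F j in sequentially. norm ((T + S) (unit_vector j) - v j) \<le> e"
    using ap_bands_add[OF v(1) w(1)] by (rule bexI)
qed

lemma ap_columns_cscale:
  assumes "ap_columns T"
  shows "ap_columns (cscale_op c T)"
  unfolding ap_columns_def
proof (intro allI impI)
  fix e :: real assume "e > 0"
  then have e: "e / (cmod c + 1) > 0" by (simp add: add_nonneg_pos)
  obtain v where v: "v \<in> ap_bands"
    "\<forall>\<^sub>F j in sequentially. norm (T (unit_vector j) - v j) \<le> e / (cmod c + 1)"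
    by (rule ap_columnsD[OF assms e])
  obtain w where w: "w \<in> ap_bands"
    "\<forall>\<^sub>F j in sequentially. cscale (const_bcontfun c (int j)) (v (nat (int j + 0))) = w j"
    using ap_bands_shift[OF v(1) AP_const[of c], of 0] by blast
  have "\<forall>\<^sub>F j in sequentially. norm (cscale_op c T (unit_vector j) - w j) \<le> e"
    using v(2) w(2)
  proof eventually_elim
    case (elim j)
    have "norm (cscale_op c T (unit_vector j) - w j) = cmod c * norm (T (unit_vector j) - v j)"
      unfolding elim(2)[symmetric]
      by (simp add: cscale_op_apply const_bcontfun.rep_eq flip: cscale_diff_right norm_cscale)
    also have "\<dots> \<le> (cmod c + 1) * (e / (cmod c + 1))" using elim(1) by (intro mult_mono) simp_all
    also have "\<dots> = e" using norm_ge_zero[of c] by (simp add: add_nonneg_eq_0_iff)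
    finally show ?case .
  qed
  with w(1) show "\<exists>v\<in>ap_bands. \<forall>\<^sub>F j in sequentially. norm (cscale_op c T (unit_vector j) - v j) \<le> e"
    by blast
qed

lemma mult_half_divide: "d * (e / 2 / d) = e / 2" if "d \<noteq> 0" for d e :: real
  using that by simp

text \<open>\<open>T\<close> maps a band column to a finite combination of columns
  \<open>T e_{j+k}\<close> with coefficients \<open>b j\<close>; each is replaced by the
  approximating band read at \<open>j + k\<close>, which is legitimate since \<open>j + k\<close>
  tends to infinity with \<open>j\<close>. The induction leaves \<open>e\<close> arbitrary because
  every summand takes half of the tolerance.\<close>

lemma ap_columns_apply_band:
  assumes T: "ap_columns T" "complex_linear T" and v: "v \<in> ap_bands" and "e > 0"
  shows "\<exists>w\<in>ap_bands. \<forall>\<^sub>F j in sequentially. norm (T (v j) - w j) \<le> e"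
  using v \<open>e > 0\<close>
proof (induction arbitrary: e)
  case zero
  then show ?case using ap_bands.zero by (intro bexI[of _ "\<lambda>_. 0"]) (simp_all add: blinfun.zero_right)
next
  case (add v b k)
  have "e / 2 > 0" using add by simp
  from add.IH[OF this] obtain w where w: "w \<in> ap_bands"
    "\<forall>\<^sub>F j in sequentially. norm (T (v j) - w j) \<le> e / 2" by blast
  \<comment> \<open>The later factor \<open>b j\<close> is compensated in advance; adding 1 keeps
    the denominator positive when \<open>b = 0\<close>.\<close>
  have "e / 2 / (norm b + 1) > 0" using add by (simp add: add_nonneg_pos)
  from ap_columnsD[OF T(1) this] obtain u where u: "u \<in> ap_bands"
    "\<forall>\<^sub>F j in sequentially. norm (T (unit_vector j) - u j) \<le> e / 2 / (norm b + 1)" .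
  obtain z where z: "z \<in> ap_bands"
    "\<forall>\<^sub>F j in sequentially. cscale (b (int j)) (u (nat (int j + k))) = z j"
    using ap_bands_shift[OF u(1) add(2), of k] by blast
  have u': "\<forall>\<^sub>F j in sequentially.
      norm (T (unit_vector (nat (int j + k))) - u (nat (int j + k))) \<le> e / 2 / (norm b + 1)"
    using filterlim_nat_shift[of k] u(2) unfolding filterlim_iff by blast
  have "\<forall>\<^sub>F j in sequentially.
      norm (T (v j + cscale (b (int j)) (unit_vector (nat (int j + k)))) - (w j + z j)) \<le> e"
    using w(2) u' z(2)
  proof eventually_elim
    case (elim j)
    let ?y = "T (unit_vector (nat (int j + k))) - u (nat (int j + k))"
    have "T (v j + cscale (b (int j)) (unit_vector (nat (int j + k)))) - (w j + z j)
        = (T (v j) - w j) + cscale (b (int j)) ?y"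
      unfolding elim(3)[symmetric] using T(2)
      by (simp add: blinfun.add_right complex_linear_def cscale_diff_right)
    also have "norm \<dots> \<le> e / 2 + (norm b + 1) * (e / 2 / (norm b + 1))"
      unfolding norm_cscale
    proof (rule norm_triangle_mono[OF elim(1)])
      have "cmod (b (int j)) \<le> norm b + 1" using norm_bounded[of b "int j"] by simp
      then show "norm (cscale (b (int j)) ?y) \<le> (norm b + 1) * (e / 2 / (norm b + 1))"
        unfolding norm_cscale using elim(2) by (intro mult_mono) simp_all
    qed
    also have "\<dots> = e" using norm_ge_zero[of b] by (subst mult_half_divide) linarith+
    finally show ?case .
  qed
  then show ?case using ap_bands_add[OF w(1) z(1)] by (rule bexI)
qed

text \<open>Passing from \<open>S\<close> to \<open>v\<close> costs a factor \<open>norm T\<close>.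
  After that \<open>v\<close> is fixed, so the tolerance for \<open>T\<close> can be adapted to the
  coefficients of \<open>v\<close>.\<close>

lemma ap_columns_compose:
  assumes T: "ap_columns T" "complex_linear T" and S: "ap_columns S"
  shows "ap_columns (T o\<^sub>L S)"
  unfolding ap_columns_def
proof (intro allI impI)
  fix e :: real assume e: "e > 0"
  have "e / 2 / (norm T + 1) > 0" using e by (simp add: add_nonneg_pos)
  from ap_columnsD[OF S this] obtain v where v: "v \<in> ap_bands"
    "\<forall>\<^sub>F j in sequentially. norm (S (unit_vector j) - v j) \<le> e / 2 / (norm T + 1)" .
  obtain w where w: "w \<in> ap_bands" "\<forall>\<^sub>F j in sequentially. norm (T (v j) - w j) \<le> e / 2"
    using ap_columns_apply_band[OF T v(1), of "e / 2"] e by auto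
  have "\<forall>\<^sub>F j in sequentially. norm ((T o\<^sub>L S) (unit_vector j) - w j) \<le> e"
    using v(2) w(2)
  proof eventually_elim
    case (elim j)
    have "(T o\<^sub>L S) (unit_vector j) - w j = T (S (unit_vector j) - v j) + (T (v j) - w j)"
      by (simp add: blinfun.diff_right)
    also have "norm \<dots> \<le> (norm T + 1) * (e / 2 / (norm T + 1)) + e / 2"
    proof (rule norm_triangle_mono[OF _ elim(2)])
      show "norm (T (S (unit_vector j) - v j)) \<le> (norm T + 1) * (e / 2 / (norm T + 1))"
        by (rule order_trans[OF norm_blinfun mult_mono]) (use elim(1) in simp_all)
    qed
    also have "\<dots> = e" using norm_ge_zero[of T] by (subst mult_half_divide) linarith+
    finally show ?case .
  qed
  with w(1) show "\<exists>v\<in>ap_bands. \<forall>\<^sub>F j in sequentially. norm ((T o\<^sub>L S) (unit_vector j) - v j) \<le> e"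
    by blast
qed

lemma ap_columns_approx:
  assumes "\<And>e. e > 0 \<Longrightarrow> \<exists>S. ap_columns S \<and> norm (T - S) \<le> e"
  shows "ap_columns T"
  unfolding ap_columns_def
proof (intro allI impI)
  fix e :: real assume "e > 0"
  then have e: "e / 2 > 0" by simp
  from assms[OF e] obtain S where S: "ap_columns S" "norm (T - S) \<le> e / 2" by blast
  obtain v where v: "v \<in> ap_bands" "\<forall>\<^sub>F j in sequentially. norm (S (unit_vector j) - v j) \<le> e / 2"
    by (rule ap_columnsD[OF S(1) e])
  have "\<forall>\<^sub>F j in sequentially. norm (T (unit_vector j) - v j) \<le> e"
    using v(2)
  proof eventually_elim
    case (elim j)
    have eq: "T (unit_vector j) - v j = (T - S) (unit_vector j) + (S (unit_vector j) - v j)"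
      by (simp add: blinfun.diff_left)
    have "norm ((T - S) (unit_vector j)) \<le> e / 2"
      using norm_blinfun[of "T - S" "unit_vector j"] S(2) by simp
    from norm_triangle_mono[OF this elim] show ?case unfolding eq by simp
  qed
  with v(1) show "\<exists>v\<in>ap_bands. \<forall>\<^sub>F j in sequentially. norm (T (unit_vector j) - v j) \<le> e" by blast
qed

text \<open>Each tolerance yields an almost periodic function that follows the diagonal far out. Two
  of them are compared only at large indices, but \<open>AP_norm_le\<close> makes them close on all
  integers. So they form a Cauchy sequence, and its limit is the required \<open>f\<close>.\<close>

lemma ap_columns_diagonal:
  assumes "ap_columns T"
  shows "\<exists>f\<in>AP. (\<lambda>i. entry T i i - f (int i)) \<longlonglongrightarrow> 0"
proof -
  have "\<exists>f\<in>AP. \<forall>\<^sub>F j in sequentially. cmod (entry T j j - f (int j)) \<le> e" if e: "e > 0" for e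
  proof -
    obtain v where v: "v \<in> ap_bands" "\<forall>\<^sub>F j in sequentially. norm (T (unit_vector j) - v j) \<le> e"
      by (rule ap_columnsD[OF assms e])
    obtain f where f: "f \<in> AP" "\<forall>\<^sub>F j in sequentially. coord (v j) j = f (int j)"
      using ap_bands_diagonal[OF v(1)] by blast
    have "\<forall>\<^sub>F j in sequentially. cmod (entry T j j - f (int j)) \<le> e"
      using v(2) f(2)
    proof eventually_elim
      case (elim j)
      show ?case using cmod_coord_le[of "T (unit_vector j) - v j" j] elim by (simp add: entry_def)
    qed
    with f(1) show ?thesis by blast
  qed
  then have "\<forall>n. \<exists>f\<in>AP. \<forall>\<^sub>F j in sequentially. cmod (entry T j j - f (int j)) \<le> 1 / real (Suc n)"
    by simp
  then obtain F where F: "\<And>n. F n \<in> AP"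
    "\<And>n. \<forall>\<^sub>F j in sequentially. cmod (entry T j j - F n (int j)) \<le> 1 / real (Suc n)"
    by metis
  have dist: "norm (F m - F n) \<le> 1 / real (Suc m) + 1 / real (Suc n)" for m n
  proof (rule AP_norm_le[OF AP_diff[OF F(1) F(1)]])
    show "\<forall>\<^sub>F j in sequentially. cmod ((F m - F n) (int j)) \<le> 1 / real (Suc m) + 1 / real (Suc n)"
      using F(2)[of m] F(2)[of n]
    proof eventually_elim
      case (elim j)
      have "(F m - F n) (int j) = (entry T j j - F n (int j)) - (entry T j j - F m (int j))"
        by (simp add: minus_bcontfun.rep_eq)
      then show ?case
        using norm_triangle_ineq4[of "entry T j j - F n (int j)" "entry T j j - F m (int j)"] elim by simp
    qed
  qed
  have "Cauchy F"
  proof (rule metric_CauchyI)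
    fix e :: real assume "e > 0"
    then obtain N where N: "1 / real (Suc N) < e / 2" using nat_approx_posE[of "e / 2"] by auto
    have "dist (F m) (F n) < e" if "m \<ge> N" "n \<ge> N" for m n
    proof -
      have "1 / real (Suc m) \<le> 1 / real (Suc N)" "1 / real (Suc n) \<le> 1 / real (Suc N)"
        using that by (simp_all add: frac_le)
      then show ?thesis using dist[of m n] N unfolding dist_norm by linarith
    qed
    then show "\<exists>M. \<forall>m\<ge>M. \<forall>n\<ge>M. dist (F m) (F n) < e" by blast
  qed
  then obtain f where f: "F \<longlonglongrightarrow> f" using convergent_bcontfun_int by (auto simp: convergent_def)
  have "f \<in> AP" using closed_sequentially[OF closed_AP F(1) f] by simp
  moreover have "(\<lambda>i. entry T i i - f (int i)) \<longlonglongrightarrow> 0"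
  proof (rule tendstoI)
    fix e :: real assume e: "e > 0"
    then have "\<forall>\<^sub>F n in sequentially. dist (F n) f < e / 2" using tendstoD[OF f, of "e / 2"] by simp
    moreover have "\<forall>\<^sub>F n in sequentially. 1 / real (Suc n) < e / 2"
      using order_tendstoD(2)[OF LIMSEQ_inverse_real_of_nat, of "e / 2"] e by (simp add: inverse_eq_divide)
    ultimately have "\<forall>\<^sub>F n in sequentially. dist (F n) f < e / 2 \<and> 1 / real (Suc n) < e / 2"
      by (rule eventually_conj)
    then obtain n where n: "dist (F n) f < e / 2" "1 / real (Suc n) < e / 2"
      unfolding eventually_sequentially by blast
    show "\<forall>\<^sub>F i in sequentially. dist (entry T i i - f (int i)) 0 < e"
      using F(2)[of n]
    proof eventually_elim
      case (elim j)
      have "cmod (F n (int j) - f (int j)) \<le> norm (F n - f)"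
        using norm_bounded[of "F n - f" "int j"] by (simp add: minus_bcontfun.rep_eq)
      then have "cmod (F n (int j) - f (int j)) < e / 2" using n(1) by (simp add: dist_norm)
      then show ?case
        using norm_triangle_ineq[of "entry T j j - F n (int j)" "F n (int j) - f (int j)"] elim n(2)
        by simp
    qed
  qed
  ultimately show ?thesis by blast
qed

text \<open>Uniqueness holds because an almost periodic function that tends to 0 at +\<infinity>
  vanishes identically.\<close>

lemma D_ap_eqI:
  assumes f: "f \<in> AP" "(\<lambda>i. entry T i i - f (int i)) \<longlonglongrightarrow> 0"
  shows "D_ap T = f"
  unfolding D_ap_def
proof (rule the_equality)
  fix g assume g: "g \<in> AP \<and> (\<lambda>i. entry T i i - g (int i)) \<longlonglongrightarrow> 0"
  have "norm (g - f) \<le> e" if "e > 0" for e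
  proof (rule AP_norm_le[OF AP_diff])
    have "(\<lambda>i. (g - f) (int i)) \<longlonglongrightarrow> 0"
      using tendsto_diff[OF f(2) conjunct2[OF g]] by (simp add: minus_bcontfun.rep_eq)
    then show "\<forall>\<^sub>F i in sequentially. cmod ((g - f) (int i)) \<le> e"
      using tendstoD[OF _ that] by (force elim: eventually_mono)
  qed (use f g in auto)
  then have "norm (g - f) \<le> 0" by (meson dense_ge)
  then show "g = f" by simp
qed (use f in simp)

text \<open>A band of width \<open>m\<close> reaches below row \<open>n\<close> only from the last \<open>m\<close> of the first \<open>n\<close> columns.\<close>
lemma ap_columns_corner:
  assumes "ap_columns T"
  shows "(\<lambda>n. (\<Sum>j<n. (norm (T (unit_vector j) - trunc n (T (unit_vector j))))\<^sup>2) / real n) \<longlonglongrightarrow> 0"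
proof (rule tendstoI)
  fix e :: real assume e: "e > 0"
  obtain v where v: "v \<in> ap_bands" "\<forall>\<^sub>F j in sequentially. norm (T (unit_vector j) - v j) \<le> sqrt (e / 2)"
    by (rule ap_columnsD[OF assms, of "sqrt (e / 2)"]) (use e in auto)
  obtain J where J: "\<And>j. j \<ge> J \<Longrightarrow> norm (T (unit_vector j) - v j) \<le> sqrt (e / 2)"
    using v(2) by (auto simp: eventually_sequentially)
  obtain m where m: "\<And>j i. i > j + m \<Longrightarrow> coord (v j) i = 0" using ap_bands_width[OF v(1)] by blast
  define c where "c n j = norm (T (unit_vector j) - trunc n (T (unit_vector j)))" for n j
  \<comment> \<open>For \<open>j \<ge> J\<close> with \<open>j + m < n\<close> the vector
    \<open>v j\<close> lives in the first \<open>n\<close> rows, so the tail of \<open>T e_j\<close>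
    is a tail of \<open>T e_j - v j\<close> and contributes at most \<open>e / 2\<close>. The
    remaining columns number at most \<open>J + m + 1\<close> and contribute at most the square of
    \<open>norm T\<close> each.\<close>
  have bound: "(\<Sum>j<n. (c n j)\<^sup>2) \<le> real n * (e / 2) + real (J + m + 1) * (norm T)\<^sup>2" for n
  proof -
    have "(c n j)\<^sup>2 \<le> e / 2 + (if j < J \<or> n \<le> j + m then (norm T)\<^sup>2 else 0)" for j
    proof (cases "j < J \<or> n \<le> j + m")
      case True
      have "c n j \<le> norm T"
        unfolding c_def using norm_diff_trunc_le norm_blinfun[of T "unit_vector j"] by (metis mult.right_neutral norm_unit_vector order_trans)
      then have "(c n j)\<^sup>2 \<le> (norm T)\<^sup>2" by (intro power_mono) (simp_all add: c_def)
      then show ?thesis using True e by simp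
    next
      case False
      then have "v j = trunc n (v j)" using m by (intro ell2_eqI) (simp add: not_less)
      then have "c n j = norm ((T (unit_vector j) - v j) - trunc n (T (unit_vector j) - v j))"
        unfolding c_def by (intro arg_cong[where f = norm] ell2_eqI) (metis coord_simps(3) coord_trunc diff_zero diff_self)
      also have "\<dots> \<le> sqrt (e / 2)" using False J[of j] by (intro order_trans[OF norm_diff_trunc_le]) simp
      finally have "(c n j)\<^sup>2 \<le> (sqrt (e / 2))\<^sup>2" by (intro power_mono) (simp_all add: c_def)
      then show ?thesis using e False by simp
    qed
    then have "(\<Sum>j<n. (c n j)\<^sup>2) \<le> (\<Sum>j<n. e / 2 + (if j < J \<or> n \<le> j + m then (norm T)\<^sup>2 else 0))"
      by (intro sum_mono)
    also have "\<dots> = real n * (e / 2) + real (card {j. j < n \<and> (j < J \<or> n \<le> j + m)}) * (norm T)\<^sup>2"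
      by (simp add: sum.distrib sum.If_cases Int_def)
    also have "card {j. j < n \<and> (j < J \<or> n \<le> j + m)} \<le> card ({..<J} \<union> {n - m..n})"
      by (intro card_mono) auto
    also have "\<dots> \<le> J + card {n - m..n}" using card_Un_le[of "{..<J}" "{n - m..n}"] by simp
    also have "\<dots> \<le> J + m + 1" by simp
    finally show ?thesis by (simp add: mult_right_mono)
  qed
  obtain N where N: "real N > real (J + m + 1) * (norm T)\<^sup>2 / (e / 2)" using reals_Archimedean2 by blast
  show "\<forall>\<^sub>F n in sequentially.
      dist ((\<Sum>j<n. (norm (T (unit_vector j) - trunc n (T (unit_vector j))))\<^sup>2) / real n) 0 < e"
    using eventually_ge_at_top[of "Suc N"]
  proof eventually_elim
    case (elim n)
    then have "real n > real (J + m + 1) * (norm T)\<^sup>2 / (e / 2)" using N by linarith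
    then have "real (J + m + 1) * (norm T)\<^sup>2 < real n * (e / 2)" using e by (simp add: field_simps)
    then have "(\<Sum>j<n. (c n j)\<^sup>2) < real n * e" using bound[of n] by argo
    moreover have "(\<Sum>j<n. (c n j)\<^sup>2) \<ge> 0" by (intro sum_nonneg) simp
    ultimately show ?case using elim by (simp add: c_def[symmetric] field_simps)
  qed
qed


section \<open>Laurent and Toeplitz operators\<close>

abbreviation circle_measure :: "real measure" where
  "circle_measure \<equiv> lebesgue_on {0..2 * pi}"

lemma finite_measure_circle: "finite_measure circle_measure"
  by (intro finite_measure_lebesgue_on) simp

lemma measurable_cis_mult [measurable]: "(\<lambda>t. cis (of_int k * t)) \<in> borel_measurable circle_measure"
  by (intro continuous_imp_measurable_on_sets_lebesgue continuous_intros) simp_all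

text \<open>This class is closed under sums, products and conjugation, and its members are
  integrable because the measure is finite; it therefore settles the integrability of the integrands
  that arise from symbols and trigonometric polynomials.\<close>

definition circle_bounded :: "(real \<Rightarrow> complex) \<Rightarrow> bool" where
  "circle_bounded g \<longleftrightarrow> g \<in> borel_measurable circle_measure \<and> (\<exists>C. AE t in circle_measure. cmod (g t) \<le> C)"

lemma circle_bounded_integrable:
  assumes "circle_bounded g"
  shows "integrable circle_measure g"
proof -
  obtain C where "AE t in circle_measure. cmod (g t) \<le> C" using assms by (auto simp: circle_bounded_def)
  then show ?thesis
    using assms finite_measure.integrable_const_bound[OF finite_measure_circle]
    by (auto simp: circle_bounded_def)
qed

lemma circle_bounded_cis: "circle_bounded (\<lambda>t. cis (of_int k * t))"
  unfolding circle_bounded_def by (auto intro!: exI[of _ 1])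

lemma circle_bounded_mult:
  assumes "circle_bounded f" "circle_bounded g"
  shows "circle_bounded (\<lambda>t. f t * g t)"
proof -
  obtain C D where C: "AE t in circle_measure. cmod (f t) \<le> C" and D: "AE t in circle_measure. cmod (g t) \<le> D"
    using assms by (auto simp: circle_bounded_def)
  have "AE t in circle_measure. cmod (f t * g t) \<le> \<bar>C\<bar> * \<bar>D\<bar>"
    using C D by eventually_elim (simp add: norm_mult mult_mono)
  then show ?thesis using assms by (auto simp: circle_bounded_def)
qed

lemma circle_bounded_add:
  assumes "circle_bounded f" "circle_bounded g"
  shows "circle_bounded (\<lambda>t. f t + g t)"
proof -
  obtain C D where C: "AE t in circle_measure. cmod (f t) \<le> C" and D: "AE t in circle_measure. cmod (g t) \<le> D"
    using assms by (auto simp: circle_bounded_def)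
  have "AE t in circle_measure. cmod (f t + g t) \<le> C + D"
    using C D by eventually_elim (rule norm_triangle_mono)
  then show ?thesis using assms by (auto simp: circle_bounded_def)
qed

lemma circle_bounded_const: "circle_bounded (\<lambda>_. c)"
  unfolding circle_bounded_def by (auto intro!: exI[of _ "cmod c"])

lemma circle_bounded_sum:
  "(\<And>k. k \<in> F \<Longrightarrow> circle_bounded (f k)) \<Longrightarrow> circle_bounded (\<lambda>t. \<Sum>k\<in>F. f k t)"
  by (induction F rule: infinite_finite_induct) (simp_all add: circle_bounded_const circle_bounded_add)

lemma circle_bounded_cnj:
  assumes "circle_bounded f"
  shows "circle_bounded (\<lambda>t. cnj (f t))"
proof -
  have "cnj \<in> borel_measurable borel"
    by (intro borel_measurable_continuous_onI continuous_on_cnj continuous_on_id)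
  with assms show ?thesis
    unfolding circle_bounded_def using measurable_compose[of f circle_measure borel cnj borel] by auto
qed

lemma circle_bounded_square_integrable:
  assumes "circle_bounded f"
  shows "integrable circle_measure (\<lambda>t. (cmod (f t))\<^sup>2)"
  using integrable_Re[OF circle_bounded_integrable[OF circle_bounded_mult[OF assms circle_bounded_cnj[OF assms]]]]
  by (simp add: complex_mult_cnj cmod_power2)

lemma integral_cis: "(LINT t|circle_measure. cis (of_int k * t)) = (if k = 0 then 2 * pi else 0)"
proof (cases "k = 0")
  case True
  then show ?thesis by (simp add: measure_restrict_space scaleR_conv_of_real)
next
  case False
  let ?F = "\<lambda>t. cis (of_int k * t) / (\<i> * of_int k)"
  have "((\<lambda>t. cis (of_int k * t)) has_integral ?F (2 * pi) - ?F 0) {0..2 * pi}"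
  proof (rule fundamental_theorem_of_calculus)
    fix x
    have "((\<lambda>z. exp (\<i> * of_int k * z) / (\<i> * of_int k)) has_field_derivative exp (\<i> * of_int k * of_real x))
        (at (of_real x))"
      using False by (auto intro!: derivative_eq_intros)
    then have "((\<lambda>t. exp (\<i> * of_int k * of_real t) / (\<i> * of_int k)) has_vector_derivative
        exp (\<i> * of_int k * of_real x)) (at x within {0..2 * pi})"
      by (rule has_vector_derivative_real_field)
    then show "(?F has_vector_derivative cis (of_int k * x)) (at x within {0..2 * pi})"
      by (simp add: cis_conv_exp mult.assoc)
  qed simp
  moreover have "cis (of_int k * (2 * pi)) = 1"
    using cis_multiple_2pi[of "of_int k"] by (simp add: mult_ac)
  ultimately have "integral {0..2 * pi} (\<lambda>t. cis (of_int k * t)) = 0"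
    by (simp add: integral_unique)
  then show ?thesis
    using False lebesgue_integral_eq_integral[OF circle_bounded_integrable[OF circle_bounded_cis]] by simp
qed

text \<open>\<open>fourier_coeff a\<close> is the case \<open>g t = a (cis t)\<close>. Functions of
  the angle also cover the product of a symbol with a trigonometric polynomial.\<close>

definition period_fourier :: "(real \<Rightarrow> complex) \<Rightarrow> int \<Rightarrow> complex" where
  "period_fourier g k = (LINT t|circle_measure. g t * cis (- (of_int k * t))) / (2 * pi)"

definition trig_poly :: "int set \<Rightarrow> (int \<Rightarrow> complex) \<Rightarrow> real \<Rightarrow> complex" where
  "trig_poly G x t = (\<Sum>j\<in>G. x j * cis (of_int j * t))"

lemma circle_bounded_trig_poly: "circle_bounded (trig_poly G x)"
  unfolding trig_poly_def
  by (intro circle_bounded_sum circle_bounded_mult circle_bounded_const circle_bounded_cis)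

lemma integral_mult_cnj_trig_poly:
  assumes g: "circle_bounded g"
  shows "(LINT t|circle_measure. g t * cnj (trig_poly G x t)) = 2 * pi * (\<Sum>j\<in>G. cnj (x j) * period_fourier g j)"
proof -
  have i: "integrable circle_measure (\<lambda>t. g t * cis (- (of_int j * t)))" for j
    using circle_bounded_integrable[OF circle_bounded_mult[OF g circle_bounded_cis[of "- j"]]] by simp
  have "(LINT t|circle_measure. g t * cnj (trig_poly G x t)) =
      (LINT t|circle_measure. (\<Sum>j\<in>G. cnj (x j) * (g t * cis (- (of_int j * t)))))"
    by (simp add: trig_poly_def sum_distrib_left cis_cnj mult_ac)
  also have "\<dots> = (\<Sum>j\<in>G. cnj (x j) * (LINT t|circle_measure. g t * cis (- (of_int j * t))))"
    using i by (simp add: Bochner_Integration.integral_sum)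
  also have "\<dots> = 2 * pi * (\<Sum>j\<in>G. cnj (x j) * period_fourier g j)"
    by (simp add: period_fourier_def sum_distrib_left mult_ac)
  finally show ?thesis .
qed

lemma period_fourier_trig_poly:
  assumes "finite G"
  shows "period_fourier (trig_poly G x) k = (if k \<in> G then x k else 0)"
proof -
  have eq: "trig_poly G x t * cis (- (of_int k * t)) = (\<Sum>j\<in>G. x j * cis (of_int (j - k) * t))" for t
    unfolding trig_poly_def sum_distrib_right
    by (intro sum.cong refl) (simp add: mult.assoc cis_mult algebra_simps)
  have "(LINT t|circle_measure. trig_poly G x t * cis (- (of_int k * t))) =
      (\<Sum>j\<in>G. x j * (LINT t|circle_measure. cis (of_int (j - k) * t)))"
    unfolding eq using circle_bounded_integrable[OF circle_bounded_cis]
    by (subst Bochner_Integration.integral_sum) (auto intro!: integrable_mult_right simp del: of_int_diff)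
  also have "\<dots> = (\<Sum>j\<in>G. if j = k then 2 * pi * x k else 0)"
    unfolding integral_cis by (intro sum.cong) auto
  finally show ?thesis using assms by (simp add: period_fourier_def)
qed

lemma parseval_trig_poly:
  assumes "finite G"
  shows "(LINT t|circle_measure. (cmod (trig_poly G x t))\<^sup>2) = 2 * pi * (\<Sum>j\<in>G. (cmod (x j))\<^sup>2)"
proof -
  have "complex_of_real (LINT t|circle_measure. (cmod (trig_poly G x t))\<^sup>2) =
      (LINT t|circle_measure. trig_poly G x t * cnj (trig_poly G x t))"
    by (simp only: complex_norm_square flip: integral_complex_of_real)
  also have "\<dots> = 2 * pi * (\<Sum>j\<in>G. cnj (x j) * x j)"
    unfolding integral_mult_cnj_trig_poly[OF circle_bounded_trig_poly]
    using assms by (simp add: period_fourier_trig_poly cong: sum.cong)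
  also have "\<dots> = complex_of_real (2 * pi * (\<Sum>j\<in>G. (cmod (x j))\<^sup>2))"
    unfolding of_real_mult of_real_sum complex_norm_square by (simp add: mult.commute)
  finally show ?thesis by (simp only: of_real_eq_iff)
qed

text \<open>Bessel's inequality, by integrating the square of the distance between \<open>g\<close>
  and its Fourier sum \<open>?s\<close>: the mixed term contributes \<open>- 2 * ?S\<close> and the
  square of \<open>?s\<close> contributes \<open>?S\<close>.\<close>

lemma bessel_circle:
  assumes g: "circle_bounded g" and F: "finite F"
  shows "2 * pi * (\<Sum>k\<in>F. (cmod (period_fourier g k))\<^sup>2) \<le> (LINT t|circle_measure. (cmod (g t))\<^sup>2)"
proof -
  let ?s = "trig_poly F (period_fourier g)"
  let ?S = "2 * pi * (\<Sum>k\<in>F. (cmod (period_fourier g k))\<^sup>2)"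
  note s = circle_bounded_trig_poly[of F "period_fourier g"]
  have cS: "(LINT t|circle_measure. g t * cnj (?s t)) = complex_of_real ?S"
    unfolding integral_mult_cnj_trig_poly[OF g] of_real_mult of_real_sum complex_norm_square
    by (simp add: mult.commute)
  have i: "integrable circle_measure (\<lambda>t. g t * cnj (?s t))"
    by (intro circle_bounded_integrable circle_bounded_mult circle_bounded_cnj g s)
  have re: "(LINT t|circle_measure. Re (g t * cnj (?s t))) = ?S"
    using integral_Re[OF i] cS by simp
  have "0 \<le> (LINT t|circle_measure. (cmod (g t))\<^sup>2 - 2 * Re (g t * cnj (?s t)) + (cmod (?s t))\<^sup>2)"
  proof (rule Bochner_Integration.integral_nonneg)
    fix t
    have "(cmod (g t))\<^sup>2 - 2 * Re (g t * cnj (?s t)) + (cmod (?s t))\<^sup>2 = (cmod (g t - ?s t))\<^sup>2"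
      unfolding cmod_power2 by (simp add: power2_eq_square algebra_simps)
    then show "0 \<le> (cmod (g t))\<^sup>2 - 2 * Re (g t * cnj (?s t)) + (cmod (?s t))\<^sup>2" by simp
  qed
  also have "\<dots> = (LINT t|circle_measure. (cmod (g t))\<^sup>2) - 2 * ?S + ?S"
    using circle_bounded_square_integrable[OF g] circle_bounded_square_integrable[OF s] integrable_Re[OF i] re parseval_trig_poly[OF F, of "period_fourier g"]
    by (simp del: complex_cnj_mult times_complex.simps)
  finally show ?thesis by simp
qed

text \<open>A column-finite block applied to \<open>x\<close> produces Fourier coefficients of the
  symbol times the trigonometric polynomial with coefficients \<open>x\<close>. Bessel's inequality,
  the essential bound on the symbol and Parseval's identity give the estimate. With
  \<open>G = {0}\<close> it also says that the Fourier coefficients are square summable.\<close>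

lemma laurent_matrix_bound:
  assumes "a \<in> Linf_circle"
  shows "\<exists>C\<ge>0. \<forall>F G x. finite F \<longrightarrow> finite G \<longrightarrow>
      (\<Sum>i\<in>F. (cmod (\<Sum>j\<in>G. fourier_coeff a (i - j) * x j))\<^sup>2) \<le> C\<^sup>2 * (\<Sum>j\<in>G. (cmod (x j))\<^sup>2)"
proof -
  let ?A = "\<lambda>t. a (cis t)"
  have A: "circle_bounded ?A" using assms by (simp add: Linf_circle_def circle_bounded_def)
  obtain C0 where C0: "AE t in circle_measure. cmod (?A t) \<le> C0" using A by (auto simp: circle_bounded_def)
  define C where "C = \<bar>C0\<bar>"
  have C: "AE t in circle_measure. cmod (?A t) \<le> C" using C0 by eventually_elim (simp add: C_def)
  show ?thesis
  proof (intro exI[of _ C] conjI allI impI)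
    show "C \<ge> 0" by (simp add: C_def)
    fix F G :: "int set" and x assume F: "finite F" and G: "finite G"
    let ?g = "\<lambda>t. ?A t * trig_poly G x t"
    have g: "circle_bounded ?g" by (intro circle_bounded_mult A circle_bounded_trig_poly)
    have "period_fourier ?g i = (\<Sum>j\<in>G. fourier_coeff a (i - j) * x j)" for i
    proof -
      have eq: "?g t * cis (- (of_int i * t)) = (\<Sum>j\<in>G. x j * (?A t * cis (- (of_int (i - j) * t))))" for t
      proof -
        have "cis (- (of_int (i - j) * t)) = cis (of_int j * t) * cis (- (of_int i * t))" for j
          by (simp add: cis_mult algebra_simps)
        then show ?thesis
          unfolding trig_poly_def sum_distrib_right sum_distrib_left by (simp only: mult_ac)
      qed
      have "integrable circle_measure (\<lambda>t. ?A t * cis (- (of_int k * t)))" for k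
        using circle_bounded_integrable[OF circle_bounded_mult[OF A circle_bounded_cis[of "- k"]]] by simp
      then have "(LINT t|circle_measure. ?g t * cis (- (of_int i * t))) =
          (\<Sum>j\<in>G. x j * (LINT t|circle_measure. ?A t * cis (- (of_int (i - j) * t))))"
        unfolding eq
        by (subst Bochner_Integration.integral_sum) (auto intro!: integrable_mult_right simp del: of_int_diff)
      then show ?thesis unfolding period_fourier_def fourier_coeff_def by (simp add: sum_divide_distrib mult.commute)
    qed
    then have "2 * pi * (\<Sum>i\<in>F. (cmod (\<Sum>j\<in>G. fourier_coeff a (i - j) * x j))\<^sup>2) \<le>
        (LINT t|circle_measure. (cmod (?g t))\<^sup>2)"
      using bessel_circle[OF g F] by simp
    also have "\<dots> \<le> (LINT t|circle_measure. C\<^sup>2 * (cmod (trig_poly G x t))\<^sup>2)"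
    proof (rule integral_mono_AE)
      show "integrable circle_measure (\<lambda>t. (cmod (?g t))\<^sup>2)" by (rule circle_bounded_square_integrable[OF g])
      show "integrable circle_measure (\<lambda>t. C\<^sup>2 * (cmod (trig_poly G x t))\<^sup>2)"
        by (intro integrable_mult_right circle_bounded_square_integrable circle_bounded_trig_poly)
      show "AE t in circle_measure. (cmod (?g t))\<^sup>2 \<le> C\<^sup>2 * (cmod (trig_poly G x t))\<^sup>2"
        using C by eventually_elim (simp add: norm_mult power_mult_distrib mult_right_mono power_mono)
    qed
    also have "\<dots> = 2 * pi * (C\<^sup>2 * (\<Sum>j\<in>G. (cmod (x j))\<^sup>2))"
      by (simp add: parseval_trig_poly[OF G])
    finally show "(\<Sum>i\<in>F. (cmod (\<Sum>j\<in>G. fourier_coeff a (i - j) * x j))\<^sup>2) \<le> C\<^sup>2 * (\<Sum>j\<in>G. (cmod (x j))\<^sup>2)"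
      by (simp add: mult_le_cancel_left_pos)
  qed
qed

text \<open>Linearity and boundedness are needed before \<^const>\<open>Blinfun\<close> in the definition of
  \<^const>\<open>laurent\<close> means anything; both come from the bound on finite blocks.\<close>
lemma laurent_apply:
  assumes a: "a \<in> Linf_circle"
  shows "coord (laurent a x) i = (\<Sum>\<^sub>\<infinity>j. fourier_coeff a (i - j) * coord x j)"
    and complex_linear_laurent: "complex_linear (laurent a)"
proof -
  obtain C where C: "C \<ge> 0" and bound: "\<And>F G x. finite F \<Longrightarrow> finite G \<Longrightarrow>
      (\<Sum>i\<in>F. (cmod (\<Sum>j\<in>G. fourier_coeff a (i - j) * x j))\<^sup>2) \<le> C\<^sup>2 * (\<Sum>j\<in>G. (cmod (x j))\<^sup>2)"
    using laurent_matrix_bound[OF a] by blast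
  define M where "M x i = (\<Sum>\<^sub>\<infinity>j. fourier_coeff a (i - j) * coord x j)" for x i
  \<comment> \<open>The block consisting of the single column 0 gives the square summability, whence
    the series defining \<open>M x i\<close> converges.\<close>
  have sq: "(\<lambda>j. (cmod (cnj (fourier_coeff a (i - j))))\<^sup>2) summable_on UNIV" for i
  proof (rule summable_on_square_boundedI)
    fix F :: "int set" assume F: "finite F"
    have "(\<Sum>j\<in>F. (cmod (cnj (fourier_coeff a (i - j))))\<^sup>2) = (\<Sum>k\<in>(\<lambda>j. i - j) ` F. (cmod (fourier_coeff a k))\<^sup>2)"
      by (subst sum.reindex) (auto simp: inj_on_def)
    also have "\<dots> \<le> C\<^sup>2" using bound[of "(\<lambda>j. i - j) ` F" "{0}" "\<lambda>_. 1"] F by simp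
    finally show "(\<Sum>j\<in>F. (cmod (cnj (fourier_coeff a (i - j))))\<^sup>2) \<le> C\<^sup>2" .
  qed
  have summ: "(\<lambda>j. fourier_coeff a (i - j) * coord x j) summable_on UNIV" for i x
    using ell2_summable_mult[OF sq[of i] summable_coord[of x]] by simp
  \<comment> \<open>The rows stay in the finite set \<open>F\<close> while the column set
    \<open>G\<close> exhausts the integers; the block bound passes to the limit.\<close>
  have M_bound: "(\<Sum>i\<in>F. (cmod (M x i))\<^sup>2) \<le> (C * norm x)\<^sup>2" if F: "finite F" for F x
  proof (rule tendsto_upperbound)
    show "((\<lambda>G. \<Sum>i\<in>F. (cmod (\<Sum>j\<in>G. fourier_coeff a (i - j) * coord x j))\<^sup>2) \<longlongrightarrow>
        (\<Sum>i\<in>F. (cmod (M x i))\<^sup>2)) (finite_subsets_at_top UNIV)"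
      unfolding M_def
      by (intro tendsto_sum tendsto_power tendsto_norm infsum_tendsto summ)
    show "\<forall>\<^sub>F G in finite_subsets_at_top UNIV.
        (\<Sum>i\<in>F. (cmod (\<Sum>j\<in>G. fourier_coeff a (i - j) * coord x j))\<^sup>2) \<le> (C * norm x)\<^sup>2"
    proof (rule eventually_finite_subsets_at_top_weakI)
      fix G :: "int set" assume G: "finite G"
      have "(\<Sum>i\<in>F. (cmod (\<Sum>j\<in>G. fourier_coeff a (i - j) * coord x j))\<^sup>2) \<le>
          C\<^sup>2 * (\<Sum>j\<in>G. (cmod (coord x j))\<^sup>2)" by (rule bound[OF F G])
      also have "\<dots> \<le> C\<^sup>2 * (norm x)\<^sup>2" by (intro mult_left_mono sum_coord_le_norm G) simp
      finally show "(\<Sum>i\<in>F. (cmod (\<Sum>j\<in>G. fourier_coeff a (i - j) * coord x j))\<^sup>2) \<le> (C * norm x)\<^sup>2"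
        by (simp add: power_mult_distrib)
    qed
  qed simp
  define L where "L x = Abs_ell2 (M x)" for x
  have coord_L: "coord (L x) = M x" for x
    unfolding L_def by (subst Abs_ell2_inverse) (auto intro: summable_on_square_boundedI M_bound)
  have M_add: "M (x + y) i = M x i + M y i" for x y i
    unfolding M_def by (simp add: distrib_left infsum_add summ)
  have M_scale: "M (cscale c x) i = c * M x i" for c x i
    unfolding M_def by (simp add: mult.left_commute infsum_cmult_right')
  have "bounded_linear L"
  proof (rule bounded_linear_intro[where K = C])
    show "L (x + y) = L x + L y" for x y by (rule ell2_eqI) (simp add: coord_L M_add)
    show "L (r *\<^sub>R x) = r *\<^sub>R L x" for r x
      by (rule ell2_eqI) (simp add: coord_L M_scale scaleR_eq_cscale)
    show "norm (L x) \<le> norm x * C" for x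
      using M_bound[of _ x] C by (intro norm_ell2_leI) (simp_all add: coord_L mult.commute)
  qed
  moreover have "laurent a = Blinfun L"
    by (simp add: laurent_def L_def[abs_def] M_def[abs_def])
  ultimately have app: "laurent a x = L x" for x by (simp add: bounded_linear_Blinfun_apply)
  show "coord (laurent a x) i = (\<Sum>\<^sub>\<infinity>j. fourier_coeff a (i - j) * coord x j)"
    by (simp add: app coord_L M_def)
  show "complex_linear (laurent a)"
    unfolding complex_linear_def app by (auto intro!: ell2_eqI simp: coord_L M_scale)
qed

section \<open>Compressions to the half-axis and their matrix entries\<close>

lemma extend_unit_vector [simp]: "extend (unit_vector j) = unit_vector (int j)"
  by (rule ell2_eqI) (auto simp: extend.rep_eq)

lemma extend_cscale: "extend (cscale c x) = cscale c (extend x)"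
  by (rule ell2_eqI) (simp add: extend.rep_eq)

lemma restr_cscale: "restr (cscale c x) = cscale c (restr x)"
  by (rule ell2_eqI) (simp add: restr.rep_eq)

lemma complex_linear_compression: "complex_linear T \<Longrightarrow> complex_linear (compression T)"
  by (simp add: complex_linear_def compression_apply extend_cscale restr_cscale)

lemma entry_compression: "entry (compression T) i j = entry T (int i) (int j)"
  by (simp add: entry_def compression_apply restr.rep_eq)

lemma entry_toeplitz:
  assumes "a \<in> Linf_circle"
  shows "entry (toeplitz a) i j = fourier_coeff a (int i - int j)"
proof -
  have "coord (laurent a (unit_vector (int j))) (int i) = (\<Sum>\<^sub>\<infinity>k\<in>{int j}. fourier_coeff a (int i - k))"
    unfolding laurent_apply[OF assms] by (rule infsum_cong_neutral) auto
  then show ?thesis unfolding toeplitz_def entry_compression unfolding entry_def by simp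
qed

lemma complex_linear_toeplitz: "a \<in> Linf_circle \<Longrightarrow> complex_linear (toeplitz a)"
  by (simp add: toeplitz_def complex_linear_compression complex_linear_laurent)

lemma entry_mult_op: "entry (compression (mult_op b)) i j = (if i = j then b (int j) else 0)"
  unfolding entry_compression by (simp add: entry_def mult_op_apply mult_fun.rep_eq)

lemma complex_linear_mult_op: "complex_linear (mult_op b)"
  unfolding complex_linear_def mult_op_apply
  by (auto intro!: ell2_eqI simp: mult_fun.rep_eq)

section \<open>The generators satisfy the column condition\<close>

lemma ap_bands_sum:
  assumes "finite K"
  shows "(\<lambda>j. \<Sum>k\<in>K. cscale (c k) (unit_vector (nat (int j + k)))) \<in> ap_bands"
  using assms
proof induction
  case (insert k K)
  from ap_bands.add[OF insert.IH AP_const[of "c k"], of k] show ?case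
    using insert.hyps by (simp add: const_bcontfun.rep_eq add.commute)
qed (simp add: ap_bands.zero)

text \<open>Column \<open>j\<close> is the sequence \<open>c\<close> moved by \<open>j\<close> and
  cut off at row 0, so truncating \<open>c\<close> to a finite set \<open>K\<close> with small tail
  serves all late columns at once. Being stated for entries, the lemma applies to
  \<open>T(a)\<close> and to its adjoint alike.\<close>

lemma ap_columns_toeplitz_entries:
  assumes T: "\<And>i j. entry T i j = c (int i - int j)"
    and c: "\<And>F. finite F \<Longrightarrow> (\<Sum>k\<in>F. (cmod (c k))\<^sup>2) \<le> B"
  shows "ap_columns T"
  unfolding ap_columns_def
proof (intro allI impI)
  fix e :: real assume e: "e > 0"
  define S where "S = (\<Sum>\<^sub>\<infinity>k. (cmod (c k))\<^sup>2)"
  have summ: "(\<lambda>k. (cmod (c k))\<^sup>2) summable_on UNIV" by (rule summable_on_square_boundedI[OF c])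
  have "((\<lambda>F. \<Sum>k\<in>F. (cmod (c k))\<^sup>2) \<longlongrightarrow> S) (finite_subsets_at_top UNIV)"
    unfolding S_def by (rule infsum_tendsto[OF summ])
  then have "\<forall>\<^sub>F F in finite_subsets_at_top UNIV. dist (\<Sum>k\<in>F. (cmod (c k))\<^sup>2) S < e\<^sup>2"
    using e by (intro tendstoD) simp_all
  then obtain K where K: "finite K" "dist (\<Sum>k\<in>K. (cmod (c k))\<^sup>2) S < e\<^sup>2"
    unfolding eventually_finite_subsets_at_top by blast
  define v where "v j = (\<Sum>k\<in>K. cscale (c k) (unit_vector (nat (int j + k))))" for j
  have v: "v \<in> ap_bands" unfolding v_def by (rule ap_bands_sum[OF K(1)])
  have tail: "(\<Sum>k\<in>F. (cmod (c k))\<^sup>2) \<le> e\<^sup>2" if "finite F" "F \<inter> K = {}" for F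
  proof -
    have "(\<Sum>k\<in>F. (cmod (c k))\<^sup>2) + (\<Sum>k\<in>K. (cmod (c k))\<^sup>2) = (\<Sum>k\<in>F \<union> K. (cmod (c k))\<^sup>2)"
      using that K(1) by (simp add: sum.union_disjoint)
    also have "\<dots> \<le> S"
      unfolding S_def using that K(1) by (intro finite_sum_le_infsum summ) auto
    finally show ?thesis using K(2) by (simp add: dist_real_def abs_less_iff)
  qed
  \<comment> \<open>Any upper bound for the \<open>\<bar>k\<bar>\<close> with
    \<open>k \<in> K\<close> would do; from column \<open>J\<close> on, no offset in
    \<open>K\<close> is cut off at row 0.\<close>
  define J where "J = (\<Sum>k\<in>K. nat \<bar>k\<bar>)"
  have "norm (T (unit_vector j) - v j) \<le> e" if j: "j \<ge> J" for j
  proof (rule norm_ell2_leI)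
    have nonneg: "int j + k \<ge> 0" if "k \<in> K" for k
    proof -
      have "nat \<bar>k\<bar> \<le> J" unfolding J_def using K(1) that by (intro member_le_sum) auto
      then show ?thesis using j by linarith
    qed
    have co: "coord (T (unit_vector j) - v j) i = (if int i - int j \<in> K then 0 else c (int i - int j))" for i
    proof -
      have "coord (v j) i = (\<Sum>k\<in>K. if k = int i - int j then c k else 0)"
        unfolding v_def coord_sum using nonneg by (intro sum.cong refl) (fastforce simp: nat_eq_iff)
      then show ?thesis using K(1) T[of i j] by (simp add: entry_def)
    qed
    fix F :: "nat set" assume F: "finite F"
    have "(\<Sum>i\<in>F. (cmod (coord (T (unit_vector j) - v j) i))\<^sup>2) =
        (\<Sum>i\<in>{i\<in>F. int i - int j \<notin> K}. (cmod (c (int i - int j)))\<^sup>2)"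
      unfolding co using F by (intro sum.mono_neutral_cong_right) auto
    also have "\<dots> = (\<Sum>k\<in>(\<lambda>i. int i - int j) ` {i\<in>F. int i - int j \<notin> K}. (cmod (c k))\<^sup>2)"
      by (subst sum.reindex) (auto simp: inj_on_def)
    also have "\<dots> \<le> e\<^sup>2" using F by (intro tail) auto
    finally show "(\<Sum>i\<in>F. (cmod (coord (T (unit_vector j) - v j) i))\<^sup>2) \<le> e\<^sup>2" .
  qed (use e in simp)
  then have "\<forall>\<^sub>F j in sequentially. norm (T (unit_vector j) - v j) \<le> e"
    unfolding eventually_sequentially by blast
  with v show "\<exists>v\<in>ap_bands. \<forall>\<^sub>F j in sequentially. norm (T (unit_vector j) - v j) \<le> e" by blast
qed

lemma ap_columns_diagonal_entries:
  fixes b :: "int \<Rightarrow>\<^sub>C complex"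
  assumes T: "\<And>i j. entry T i j = (if i = j then b (int j) else 0)" and b: "b \<in> AP"
  shows "ap_columns T"
proof -
  have eq: "T (unit_vector j) = cscale (b (int j)) (unit_vector j)" for j
    using T by (intro ell2_eqI) (simp add: entry_def)
  have "(\<lambda>j. T (unit_vector j)) \<in> ap_bands"
    using ap_bands.add[OF ap_bands.zero b, of 0] by (simp add: eq)
  then show ?thesis unfolding ap_columns_def by (intro allI impI bexI) auto
qed

text \<open>The column condition is not inherited by adjoints, since small columns can add up to
  large rows; it is required on both sides so that the set is closed under the involution.\<close>

definition ap_operators :: "(nat ell2 \<Rightarrow>\<^sub>L nat ell2) set" where
  "ap_operators = {T. complex_linear T \<and> ap_columns T \<and> (\<forall>R. is_adjoint R T \<longrightarrow> ap_columns R)}"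

lemma ap_operatorsI:
  assumes "complex_linear T" "ap_columns T" "is_adjoint R T" "ap_columns R"
  shows "T \<in> ap_operators"
  using assms is_adjoint_unique unfolding ap_operators_def by blast

lemma ap_operatorsE:
  assumes "T \<in> ap_operators"
  obtains R where "complex_linear T" "ap_columns T" "complex_linear R" "is_adjoint R T" "ap_columns R"
  using assms adjoint_exists[of T] complex_linear_adjoint unfolding ap_operators_def by blast

lemma toeplitz_in_ap_operators:
  assumes a: "a \<in> Linf_circle"
  shows "toeplitz a \<in> ap_operators"
proof -
  obtain C where "\<And>F G x. finite F \<Longrightarrow> finite G \<Longrightarrow>
      (\<Sum>i\<in>F. (cmod (\<Sum>j\<in>G. fourier_coeff a (i - j) * x j))\<^sup>2) \<le> C\<^sup>2 * (\<Sum>j\<in>G. (cmod (x j))\<^sup>2)"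
    using laurent_matrix_bound[OF a] by blast
  from this[of _ "{0}" "\<lambda>_. 1"] have C: "finite F \<Longrightarrow> (\<Sum>k\<in>F. (cmod (fourier_coeff a k))\<^sup>2) \<le> C\<^sup>2" for F
    by simp
  obtain R where R: "is_adjoint R (toeplitz a)" using adjoint_exists[OF complex_linear_toeplitz[OF a]] ..
  have "ap_columns (toeplitz a)"
    by (rule ap_columns_toeplitz_entries[OF entry_toeplitz[OF a] C])
  moreover have "ap_columns R"
  proof (rule ap_columns_toeplitz_entries)
    show "entry R i j = (\<lambda>k. cnj (fourier_coeff a (- k))) (int i - int j)" for i j
      by (simp add: entry_adjoint[OF R] entry_toeplitz[OF a])
    show "(\<Sum>k\<in>F. (cmod (cnj (fourier_coeff a (- k))))\<^sup>2) \<le> C\<^sup>2" if "finite F" for F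
      using C[of "uminus ` F"] that by (simp add: sum.reindex o_def)
  qed
  ultimately show ?thesis using ap_operatorsI complex_linear_toeplitz[OF a] R by blast
qed

lemma mult_op_in_ap_operators:
  assumes b: "b \<in> AP"
  shows "compression (mult_op b) \<in> ap_operators"
proof -
  have lin: "complex_linear (compression (mult_op b))"
    by (intro complex_linear_compression complex_linear_mult_op)
  obtain R where R: "is_adjoint R (compression (mult_op b))" using adjoint_exists[OF lin] ..
  have "ap_columns (compression (mult_op b))"
    by (rule ap_columns_diagonal_entries[OF entry_mult_op b])
  moreover have "ap_columns R"
    by (rule ap_columns_diagonal_entries[OF _ AP_bcnj[OF b]]) (simp add: entry_adjoint[OF R] entry_mult_op)
  ultimately show ?thesis using ap_operatorsI lin R by blast
qed

section \<open>The operators with the column condition on both sides form a closed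
  star-algebra\<close>

lemma complex_linear_0: "complex_linear 0"
  by (simp add: complex_linear_def)

lemma complex_linear_compose: "complex_linear T \<Longrightarrow> complex_linear S \<Longrightarrow> complex_linear (T o\<^sub>L S)"
  by (simp add: complex_linear_def)

lemma complex_linear_add: "complex_linear T \<Longrightarrow> complex_linear S \<Longrightarrow> complex_linear (T + S)"
  by (simp add: complex_linear_def blinfun.add_left cscale_add_right)

lemma complex_linear_cscale_op: "complex_linear T \<Longrightarrow> complex_linear (cscale_op c T)"
  by (simp add: complex_linear_def cscale_op_apply mult.commute)

text \<open>Taking adjoints does not increase distances, so approximants of \<open>T\<close> supply
  approximants of its adjoint. The same criterion later handles strong limits of matrix
  sequences.\<close>

lemma ap_operators_approx:
  assumes T: "complex_linear T" and approx: "\<And>e. e > 0 \<Longrightarrow> \<exists>S\<in>ap_operators. norm (T - S) \<le> e"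
  shows "T \<in> ap_operators"
proof -
  obtain R where R: "is_adjoint R T" using adjoint_exists[OF T] ..
  have "ap_columns T"
    by (rule ap_columns_approx) (use approx in \<open>auto simp: ap_operators_def\<close>)
  moreover have "ap_columns R"
  proof (rule ap_columns_approx)
    fix e :: real assume "e > 0"
    then obtain S where S: "S \<in> ap_operators" "norm (T - S) \<le> e" using approx by blast
    obtain S' where S': "is_adjoint S' S" "ap_columns S'" by (rule ap_operatorsE[OF S(1)])
    have "norm (R - S') \<le> norm (T - S)" by (rule norm_adjoint_le[OF is_adjoint_diff[OF R S'(1)]])
    with S S' show "\<exists>S. ap_columns S \<and> norm (R - S) \<le> e" by (meson order_trans)
  qed
  ultimately show ?thesis using T R ap_operatorsI by blast
qed

lemma closed_star_subalgebra_ap_operators: "closed_star_subalgebra ap_operators"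
  unfolding closed_star_subalgebra_def
proof (intro conjI ballI allI impI)
  show "ap_operators \<subseteq> Collect complex_linear" by (auto simp: ap_operators_def)
  show "0 \<in> ap_operators"
    by (rule ap_operatorsI[OF complex_linear_0 ap_columns_0 is_adjoint_0 ap_columns_0])
  show "closed ap_operators"
    unfolding closed_sequential_limits
  proof (intro allI impI, elim conjE)
    fix X T assume X: "\<forall>n. X n \<in> ap_operators" and lim: "X \<longlonglongrightarrow> T"
    show "T \<in> ap_operators"
    proof (rule ap_operators_approx)
      show "complex_linear T"
        unfolding complex_linear_def
      proof (intro allI)
        fix c x
        have ev: "(\<lambda>n. X n y) \<longlonglongrightarrow> T y" for y
          by (rule bounded_linear.tendsto[OF blinfun.bounded_linear_left lim])
        have "(\<lambda>n. X n (cscale c x)) \<longlonglongrightarrow> cscale c (T x)"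
          using bounded_linear.tendsto[OF bounded_linear_cscale ev[of x], of c] X
          by (simp add: ap_operators_def complex_linear_def)
        with ev show "T (cscale c x) = cscale c (T x)" by (rule LIMSEQ_unique)
      qed
      fix e :: real assume "e > 0"
      then have "\<forall>\<^sub>F n in sequentially. dist (X n) T < e" by (rule tendstoD[OF lim])
      then obtain n where "dist (X n) T < e" unfolding eventually_sequentially by blast
      then have "norm (T - X n) \<le> e" by (simp add: dist_norm norm_minus_commute)
      with X show "\<exists>S\<in>ap_operators. norm (T - S) \<le> e" by blast
    qed
  qed
next
  fix T S assume T: "T \<in> ap_operators" and S: "S \<in> ap_operators"
  obtain T' where T': "complex_linear T" "ap_columns T" "complex_linear T'" "is_adjoint T' T" "ap_columns T'"
    by (rule ap_operatorsE[OF T])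
  obtain S' where S': "complex_linear S" "ap_columns S" "complex_linear S'" "is_adjoint S' S" "ap_columns S'"
    by (rule ap_operatorsE[OF S])
  show "T + S \<in> ap_operators"
    by (rule ap_operatorsI[OF complex_linear_add ap_columns_add is_adjoint_add ap_columns_add]) (rule T' S')+
  show "T o\<^sub>L S \<in> ap_operators"
    by (rule ap_operatorsI[OF complex_linear_compose ap_columns_compose is_adjoint_compose ap_columns_compose])
      (rule T' S')+
next
  fix c T assume "T \<in> ap_operators"
  then obtain T' where T': "complex_linear T" "ap_columns T" "complex_linear T'" "is_adjoint T' T" "ap_columns T'"
    by (rule ap_operatorsE)
  show "cscale_op c T \<in> ap_operators"
    by (rule ap_operatorsI[OF complex_linear_cscale_op ap_columns_cscale is_adjoint_cscale_op ap_columns_cscale])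
      (rule T')+
next
  fix T R assume "T \<in> ap_operators" "is_adjoint R T"
  then show "R \<in> ap_operators"
    using is_adjoint_sym complex_linear_adjoint ap_operatorsI unfolding ap_operators_def by blast
qed

lemma alg_A_subset_ap_operators: "alg_A \<subseteq> ap_operators"
  unfolding alg_A_def
  by (rule hull_minimal)
    (auto intro: toeplitz_in_ap_operators mult_op_in_ap_operators closed_star_subalgebra_ap_operators)


section \<open>Traces and Hilbert-Schmidt norms of matrices\<close>

definition mat_trace :: "'a::comm_monoid_add mat \<Rightarrow> 'a" where
  "mat_trace A = (\<Sum>i<dim_row A. A $$ (i, i))"

lemma mat_trace_mult_commute:
  fixes A B :: "'a::comm_semiring_0 mat"
  assumes "A \<in> carrier_mat n m" "B \<in> carrier_mat m n"
  shows "mat_trace (A * B) = mat_trace (B * A)"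
proof -
  have "mat_trace (A * B) = (\<Sum>i<n. \<Sum>k<m. A $$ (i, k) * B $$ (k, i))"
    using assms by (simp add: mat_trace_def scalar_prod_def atLeast0LessThan)
  also have "\<dots> = (\<Sum>k<m. \<Sum>i<n. B $$ (k, i) * A $$ (i, k))"
    by (subst sum.swap) (simp add: mult.commute)
  also have "\<dots> = mat_trace (B * A)"
    using assms by (simp add: mat_trace_def scalar_prod_def atLeast0LessThan)
  finally show ?thesis .
qed

lemma proots_linear_factors: "proots (\<Prod>e\<leftarrow>es. [:- e, 1:]) = mset es"
  for es :: "'a::idom list"
  by (induction es) (simp_all add: proots_mult prod_list_zero_iff image_iff del: mult_pCons_left)

text \<open>The characteristic polynomial splits over the complex numbers, and the Schur
  decomposition makes \<open>A\<close> similar to a triangular matrix whose diagonal is the list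
  \<open>es\<close> of its roots with multiplicity. The trace is invariant under similarity.\<close>

lemma sum_eigenvalues_eq_trace:
  assumes A: "A \<in> carrier_mat n n"
  shows "sum_mset (eigenvalues A) = mat_trace A"
proof -
  obtain es where es: "char_poly A = (\<Prod>e\<leftarrow>es. [:- e, 1:])" using char_poly_factorized[OF A] by blast
  obtain B P Q where BPQ: "schur_decomposition A es = (B, P, Q)" by (cases "schur_decomposition A es")
  have wit: "similar_mat_wit A B P Q" and diag: "diag_mat B = es"
    using schur_decomposition[OF A es BPQ] by auto
  note w = similar_mat_witD2[OF A wit]
  have "mat_trace A = mat_trace (P * (B * Q))" using w by (simp add: assoc_mult_mat[of P n n B n Q n])
  also have "\<dots> = mat_trace (B * Q * P)"
    using w by (intro mat_trace_mult_commute[of _ n n]) auto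
  also have "B * Q * P = B" using w by (simp add: assoc_mult_mat[of B n n Q n P n])
  also have "mat_trace B = sum_list (diag_mat B)"
    by (simp add: mat_trace_def diag_mat_def interv_sum_list_conv_sum_set_nat atLeast0LessThan)
  also have "\<dots> = sum_mset (eigenvalues A)"
    by (simp add: diag eigenvalues_def es proots_linear_factors sum_mset_sum_list)
  finally show ?thesis ..
qed

section \<open>Matrices as operators on square-summable sequences\<close>

lemma mat_adjoint_dim [simp]:
  "dim_row (mat_adjoint A) = dim_col A" "dim_col (mat_adjoint A) = dim_row A"
  by (simp_all add: mat_adjoint_def)

lemma mat_adjoint_carrier: "A \<in> carrier_mat n m \<Longrightarrow> mat_adjoint A \<in> carrier_mat m n"
  by auto

lemma mat_adjoint_index [simp]:
  "i < dim_col A \<Longrightarrow> j < dim_row A \<Longrightarrow> mat_adjoint A $$ (i, j) = cnj (A $$ (j, i))"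
  for A :: "complex mat"
  by (simp add: mat_adjoint_def mat_of_rows_index)

lemma mat_adjoint_adjoint [simp]: "mat_adjoint (mat_adjoint A) = A" for A :: "complex mat"
  by (rule eq_matI) simp_all

lemma coord_mat_op:
  assumes "M \<in> carrier_mat n n"
  shows "coord (mat_op M x) i = (if i < n then \<Sum>j<n. M $$ (i, j) * coord x j else 0)"
  using assms by (auto simp: mat_op.rep_eq)

lemma mat_op_add:
  assumes "M \<in> carrier_mat n n" "N \<in> carrier_mat n n"
  shows "mat_op (M + N) x = mat_op M x + mat_op N x"
proof (rule ell2_eqI)
  have "M + N \<in> carrier_mat n n" using assms by simp
  then show "coord (mat_op (M + N) x) i = coord (mat_op M x + mat_op N x) i" for i
    using assms by (auto simp: coord_mat_op[of _ n] distrib_right sum.distrib intro!: sum.cong)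
qed

lemma mat_op_diff:
  assumes "M \<in> carrier_mat n n" "N \<in> carrier_mat n n"
  shows "mat_op (M - N) x = mat_op M x - mat_op N x"
proof (rule ell2_eqI)
  have "M - N \<in> carrier_mat n n" by (rule minus_carrier_mat[OF assms(2)])
  then show "coord (mat_op (M - N) x) i = coord (mat_op M x - mat_op N x) i" for i
    using assms by (auto simp: coord_mat_op[of _ n] left_diff_distrib simp flip: sum_subtractf intro!: sum.cong)
qed

lemma mat_op_smult: "mat_op (c \<cdot>\<^sub>m M) x = cscale c (mat_op M x)"
  by (rule ell2_eqI) (simp add: mat_op.rep_eq sum_distrib_left mult.assoc)

lemma mat_op_mult:
  assumes "M \<in> carrier_mat n n" "N \<in> carrier_mat n n"
  shows "mat_op (M * N) x = mat_op M (mat_op N x)"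
proof (rule ell2_eqI)
  fix i
  have MN: "M * N \<in> carrier_mat n n" using assms by simp
  have "(\<Sum>j<n. (M * N) $$ (i, j) * coord x j) = (\<Sum>k<n. M $$ (i, k) * (\<Sum>j<n. N $$ (k, j) * coord x j))"
    if "i < n"
  proof -
    have "(\<Sum>j<n. (M * N) $$ (i, j) * coord x j) = (\<Sum>j<n. \<Sum>k<n. M $$ (i, k) * N $$ (k, j) * coord x j)"
      using assms that by (simp add: scalar_prod_def atLeast0LessThan sum_distrib_right)
    also have "\<dots> = (\<Sum>k<n. M $$ (i, k) * (\<Sum>j<n. N $$ (k, j) * coord x j))"
      by (subst sum.swap) (simp add: sum_distrib_left mult.assoc)
    finally show ?thesis .
  qed
  then show "coord (mat_op (M * N) x) i = coord (mat_op M (mat_op N x)) i"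
    using assms by (simp add: coord_mat_op[OF MN] coord_mat_op[of _ n])
qed

lemma mat_op_cscale: "mat_op M (cscale c x) = cscale c (mat_op M x)"
  by (rule ell2_eqI) (simp add: mat_op.rep_eq sum_distrib_left mult.left_commute)

lemma mat_op_plus: "mat_op M (x + y) = mat_op M x + mat_op M y"
  by (rule ell2_eqI) (simp add: mat_op.rep_eq distrib_left sum.distrib)

lemma bounded_linear_mat_op: "bounded_linear (mat_op M)"
proof (rule bounded_linear_intro)
  let ?K = "\<Sum>i<dim_row M. \<Sum>j<dim_col M. cmod (M $$ (i, j))"
  show "mat_op M (x + y) = mat_op M x + mat_op M y" for x y by (rule mat_op_plus)
  show "mat_op M (r *\<^sub>R x) = r *\<^sub>R mat_op M x" for r x by (simp add: scaleR_eq_cscale mat_op_cscale)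
  show "norm (mat_op M x) \<le> norm x * ?K" for x
  proof -
    have "mat_op M x = (\<Sum>i<dim_row M. \<Sum>j<dim_col M. cscale (M $$ (i, j) * coord x j) (unit_vector i))"
    proof (rule ell2_eqI)
      fix k
      have "coord (\<Sum>i<dim_row M. \<Sum>j<dim_col M. cscale (M $$ (i, j) * coord x j) (unit_vector i)) k
          = (\<Sum>i<dim_row M. if i = k then (\<Sum>j<dim_col M. M $$ (i, j) * coord x j) else 0)"
        unfolding coord_sum by (intro sum.cong refl) auto
      then show "coord (mat_op M x) k = coord (\<Sum>i<dim_row M. \<Sum>j<dim_col M. cscale (M $$ (i, j) * coord x j) (unit_vector i)) k"
        by (simp add: mat_op.rep_eq)
    qed
    also have "norm \<dots> \<le> (\<Sum>i<dim_row M. \<Sum>j<dim_col M. cmod (M $$ (i, j)) * norm x)"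
      by (intro sum_norm_le) (simp add: norm_cscale norm_mult mult_left_mono cmod_coord_le)
    also have "\<dots> = norm x * ?K" by (simp add: sum_distrib_left mult.commute)
    finally show ?thesis .
  qed
qed

lemma cinner_mat_adjoint:
  assumes M: "M \<in> carrier_mat n n"
  shows "cinner (mat_op (mat_adjoint M) y) x = cinner y (mat_op M x)"
proof -
  note M' = mat_adjoint_carrier[OF M]
  have "cinner (mat_op (mat_adjoint M) y) x = (\<Sum>\<^sub>\<infinity>i\<in>{..<n}. cnj (coord (mat_op (mat_adjoint M) y) i) * coord x i)"
    unfolding cinner.rep_eq by (rule infsum_cong_neutral) (auto simp: coord_mat_op[OF M'])
  also have "\<dots> = (\<Sum>i<n. \<Sum>j<n. M $$ (j, i) * cnj (coord y j) * coord x i)"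
    using M by (simp add: coord_mat_op[OF M'] sum_distrib_right)
  also have "\<dots> = (\<Sum>j<n. cnj (coord y j) * coord (mat_op M x) j)"
    by (subst sum.swap) (simp add: coord_mat_op[OF M] sum_distrib_left mult_ac)
  also have "\<dots> = (\<Sum>\<^sub>\<infinity>j\<in>{..<n}. cnj (coord y j) * coord (mat_op M x) j)" by simp
  also have "\<dots> = cinner y (mat_op M x)"
    unfolding cinner.rep_eq by (rule infsum_cong_neutral) (auto simp: coord_mat_op[OF M])
  finally show ?thesis .
qed

lemma norm_mat_adjoint_le:
  assumes M: "M \<in> carrier_mat n n" and bound: "\<And>x. norm (mat_op M x) \<le> C * norm x"
  shows "norm (mat_op (mat_adjoint M) y) \<le> C * norm y"
proof -
  let ?z = "mat_op (mat_adjoint M) y"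
  have "norm ?z * norm ?z = cmod (cinner ?z ?z)" by (simp add: cinner_self power2_eq_square norm_mult)
  also have "\<dots> = cmod (cinner y (mat_op M ?z))" by (simp add: cinner_mat_adjoint[OF M])
  also have "\<dots> \<le> norm y * norm (mat_op M ?z)" by (rule norm_cinner_le)
  also have "\<dots> \<le> norm y * (C * norm ?z)" by (intro mult_left_mono bound) simp
  finally have *: "norm ?z * norm ?z \<le> (C * norm y) * norm ?z" by (simp add: mult_ac)
  \<comment> \<open>The sign of \<open>C\<close> is read off by testing the bound on a unit
    vector.\<close>
  have "0 \<le> C" using order_trans[OF norm_ge_zero bound[of "unit_vector 0"]] by simp
  then show ?thesis using * by (cases "norm ?z = 0") (simp_all add: mult_le_cancel_right)
qed

section \<open>Squared Hilbert-Schmidt norms\<close>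

definition hs_norm_sq :: "complex mat \<Rightarrow> real" where
  "hs_norm_sq M = (\<Sum>j<dim_col M. \<Sum>i<dim_row M. (cmod (M $$ (i, j)))\<^sup>2)"

lemma hs_norm_sq_nonneg: "0 \<le> hs_norm_sq M"
  unfolding hs_norm_sq_def by (intro sum_nonneg) simp

lemma hs_norm_sq_columns:
  assumes M: "M \<in> carrier_mat n n"
  shows "hs_norm_sq M = (\<Sum>j<n. (norm (mat_op M (unit_vector j)))\<^sup>2)"
proof -
  have "(norm (mat_op M (unit_vector j)))\<^sup>2 = (\<Sum>i<n. (cmod (M $$ (i, j)))\<^sup>2)" if "j < n" for j
  proof -
    have "coord (mat_op M (unit_vector j)) i = (if i < n then M $$ (i, j) else 0)" for i
      using that by (simp add: coord_mat_op[OF M] if_distrib[of "\<lambda>c. _ * c"] cong: if_cong)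
    then show ?thesis by (subst norm_ell2_finite_support[of "{..<n}"]) auto
  qed
  then show ?thesis using M by (simp add: hs_norm_sq_def)
qed

lemma hs_norm_sq_adjoint: "hs_norm_sq (mat_adjoint M) = hs_norm_sq M"
  unfolding hs_norm_sq_def by (subst sum.swap) simp

lemma power2_sum3_le: "(a + b + c)\<^sup>2 \<le> 3 * (a\<^sup>2 + b\<^sup>2 + c\<^sup>2)" for a b c :: real
  using zero_le_power2[of "a - b"] zero_le_power2[of "b - c"] zero_le_power2[of "a - c"]
  by (simp add: power2_eq_square algebra_simps)

text \<open>Stands in for the triangle inequality; the factor 3 is harmless since only the order
  o(n) matters. Formulating the decomposition through \<open>mat_op\<close> reduces it to vector
  identities.\<close>

lemma hs_norm_sq_le3:
  assumes c: "M \<in> carrier_mat n n" "M1 \<in> carrier_mat n n" "M2 \<in> carrier_mat n n" "M3 \<in> carrier_mat n n"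
    and eq: "\<And>x. mat_op M x = mat_op M1 x + mat_op M2 x + mat_op M3 x"
  shows "hs_norm_sq M \<le> 3 * (hs_norm_sq M1 + hs_norm_sq M2 + hs_norm_sq M3)"
proof -
  have "hs_norm_sq M \<le> (\<Sum>j<n. 3 * ((norm (mat_op M1 (unit_vector j)))\<^sup>2 + (norm (mat_op M2 (unit_vector j)))\<^sup>2
      + (norm (mat_op M3 (unit_vector j)))\<^sup>2))"
    unfolding hs_norm_sq_columns[OF c(1)] eq
    by (intro sum_mono order_trans[OF power_mono power2_sum3_le])
      (auto intro!: order_trans[OF norm_triangle_ineq] norm_triangle_ineq)
  then show ?thesis
    by (simp add: hs_norm_sq_columns[OF c(2)] hs_norm_sq_columns[OF c(3)] hs_norm_sq_columns[OF c(4)] sum.distrib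
        flip: sum_distrib_left)
qed

lemma hs_norm_sq_mult_left:
  assumes c: "M \<in> carrier_mat n n" "N \<in> carrier_mat n n" and bound: "\<And>x. norm (mat_op M x) \<le> C * norm x"
  shows "hs_norm_sq (M * N) \<le> C\<^sup>2 * hs_norm_sq N"
proof -
  have "hs_norm_sq (M * N) = (\<Sum>j<n. (norm (mat_op M (mat_op N (unit_vector j))))\<^sup>2)"
    using c by (subst hs_norm_sq_columns[of _ n]) (simp_all add: mat_op_mult[OF c])
  also have "\<dots> \<le> (\<Sum>j<n. (C * norm (mat_op N (unit_vector j)))\<^sup>2)"
    by (intro sum_mono power_mono bound) simp
  also have "\<dots> = C\<^sup>2 * hs_norm_sq N" by (simp add: hs_norm_sq_columns[OF c(2)] power_mult_distrib sum_distrib_left)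
  finally show ?thesis .
qed

lemma mat_adjoint_mult:
  fixes M N :: "complex mat"
  assumes "M \<in> carrier_mat n n" "N \<in> carrier_mat n n"
  shows "mat_adjoint (M * N) = mat_adjoint N * mat_adjoint M"
  using assms by (intro eq_matI) (auto simp: scalar_prod_def mult.commute intro!: sum.cong)

text \<open>A right factor mixes the columns, but after taking adjoints it becomes a left factor
  acting on each column separately.\<close>

lemma hs_norm_sq_mult_right:
  assumes c: "M \<in> carrier_mat n n" "N \<in> carrier_mat n n" and bound: "\<And>x. norm (mat_op N x) \<le> C * norm x"
  shows "hs_norm_sq (M * N) \<le> C\<^sup>2 * hs_norm_sq M"
proof -
  have "hs_norm_sq (M * N) = hs_norm_sq (mat_adjoint N * mat_adjoint M)"
    unfolding mat_adjoint_mult[OF c, symmetric] hs_norm_sq_adjoint ..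
  also have "\<dots> \<le> C\<^sup>2 * hs_norm_sq (mat_adjoint M)"
    by (rule hs_norm_sq_mult_left[OF mat_adjoint_carrier[OF c(2)] mat_adjoint_carrier[OF c(1)]])
      (rule norm_mat_adjoint_le[OF c(2) bound])
  finally show ?thesis by (simp add: hs_norm_sq_adjoint)
qed

text \<open>An error of operator norm \<open>C\<close> costs \<open>C^2\<close> after division by
  \<open>n\<close>. For this reason closeness to finite sections survives limits in the supremum
  norm of sequences.\<close>

lemma hs_norm_sq_le_bound:
  assumes M: "M \<in> carrier_mat n n" and bound: "\<And>x. norm (mat_op M x) \<le> C * norm x"
  shows "hs_norm_sq M \<le> real n * C\<^sup>2"
proof -
  have "hs_norm_sq M \<le> (\<Sum>j<n. (C * norm (unit_vector j :: nat ell2))\<^sup>2)"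
    unfolding hs_norm_sq_columns[OF M] by (intro sum_mono power_mono bound) simp
  then show ?thesis by simp
qed

lemma trace_le_hs_norm_sq:
  assumes M: "M \<in> carrier_mat n n"
  shows "(cmod (mat_trace M))\<^sup>2 \<le> real n * hs_norm_sq M"
proof -
  have "cmod (mat_trace M) \<le> (\<Sum>i<n. cmod (M $$ (i, i)))"
    using M by (simp add: mat_trace_def norm_sum)
  then have "(cmod (mat_trace M))\<^sup>2 \<le> (\<Sum>i<n. cmod (M $$ (i, i)))\<^sup>2" by (intro power_mono) simp_all
  also have "\<dots> \<le> real n * (\<Sum>i<n. (cmod (M $$ (i, i)))\<^sup>2)"
    using sum_squared_le_sum_of_squares[of "\<lambda>i. cmod (M $$ (i, i))" "{..<n}"] by (simp add: mult.commute)
  also have "(\<Sum>i<n. (cmod (M $$ (i, i)))\<^sup>2) \<le> hs_norm_sq M"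
    using M unfolding hs_norm_sq_def by (auto intro!: sum_mono member_le_sum)
  finally show ?thesis by (simp add: mult_left_mono)
qed


section \<open>Sequences of finite sections\<close>

lemma strong_limit_unique:
  assumes "strong_limit A T" "strong_limit A S"
  shows "T = S"
  using assms unfolding strong_limit_def by (intro blinfun_eqI) (metis LIMSEQ_unique)

lemma W_eqI: "strong_limit A T \<Longrightarrow> W A = T"
  unfolding W_def using strong_limit_unique by blast

lemma strong_limit_add:
  assumes "\<And>n. A n \<in> carrier_mat n n" "\<And>n. B n \<in> carrier_mat n n" "strong_limit A T" "strong_limit B S"
  shows "strong_limit (\<lambda>n. A n + B n) (T + S)"
  using assms(3,4) unfolding strong_limit_def mat_op_add[OF assms(1,2)] blinfun.add_left
  by (simp add: tendsto_add)

lemma strong_limit_smult: "strong_limit A T \<Longrightarrow> strong_limit (\<lambda>n. c \<cdot>\<^sub>m A n) (cscale_op c T)"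
  unfolding strong_limit_def mat_op_smult cscale_op_apply
  by (simp add: bounded_linear.tendsto[OF bounded_linear_cscale])

text \<open>Split into \<open>A n\<close> applied to \<open>B n x - S x\<close>, controlled by the
  uniform bound, and the convergence of \<open>A n\<close> at the fixed vector
  \<open>S x\<close>.\<close>

lemma strong_limit_mult:
  assumes A: "\<And>n. A n \<in> carrier_mat n n" and B: "\<And>n. B n \<in> carrier_mat n n"
    and lim: "strong_limit A T" "strong_limit B S"
    and bound: "\<And>n x. norm (mat_op (A n) x) \<le> C * norm x"
  shows "strong_limit (\<lambda>n. A n * B n) (T o\<^sub>L S)"
  unfolding strong_limit_def
proof
  fix x
  have "(\<lambda>n. mat_op (A n) (S x) - T (S x)) \<longlonglongrightarrow> 0"
    using lim(1) unfolding strong_limit_def by (intro LIM_zero) blast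
  moreover have "(\<lambda>n. mat_op (A n) (mat_op (B n) x - S x)) \<longlonglongrightarrow> 0"
  proof (rule Lim_null_comparison)
    show "\<forall>\<^sub>F n in sequentially. norm (mat_op (A n) (mat_op (B n) x - S x)) \<le> C * norm (mat_op (B n) x - S x)"
      using bound by simp
    have "(\<lambda>n. mat_op (B n) x - S x) \<longlonglongrightarrow> 0"
      using lim(2) unfolding strong_limit_def by (intro LIM_zero) blast
    then show "(\<lambda>n. C * norm (mat_op (B n) x - S x)) \<longlonglongrightarrow> 0"
      by (intro tendsto_mult_right_zero tendsto_norm_zero)
  qed
  ultimately have "(\<lambda>n. mat_op (A n) (mat_op (B n) x - S x) + (mat_op (A n) (S x) - T (S x))) \<longlonglongrightarrow> 0 + 0"
    by (intro tendsto_add)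
  moreover have "mat_op (A n) (mat_op (B n) x - S x) + (mat_op (A n) (S x) - T (S x)) =
      mat_op (A n * B n) x - (T o\<^sub>L S) x" for n
    by (simp add: mat_op_mult[OF A B] linear_diff[OF bounded_linear.linear[OF bounded_linear_mat_op]])
  ultimately show "(\<lambda>n. mat_op (A n * B n) x) \<longlonglongrightarrow> (T o\<^sub>L S) x"
    by (simp add: LIM_zero_iff)
qed

text \<open>The adjoint relation of the matrices passes to the limit in the inner product. It
  identifies the limit of the adjoint sequence and, through \<open>complex_linear_adjoint\<close>,
  shows that both limits are complex-linear.\<close>

lemma strong_limit_is_adjoint:
  assumes A: "\<And>n. A n \<in> carrier_mat n n"
    and lim: "strong_limit A T" "strong_limit (\<lambda>n. mat_adjoint (A n)) R"
  shows "is_adjoint R T"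
  unfolding is_adjoint_def
proof (intro allI)
  fix x y
  have "(\<lambda>n. cinner y (mat_op (A n) x)) \<longlonglongrightarrow> cinner y (T x)"
    using lim(1) unfolding strong_limit_def by (simp add: bounded_linear.tendsto[OF bounded_linear_cinner_right])
  moreover have "(\<lambda>n. cnj (cinner x (mat_op (mat_adjoint (A n)) y))) \<longlonglongrightarrow> cnj (cinner x (R y))"
    using lim(2) unfolding strong_limit_def
    by (intro tendsto_cnj bounded_linear.tendsto[OF bounded_linear_cinner_right]) simp
  then have "(\<lambda>n. cinner y (mat_op (A n) x)) \<longlonglongrightarrow> cinner (R y) x"
    by (simp only: cinner_commute[symmetric] cinner_mat_adjoint[OF A])
  ultimately show "cinner (R y) x = cinner y (T x)" by (rule LIMSEQ_unique[rotated])
qed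

lemma finite_section_carrier [simp]: "finite_section T n \<in> carrier_mat n n"
  by (simp add: finite_section_def)

lemma mat_op_finite_section:
  assumes "complex_linear T"
  shows "mat_op (finite_section T n) x = trunc n (T (trunc n x))"
proof (rule ell2_eqI)
  fix i
  have "coord (T (trunc n x)) i = (\<Sum>j<n. entry T i j * coord x j)"
    unfolding trunc_eq_sum complex_linear_sum[OF assms] by (simp add: entry_def mult.commute)
  then show "coord (mat_op (finite_section T n) x) i = coord (trunc n (T (trunc n x))) i"
    by (simp add: coord_mat_op[OF finite_section_carrier]) (simp add: finite_section_def)
qed

lemma norm_finite_section_le:
  assumes "complex_linear T"
  shows "norm (mat_op (finite_section T n) x) \<le> norm T * norm x"
proof -
  have "norm (mat_op (finite_section T n) x) \<le> norm (T (trunc n x))"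
    unfolding mat_op_finite_section[OF assms] by (rule norm_trunc_le)
  also have "\<dots> \<le> norm T * norm (trunc n x)" by (rule norm_blinfun)
  also have "\<dots> \<le> norm T * norm x" by (intro mult_left_mono norm_trunc_le) simp
  finally show ?thesis .
qed

lemma trunc_diff: "trunc n (x - y) = trunc n x - trunc n y"
  by (rule ell2_eqI) simp

lemma strong_limit_finite_section:
  assumes T: "complex_linear T"
  shows "strong_limit (finite_section T) T"
  unfolding strong_limit_def
proof
  fix x
  have "(\<lambda>n. trunc n (T (trunc n x - x))) \<longlonglongrightarrow> 0"
  proof (rule Lim_null_comparison)
    show "\<forall>\<^sub>F n in sequentially. norm (trunc n (T (trunc n x - x))) \<le> norm T * norm (trunc n x - x)"
      by (intro always_eventually allI order_trans[OF norm_trunc_le norm_blinfun])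
    show "(\<lambda>n. norm T * norm (trunc n x - x)) \<longlonglongrightarrow> 0"
      by (intro tendsto_mult_right_zero tendsto_norm_zero LIM_zero trunc_tendsto)
  qed
  from tendsto_add[OF this trunc_tendsto[of "T x"]]
  show "(\<lambda>n. mat_op (finite_section T n) x) \<longlonglongrightarrow> T x"
    by (simp add: mat_op_finite_section[OF T] blinfun.diff_right trunc_diff)
qed

lemma mat_adjoint_finite_section:
  assumes "is_adjoint R T"
  shows "mat_adjoint (finite_section T n) = finite_section R n"
  by (rule eq_matI) (simp_all add: finite_section_def entry_adjoint[OF assms])

lemma finite_section_in_alg_F:
  assumes T: "complex_linear T"
  shows "finite_section T \<in> alg_F"
proof -
  obtain R where R: "is_adjoint R T" using adjoint_exists[OF T] ..
  have "strong_limit (\<lambda>n. mat_adjoint (finite_section T n)) R"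
    unfolding mat_adjoint_finite_section[OF R]
    by (rule strong_limit_finite_section[OF complex_linear_adjoint[OF R]])
  then show ?thesis
    unfolding alg_F_def using strong_limit_finite_section[OF T] by auto
qed

section \<open>The algebra of sequences close to finite sections of their limit\<close>

lemma seq_norm_lessD:
  assumes "seq_norm D < ennreal r"
  shows "norm (mat_op (D n) x) \<le> r * norm x"
proof -
  have "ennreal (onorm (mat_op (D n))) \<le> seq_norm D" unfolding seq_norm_def by (rule SUP_upper) simp
  also note assms
  finally have "onorm (mat_op (D n)) < r"
    by (simp add: ennreal_less_iff onorm_pos_le[OF bounded_linear_mat_op])
  then have "onorm (mat_op (D n)) * norm x \<le> r * norm x" by (intro mult_right_mono) simp_all
  then show ?thesis using onorm[OF bounded_linear_mat_op, of "D n" x] by linarith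
qed

text \<open>Strong limits are unique, so \<open>T\<close> is \<open>W A\<close> and the sequence is
  compared with the finite sections of its own limit. The uniform bound is what products use, both
  for the strong limit and for taking a factor out of the Hilbert-Schmidt norm.\<close>

definition ap_sequences :: "(nat \<Rightarrow> complex mat) set" where
  "ap_sequences = {A \<in> alg_F. (\<exists>C. \<forall>n x. norm (mat_op (A n) x) \<le> C * norm x) \<and>
     (\<exists>T\<in>ap_operators. strong_limit A T \<and> (\<lambda>n. hs_norm_sq (A n - finite_section T n) / real n) \<longlonglongrightarrow> 0)}"

lemma ap_sequencesD:
  assumes "A \<in> ap_sequences"
  shows "\<exists>C T R. (\<forall>n. A n \<in> carrier_mat n n) \<and> (\<forall>n x. norm (mat_op (A n) x) \<le> C * norm x) \<and>
    (\<forall>n x. norm (mat_op (mat_adjoint (A n)) x) \<le> C * norm x) \<and>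
    T \<in> ap_operators \<and> strong_limit A T \<and> strong_limit (\<lambda>n. mat_adjoint (A n)) R \<and> is_adjoint R T \<and>
    (\<lambda>n. hs_norm_sq (A n - finite_section T n) / real n) \<longlonglongrightarrow> 0"
proof -
  obtain C T R where *: "\<And>n. A n \<in> carrier_mat n n" "\<And>n x. norm (mat_op (A n) x) \<le> C * norm x"
    "T \<in> ap_operators" "strong_limit A T" "strong_limit (\<lambda>n. mat_adjoint (A n)) R"
    "(\<lambda>n. hs_norm_sq (A n - finite_section T n) / real n) \<longlonglongrightarrow> 0"
    using assms unfolding ap_sequences_def alg_F_def by blast
  show ?thesis
    using * norm_mat_adjoint_le[OF *(1,2)] strong_limit_is_adjoint[OF *(1,4,5)]
    by (intro exI[of _ C] exI[of _ T] exI[of _ R]) simp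
qed

lemma ap_sequencesI:
  assumes "\<And>n. A n \<in> carrier_mat n n" "\<And>n x. norm (mat_op (A n) x) \<le> C * norm x"
    "T \<in> ap_operators" "strong_limit A T" "strong_limit (\<lambda>n. mat_adjoint (A n)) R"
    "(\<lambda>n. hs_norm_sq (A n - finite_section T n) / real n) \<longlonglongrightarrow> 0"
  shows "A \<in> ap_sequences"
  using assms unfolding ap_sequences_def alg_F_def by blast

lemma hs_norm_sq_quotient_tendsto_0:
  assumes "\<And>n. hs_norm_sq (M n) \<le> g n" "(\<lambda>n. g n / real n) \<longlonglongrightarrow> 0"
  shows "(\<lambda>n. hs_norm_sq (M n) / real n) \<longlonglongrightarrow> 0"
  by (rule tendsto_sandwich[OF _ _ tendsto_const assms(2)])
    (simp_all add: hs_norm_sq_nonneg divide_right_mono assms(1))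

lemma hs_norm_sq_0 [simp]: "hs_norm_sq (0\<^sub>m n m) = 0"
  by (simp add: hs_norm_sq_def)

lemma mat_op_0 [simp]: "mat_op (0\<^sub>m n n) x = 0"
  by (rule ell2_eqI) (simp add: coord_mat_op[of _ n])

lemma finite_section_in_ap_sequences:
  assumes T: "T \<in> ap_operators"
  shows "finite_section T \<in> ap_sequences"
proof -
  have lin: "complex_linear T" using T by (simp add: ap_operators_def)
  obtain R where R: "strong_limit (\<lambda>n. mat_adjoint (finite_section T n)) R"
    using finite_section_in_alg_F[OF lin] by (auto simp: alg_F_def)
  have "finite_section T n - finite_section T n = 0\<^sub>m n n" for n
    by (rule minus_r_inv_mat[OF finite_section_carrier])
  then show ?thesis
    by (intro ap_sequencesI[OF finite_section_carrier norm_finite_section_le[OF lin] T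
          strong_limit_finite_section[OF lin] R]) (simp only: hs_norm_sq_0 div_0 tendsto_const)
qed

lemma ap_sequences_add:
  assumes "A \<in> ap_sequences" "B \<in> ap_sequences"
  shows "(\<lambda>n. A n + B n) \<in> ap_sequences"
proof -
  obtain C T R where A: "\<And>n. A n \<in> carrier_mat n n" "\<And>n x. norm (mat_op (A n) x) \<le> C * norm x"
    "T \<in> ap_operators" "strong_limit A T" "strong_limit (\<lambda>n. mat_adjoint (A n)) R"
    "(\<lambda>n. hs_norm_sq (A n - finite_section T n) / real n) \<longlonglongrightarrow> 0"
    using ap_sequencesD[OF assms(1)] by blast
  obtain D S Q where B: "\<And>n. B n \<in> carrier_mat n n" "\<And>n x. norm (mat_op (B n) x) \<le> D * norm x"
    "S \<in> ap_operators" "strong_limit B S" "strong_limit (\<lambda>n. mat_adjoint (B n)) Q"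
    "(\<lambda>n. hs_norm_sq (B n - finite_section S n) / real n) \<longlonglongrightarrow> 0"
    using ap_sequencesD[OF assms(2)] by blast
  have lin: "complex_linear T" "complex_linear S" using A(3) B(3) by (auto simp: ap_operators_def)
  show ?thesis
  proof (rule ap_sequencesI)
    show "A n + B n \<in> carrier_mat n n" for n using A(1) B(1) by simp
    show "norm (mat_op (A n + B n) x) \<le> (C + D) * norm x" for n x
      unfolding mat_op_add[OF A(1) B(1)] distrib_right by (intro norm_triangle_mono A B)
    show "T + S \<in> ap_operators"
      using closed_star_subalgebra_ap_operators A(3) B(3) by (simp add: closed_star_subalgebra_def)
    show "strong_limit (\<lambda>n. A n + B n) (T + S)" by (rule strong_limit_add) (rule A B)+
    have "mat_adjoint (A n + B n) = mat_adjoint (A n) + mat_adjoint (B n)" for n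
      using A(1)[of n] B(1)[of n] by (intro eq_matI) auto
    then show "strong_limit (\<lambda>n. mat_adjoint (A n + B n)) (R + Q)"
      using strong_limit_add[OF mat_adjoint_carrier[OF A(1)] mat_adjoint_carrier[OF B(1)] A(5) B(5)] by simp
    show "(\<lambda>n. hs_norm_sq (A n + B n - finite_section (T + S) n) / real n) \<longlonglongrightarrow> 0"
    proof (rule hs_norm_sq_quotient_tendsto_0)
      \<comment> \<open>There are only two error terms; the zero matrix fills the third place of
        \<open>hs_norm_sq_le3\<close>.\<close>
      show "hs_norm_sq (A n + B n - finite_section (T + S) n) \<le>
          3 * (hs_norm_sq (A n - finite_section T n) + hs_norm_sq (B n - finite_section S n) + hs_norm_sq (0\<^sub>m n n :: complex mat))" for n
      proof (rule hs_norm_sq_le3)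
        show "mat_op (A n + B n - finite_section (T + S) n) x = mat_op (A n - finite_section T n) x +
            mat_op (B n - finite_section S n) x + mat_op (0\<^sub>m n n) x" for x
          using A(1) B(1)
          by (simp add: mat_op_diff[of _ n] mat_op_add[of _ n] mat_op_finite_section lin complex_linear_add
              blinfun.add_left) (rule ell2_eqI, simp)
      qed (use A(1) B(1) in \<open>auto intro!: minus_carrier_mat\<close>)
      show "(\<lambda>n. 3 * (hs_norm_sq (A n - finite_section T n) + hs_norm_sq (B n - finite_section S n) + hs_norm_sq (0\<^sub>m n n :: complex mat)) / real n)
          \<longlonglongrightarrow> 0"
        using tendsto_mult_right_zero[OF tendsto_add_zero[OF A(6) B(6)], of 3]
        by (simp add: add_divide_distrib)
    qed
  qed
qed

lemma ap_sequences_smult: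
  assumes "A \<in> ap_sequences"
  shows "(\<lambda>n. c \<cdot>\<^sub>m A n) \<in> ap_sequences"
proof -
  obtain C T R where A: "\<And>n. A n \<in> carrier_mat n n" "\<And>n x. norm (mat_op (A n) x) \<le> C * norm x"
    "T \<in> ap_operators" "strong_limit A T" "strong_limit (\<lambda>n. mat_adjoint (A n)) R"
    "(\<lambda>n. hs_norm_sq (A n - finite_section T n) / real n) \<longlonglongrightarrow> 0"
    using ap_sequencesD[OF assms(1)] by blast
  show ?thesis
  proof (rule ap_sequencesI)
    show "c \<cdot>\<^sub>m A n \<in> carrier_mat n n" for n using A(1) by simp
    show "norm (mat_op (c \<cdot>\<^sub>m A n) x) \<le> (cmod c * C) * norm x" for n x
      unfolding mat_op_smult norm_cscale using mult_left_mono[OF A(2)] by (simp add: mult.assoc)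
    show "cscale_op c T \<in> ap_operators"
      using closed_star_subalgebra_ap_operators A(3) by (simp add: closed_star_subalgebra_def)
    show "strong_limit (\<lambda>n. c \<cdot>\<^sub>m A n) (cscale_op c T)" by (rule strong_limit_smult[OF A(4)])
    have "mat_adjoint (c \<cdot>\<^sub>m A n) = cnj c \<cdot>\<^sub>m mat_adjoint (A n)" for n
      by (rule eq_matI) simp_all
    then show "strong_limit (\<lambda>n. mat_adjoint (c \<cdot>\<^sub>m A n)) (cscale_op (cnj c) R)"
      using strong_limit_smult[OF A(5)] by simp
    have "hs_norm_sq (c \<cdot>\<^sub>m A n - finite_section (cscale_op c T) n) = (cmod c)\<^sup>2 * hs_norm_sq (A n - finite_section T n)" for n
      using A(1)[of n]
      by (simp add: hs_norm_sq_def sum_distrib_left finite_section_def entry_def cscale_op_apply norm_mult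
          power_mult_distrib flip: right_diff_distrib)
    then show "(\<lambda>n. hs_norm_sq (c \<cdot>\<^sub>m A n - finite_section (cscale_op c T) n) / real n) \<longlonglongrightarrow> 0"
      using tendsto_mult_right_zero[OF A(6)] by simp
  qed
qed

lemma ap_sequences_adjoint:
  assumes "A \<in> ap_sequences"
  shows "(\<lambda>n. mat_adjoint (A n)) \<in> ap_sequences"
proof -
  obtain C T R where A: "\<And>n. A n \<in> carrier_mat n n" "\<And>n x. norm (mat_op (A n) x) \<le> C * norm x"
    "\<And>n x. norm (mat_op (mat_adjoint (A n)) x) \<le> C * norm x"
    "T \<in> ap_operators" "strong_limit A T" "strong_limit (\<lambda>n. mat_adjoint (A n)) R" "is_adjoint R T"
    "(\<lambda>n. hs_norm_sq (A n - finite_section T n) / real n) \<longlonglongrightarrow> 0"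
    using ap_sequencesD[OF assms(1)] by blast
  show ?thesis
  proof (rule ap_sequencesI)
    show "mat_adjoint (A n) \<in> carrier_mat n n" for n by (rule mat_adjoint_carrier[OF A(1)])
    show "norm (mat_op (mat_adjoint (A n)) x) \<le> C * norm x" for n x by (rule A(3))
    show "R \<in> ap_operators"
      using closed_star_subalgebra_ap_operators A(4,7) by (simp add: closed_star_subalgebra_def)
    show "strong_limit (\<lambda>n. mat_adjoint (A n)) R" by (rule A(6))
    show "strong_limit (\<lambda>n. mat_adjoint (mat_adjoint (A n))) T" using A(5) by simp
    have "mat_adjoint (A n) - finite_section R n = mat_adjoint (A n - finite_section T n)" for n
      using A(1)[of n] by (intro eq_matI) (simp_all add: finite_section_def entry_adjoint[OF A(7)])
    then show "(\<lambda>n. hs_norm_sq (mat_adjoint (A n) - finite_section R n) / real n) \<longlonglongrightarrow> 0"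
      using A(8) by (simp add: hs_norm_sq_adjoint)
  qed
qed

text \<open>The difference is \<open>- P_n T (1 - P_n) S P_n\<close>. On \<open>e_j\<close> with
  \<open>j < n\<close> it applies \<open>T\<close> to the tail of \<open>S e_j\<close>, so only the
  columns of the right factor have to be controlled.\<close>

lemma hs_norm_sq_section_compose_le:
  assumes T: "complex_linear T" and S: "complex_linear S"
  shows "hs_norm_sq (finite_section T n * finite_section S n - finite_section (T o\<^sub>L S) n) \<le>
    (norm T)\<^sup>2 * (\<Sum>j<n. (norm (S (unit_vector j) - trunc n (S (unit_vector j))))\<^sup>2)"
proof -
  let ?M = "finite_section T n * finite_section S n - finite_section (T o\<^sub>L S) n"
  have "norm (mat_op ?M (unit_vector j)) \<le> norm T * norm (S (unit_vector j) - trunc n (S (unit_vector j)))"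
    if "j < n" for j
  proof -
    have tr: "trunc n (unit_vector j) = unit_vector j" using that by (intro ell2_eqI) auto
    have tt: "trunc n (trunc n x) = trunc n x" for x by (rule ell2_eqI) simp
    have "mat_op ?M (unit_vector j) = trunc n (T (trunc n (S (unit_vector j)) - S (unit_vector j)))"
      by (subst mat_op_diff[of _ n])
        (auto simp: mat_op_mult[of _ n] mat_op_finite_section T S complex_linear_compose tr tt
          trunc_diff blinfun.diff_right intro!: mult_carrier_mat[of _ n n])
    also have "norm \<dots> \<le> norm T * norm (trunc n (S (unit_vector j)) - S (unit_vector j))"
      by (rule order_trans[OF norm_trunc_le norm_blinfun])
    finally show ?thesis by (simp add: norm_minus_commute)
  qed
  then have "hs_norm_sq ?M \<le> (\<Sum>j<n. (norm T * norm (S (unit_vector j) - trunc n (S (unit_vector j))))\<^sup>2)"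
    by (subst hs_norm_sq_columns[OF minus_carrier_mat[OF finite_section_carrier]]) (auto intro!: sum_mono power_mono)
  then show ?thesis by (simp add: power_mult_distrib sum_distrib_left)
qed

lemma ap_sequences_mult:
  assumes "A \<in> ap_sequences" "B \<in> ap_sequences"
  shows "(\<lambda>n. A n * B n) \<in> ap_sequences"
proof -
  obtain C T R where A: "\<And>n. A n \<in> carrier_mat n n" "\<And>n x. norm (mat_op (A n) x) \<le> C * norm x"
    "T \<in> ap_operators" "strong_limit A T" "strong_limit (\<lambda>n. mat_adjoint (A n)) R"
    "(\<lambda>n. hs_norm_sq (A n - finite_section T n) / real n) \<longlonglongrightarrow> 0"
    using ap_sequencesD[OF assms(1)] by blast
  obtain D S Q where B: "\<And>n. B n \<in> carrier_mat n n" "\<And>n x. norm (mat_op (B n) x) \<le> D * norm x"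
    "\<And>n x. norm (mat_op (mat_adjoint (B n)) x) \<le> D * norm x"
    "S \<in> ap_operators" "strong_limit B S" "strong_limit (\<lambda>n. mat_adjoint (B n)) Q"
    "(\<lambda>n. hs_norm_sq (B n - finite_section S n) / real n) \<longlonglongrightarrow> 0"
    using ap_sequencesD[OF assms(2)] by blast
  have lin: "complex_linear T" "complex_linear S" and col: "ap_columns S"
    using A(3) B(4) by (auto simp: ap_operators_def)
  have C0: "0 \<le> C" using order_trans[OF norm_ge_zero A(2)[of 0 "unit_vector 0"]] by simp
  define cr where "cr n = (\<Sum>j<n. (norm (S (unit_vector j) - trunc n (S (unit_vector j))))\<^sup>2)" for n
  have cr: "(\<lambda>n. cr n / real n) \<longlonglongrightarrow> 0" unfolding cr_def by (rule ap_columns_corner[OF col])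
  show ?thesis
  proof (rule ap_sequencesI)
    show "A n * B n \<in> carrier_mat n n" for n by (rule mult_carrier_mat[OF A(1) B(1)])
    show "norm (mat_op (A n * B n) x) \<le> (C * D) * norm x" for n x
      unfolding mat_op_mult[OF A(1) B(1)] mult.assoc
      by (rule order_trans[OF A(2) mult_left_mono[OF B(2) C0]])
    show "T o\<^sub>L S \<in> ap_operators"
      using closed_star_subalgebra_ap_operators A(3) B(4) by (simp add: closed_star_subalgebra_def)
    show "strong_limit (\<lambda>n. A n * B n) (T o\<^sub>L S)" by (rule strong_limit_mult[OF A(1) B(1) A(4) B(5) A(2)])
    show "strong_limit (\<lambda>n. mat_adjoint (A n * B n)) (Q o\<^sub>L R)"
      unfolding mat_adjoint_mult[OF A(1) B(1)]
      by (rule strong_limit_mult[OF mat_adjoint_carrier[OF B(1)] mat_adjoint_carrier[OF A(1)] B(6) A(5) B(3)])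
    show "(\<lambda>n. hs_norm_sq (A n * B n - finite_section (T o\<^sub>L S) n) / real n) \<longlonglongrightarrow> 0"
    proof (rule hs_norm_sq_quotient_tendsto_0)
      fix n
      let ?a = "finite_section T n" and ?b = "finite_section S n"
      note cA = minus_carrier_mat[OF finite_section_carrier[of T n], of "A n"]
      note cB = minus_carrier_mat[OF finite_section_carrier[of S n], of "B n"]
      \<comment> \<open>One factor is exchanged at a time: \<open>A n\<close> with norm at most
        \<open>C\<close> multiplies the error of \<open>B n\<close>, then \<open>?b\<close> with
        norm at most \<open>norm S\<close> multiplies the error of \<open>A n\<close>. What remains
        is the defect of \<open>P_n T P_n S P_n\<close> against \<open>P_n T S P_n\<close>.\<close>
      have "hs_norm_sq (A n * B n - finite_section (T o\<^sub>L S) n) \<le>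
          3 * (hs_norm_sq (A n * (B n - ?b)) + hs_norm_sq ((A n - ?a) * ?b) + hs_norm_sq (?a * ?b - finite_section (T o\<^sub>L S) n))"
      proof (rule hs_norm_sq_le3)
        note [simp] = mat_op_diff[of _ n] mat_op_mult[of _ n]
        show "mat_op (A n * B n - finite_section (T o\<^sub>L S) n) x = mat_op (A n * (B n - ?b)) x +
            mat_op ((A n - ?a) * ?b) x + mat_op (?a * ?b - finite_section (T o\<^sub>L S) n) x" for x
          using A(1)[of n] B(1)[of n] cA cB
          by (simp add: linear_diff[OF bounded_linear.linear[OF bounded_linear_mat_op]] mult_carrier_mat[of _ n n])
      qed (use A(1)[of n] B(1)[of n] cA cB in \<open>auto intro!: minus_carrier_mat mult_carrier_mat[of _ n n]\<close>)
      also have "\<dots> \<le> 3 * (C\<^sup>2 * hs_norm_sq (B n - ?b) + (norm S)\<^sup>2 * hs_norm_sq (A n - ?a) + (norm T)\<^sup>2 * cr n)"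
        unfolding cr_def
        by (intro mult_left_mono add_mono hs_norm_sq_mult_left[OF A(1) cB A(2)]
            hs_norm_sq_mult_right[OF cA finite_section_carrier norm_finite_section_le[OF lin(2)]]
            hs_norm_sq_section_compose_le lin) simp
      finally show "hs_norm_sq (A n * B n - finite_section (T o\<^sub>L S) n) \<le>
          3 * (C\<^sup>2 * hs_norm_sq (B n - ?b) + (norm S)\<^sup>2 * hs_norm_sq (A n - ?a) + (norm T)\<^sup>2 * cr n)" .
    next
      have "(\<lambda>n. 3 * (C\<^sup>2 * (hs_norm_sq (B n - finite_section S n) / real n) + (norm S)\<^sup>2 * (hs_norm_sq (A n - finite_section T n) / real n)
          + (norm T)\<^sup>2 * (cr n / real n))) \<longlonglongrightarrow> 0"
        by (intro tendsto_mult_right_zero tendsto_add_zero A(6) B(7) cr)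
      then show "(\<lambda>n. 3 * (C\<^sup>2 * hs_norm_sq (B n - finite_section S n) + (norm S)\<^sup>2 * hs_norm_sq (A n - finite_section T n)
          + (norm T)\<^sup>2 * cr n) / real n) \<longlonglongrightarrow> 0"
        by (simp add: add_divide_distrib)
    qed
  qed
qed

text \<open>A uniform distance \<open>r\<close> between \<open>A\<close> and \<open>B\<close> passes
  to the strong limits \<open>T\<close> and \<open>S\<close>, so \<open>T\<close> is a norm limit of
  \<open>ap_operators\<close>. In \<open>A n - P_n T P_n\<close> the two replacements, of
  \<open>A\<close> by \<open>B\<close> and of \<open>T\<close> by \<open>S\<close>, each cost at
  most \<open>n * r^2\<close>.\<close>

lemma ap_sequences_closed:
  assumes A: "A \<in> alg_F" and approx: "\<And>e. e > 0 \<Longrightarrow> \<exists>B\<in>ap_sequences. seq_norm (\<lambda>n. A n - B n) < e"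
  shows "A \<in> ap_sequences"
proof -
  obtain T R where cA: "\<And>n. A n \<in> carrier_mat n n" and limA: "strong_limit A T"
    and limR: "strong_limit (\<lambda>n. mat_adjoint (A n)) R"
    using A unfolding alg_F_def by blast
  \<comment> \<open>The two strong limits \<open>T\<close> and \<open>R\<close> are adjoint to each
    other, which gives complex linearity.\<close>
  have T: "complex_linear T"
    by (rule complex_linear_adjoint[OF is_adjoint_sym[OF strong_limit_is_adjoint[OF cA limA limR]]])
  have *: "\<exists>B C S. (\<forall>n. B n \<in> carrier_mat n n) \<and> (\<forall>n x. norm (mat_op (B n) x) \<le> C * norm x) \<and>
      S \<in> ap_operators \<and> (\<lambda>n. hs_norm_sq (B n - finite_section S n) / real n) \<longlonglongrightarrow> 0 \<and>
      (\<forall>n x. norm (mat_op (A n - B n) x) \<le> r * norm x) \<and> norm (T - S) \<le> r" if r: "r > 0" for r :: real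
  proof -
    obtain B where B: "B \<in> ap_sequences" "seq_norm (\<lambda>n. A n - B n) < ennreal r"
      using approx[of "ennreal r"] r by auto
    obtain C S Q where B': "\<And>n. B n \<in> carrier_mat n n" "\<And>n x. norm (mat_op (B n) x) \<le> C * norm x"
      "S \<in> ap_operators" "strong_limit B S" "strong_limit (\<lambda>n. mat_adjoint (B n)) Q"
      "(\<lambda>n. hs_norm_sq (B n - finite_section S n) / real n) \<longlonglongrightarrow> 0"
      using ap_sequencesD[OF B(1)] by blast
    note bound = seq_norm_lessD[OF B(2)]
    have "norm (T - S) \<le> r"
    proof (rule norm_blinfun_bound)
      fix x
      have "(\<lambda>n. norm (mat_op (A n - B n) x)) \<longlonglongrightarrow> norm ((T - S) x)"
        using limA B'(4) unfolding strong_limit_def mat_op_diff[OF cA B'(1)] blinfun.diff_left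
        by (intro tendsto_norm tendsto_diff) blast+
      then show "norm ((T - S) x) \<le> r * norm x"
        by (rule LIMSEQ_le_const2) (use bound in auto)
    qed (use r in simp)
    with B' bound show ?thesis by blast
  qed
  have "T \<in> ap_operators" using * by (intro ap_operators_approx[OF T]) blast
  moreover obtain C where "\<And>n x. norm (mat_op (A n) x) \<le> C * norm x"
  proof -
    obtain B C where B: "\<And>n. B n \<in> carrier_mat n n" "\<And>n x. norm (mat_op (B n) x) \<le> C * norm x"
      "\<And>n x. norm (mat_op (A n - B n) x) \<le> 1 * norm x"
      using *[of 1] by auto
    have "norm (mat_op (A n) x) \<le> (1 + C) * norm x" for n x
      using norm_triangle_mono[OF B(3)[of n x] B(2)[of n x]]
      by (simp add: mat_op_diff[OF cA B(1)] distrib_right)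
    then show ?thesis by (rule that)
  qed
  moreover have "(\<lambda>n. hs_norm_sq (A n - finite_section T n) / real n) \<longlonglongrightarrow> 0"
  proof (rule tendstoI)
    fix e :: real assume e: "e > 0"
    \<comment> \<open>The final estimate is \<open>6 * r^2\<close> plus three times a quantity below
      \<open>e / 6\<close>, so each part takes half of \<open>e\<close>.\<close>
    define r where "r = sqrt (e / 12)"
    have r: "r > 0" "r\<^sup>2 = e / 12" using e by (simp_all add: r_def)
    obtain B S where B: "\<And>n. B n \<in> carrier_mat n n" "S \<in> ap_operators"
      "(\<lambda>n. hs_norm_sq (B n - finite_section S n) / real n) \<longlonglongrightarrow> 0"
      "\<And>n x. norm (mat_op (A n - B n) x) \<le> r * norm x" "norm (T - S) \<le> r"
      using *[OF r(1)] by blast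
    have S: "complex_linear S" using B(2) by (simp add: ap_operators_def)
    have le: "hs_norm_sq (A n - finite_section T n) \<le> 3 * (real n * r\<^sup>2 + hs_norm_sq (B n - finite_section S n) + real n * r\<^sup>2)" for n
    proof -
      let ?d = "finite_section S n - finite_section T n"
      have "norm (mat_op ?d x) \<le> r * norm x" for x
      proof -
        have "mat_op ?d x = trunc n ((S - T) (trunc n x))"
          by (simp add: mat_op_diff[of _ n] mat_op_finite_section T S trunc_diff blinfun.diff_left)
        also have "norm \<dots> \<le> norm (S - T) * norm (trunc n x)"
          by (rule order_trans[OF norm_trunc_le norm_blinfun])
        also have "\<dots> \<le> r * norm x"
          using B(5) r(1) by (intro mult_mono norm_trunc_le) (simp_all add: norm_minus_commute)
        finally show ?thesis .
      qed
      then have d: "hs_norm_sq ?d \<le> real n * r\<^sup>2" by (intro hs_norm_sq_le_bound minus_carrier_mat) simp_all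
      have "hs_norm_sq (A n - finite_section T n) \<le> 3 * (hs_norm_sq (A n - B n) + hs_norm_sq (B n - finite_section S n) + hs_norm_sq ?d)"
      proof (rule hs_norm_sq_le3)
        show "mat_op (A n - finite_section T n) x =
            mat_op (A n - B n) x + mat_op (B n - finite_section S n) x + mat_op ?d x" for x
          using cA B(1) by (simp add: mat_op_diff[of _ n])
      qed (use cA B(1) in \<open>auto intro!: minus_carrier_mat\<close>)
      also have "\<dots> \<le> 3 * (real n * r\<^sup>2 + hs_norm_sq (B n - finite_section S n) + real n * r\<^sup>2)"
        by (intro mult_left_mono add_mono hs_norm_sq_le_bound[OF minus_carrier_mat[OF B(1)] B(4)] d order_refl) simp
      finally show ?thesis .
    qed
    have "\<forall>\<^sub>F n in sequentially. hs_norm_sq (B n - finite_section S n) / real n < e / 6"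
      using order_tendstoD(2)[OF B(3), of "e / 6"] e by simp
    then show "\<forall>\<^sub>F n in sequentially. dist (hs_norm_sq (A n - finite_section T n) / real n) 0 < e"
      using eventually_gt_at_top[of 0]
    proof eventually_elim
      case (elim n)
      have "hs_norm_sq (A n - finite_section T n) / real n \<le>
          3 * (real n * r\<^sup>2 + hs_norm_sq (B n - finite_section S n) + real n * r\<^sup>2) / real n"
        by (intro divide_right_mono le) simp
      also have "\<dots> = 6 * r\<^sup>2 + 3 * (hs_norm_sq (B n - finite_section S n) / real n)"
        using elim(2) by (simp add: field_simps)
      also have "\<dots> < e" using elim(1) r(2) by linarith
      finally show ?case by (simp add: hs_norm_sq_nonneg)
    qed
  qed
  ultimately show ?thesis using ap_sequencesI cA limA limR by blast
qed

lemma alg_S_subset_ap_sequences: "alg_S \<subseteq> ap_sequences"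
  unfolding alg_S_def
proof (rule hull_minimal)
  show "finite_section ` alg_A \<subseteq> ap_sequences"
    using alg_A_subset_ap_operators finite_section_in_ap_sequences by blast
  have "finite_section 0 = (\<lambda>n. 0\<^sub>m n n)"
    by (rule ext, rule eq_matI) (simp_all add: finite_section_def entry_def)
  moreover have "0 \<in> ap_operators"
    using closed_star_subalgebra_ap_operators by (simp add: closed_star_subalgebra_def)
  ultimately have "(\<lambda>n. 0\<^sub>m n n) \<in> ap_sequences" using finite_section_in_ap_sequences by metis
  moreover have "ap_sequences \<subseteq> alg_F" by (auto simp: ap_sequences_def)
  ultimately show "closed_star_subalgebra_F ap_sequences"
    unfolding closed_star_subalgebra_F_def
    by (auto intro: ap_sequences_add ap_sequences_mult ap_sequences_smult ap_sequences_adjoint ap_sequences_closed)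
qed

section \<open>Averages of diagonal entries and the limit of the normalised traces\<close>

lemma cesaro_tendsto_0:
  fixes x :: "nat \<Rightarrow> 'a::real_normed_vector"
  assumes "x \<longlonglongrightarrow> 0"
  shows "(\<lambda>n. norm (\<Sum>r<n. x r) / real n) \<longlonglongrightarrow> 0"
proof (rule tendstoI)
  fix e :: real assume e: "e > 0"
  then obtain N where N: "\<And>n. n \<ge> N \<Longrightarrow> norm (x n) < e / 2"
    using tendstoD[OF assms, of "e / 2"] by (auto simp: eventually_sequentially)
  define B where "B = (\<Sum>r<N. norm (x r))"
  have B: "0 \<le> B" unfolding B_def by (intro sum_nonneg) simp
  have bound: "norm (\<Sum>r<n. x r) \<le> B + real n * (e / 2)" for n
  proof -
    have "norm (\<Sum>r<n. x r) \<le> (\<Sum>r<n. (if r < N then norm (x r) else 0) + e / 2)"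
      using N e by (intro sum_norm_le) (simp add: not_less order_less_imp_le)
    also have "\<dots> = (\<Sum>r\<in>{..<n} \<inter> {..<N}. norm (x r)) + real n * (e / 2)"
      by (simp add: sum.distrib sum.If_cases lessThan_def)
    also have "(\<Sum>r\<in>{..<n} \<inter> {..<N}. norm (x r)) \<le> B" unfolding B_def by (intro sum_mono2) auto
    finally show ?thesis by simp
  qed
  obtain K where K: "real K > 2 * B / e" using reals_Archimedean2 by blast
  show "\<forall>\<^sub>F n in sequentially. dist (norm (\<Sum>r<n. x r) / real n) 0 < e"
    using eventually_ge_at_top[of "Suc K"]
  proof eventually_elim
    case (elim n)
    then have "real n > 2 * B / e" using K by linarith
    then have "B < real n * (e / 2)" using e by (simp add: field_simps)
    then have "norm (\<Sum>r<n. x r) < real n * e" using bound[of n] by argo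
    then show ?case using elim by (simp add: field_simps)
  qed
qed

theorem theorem4p7:
  fixes A :: "nat \<Rightarrow> complex mat"
  assumes "A \<in> alg_S"
  shows "(\<lambda>n. sum_mset (eigenvalues (A n)) / of_nat n) \<longlonglongrightarrow> mean (D_ap (W A))"
proof -
  obtain C T R where A: "\<And>n. A n \<in> carrier_mat n n" "\<And>n x. norm (mat_op (A n) x) \<le> C * norm x"
    "T \<in> ap_operators" "strong_limit A T" "strong_limit (\<lambda>n. mat_adjoint (A n)) R"
    "(\<lambda>n. hs_norm_sq (A n - finite_section T n) / real n) \<longlonglongrightarrow> 0"
    using ap_sequencesD[OF subsetD[OF alg_S_subset_ap_sequences assms]] by blast
  have "ap_columns T" using A(3) by (simp add: ap_operators_def)
  then obtain f where f: "f \<in> AP" "(\<lambda>i. entry T i i - f (int i)) \<longlonglongrightarrow> 0"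
    using ap_columns_diagonal by blast
  \<comment> \<open>\<open>mean\<close> is defined by \<open>lim\<close>, so convergence of the
    averages is what makes it their limit.\<close>
  have mean: "(\<lambda>n. (\<Sum>r<n. f (int r)) / of_nat n) \<longlonglongrightarrow> mean (D_ap (W A))"
    unfolding W_eqI[OF A(4)] D_ap_eqI[OF f] mean_def
    using AP_mean_convergent[OF f(1)] by (simp add: convergent_LIMSEQ_iff)
  have "(\<lambda>n. cmod (mat_trace (A n - finite_section T n)) / real n) \<longlonglongrightarrow> 0"
  proof (rule tendsto_sandwich[OF _ _ tendsto_const])
    show "(\<lambda>n. sqrt (hs_norm_sq (A n - finite_section T n) / real n)) \<longlonglongrightarrow> 0"
      using tendsto_real_sqrt[OF A(6)] by simp
    show "\<forall>\<^sub>F n in sequentially. cmod (mat_trace (A n - finite_section T n)) / real n \<le>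
        sqrt (hs_norm_sq (A n - finite_section T n) / real n)"
      using eventually_gt_at_top[of 0]
    proof eventually_elim
      case (elim n)
      \<comment> \<open>The squared trace is at most \<open>n\<close> times the squared
        Hilbert-Schmidt norm; division by the square of \<open>n\<close> leaves exactly the quotient
        known to vanish.\<close>
      have "(cmod (mat_trace (A n - finite_section T n)) / real n)\<^sup>2 \<le>
          real n * hs_norm_sq (A n - finite_section T n) / (real n)\<^sup>2"
        unfolding power_divide
        by (intro divide_right_mono trace_le_hs_norm_sq minus_carrier_mat finite_section_carrier) simp
      also have "\<dots> = hs_norm_sq (A n - finite_section T n) / real n"
        using elim by (simp add: power2_eq_square)
      finally show ?case by (rule real_le_rsqrt)
    qed
  qed simp
  then have "(\<lambda>n. mat_trace (A n - finite_section T n) / of_nat n) \<longlonglongrightarrow> 0"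
    by (intro tendsto_norm_zero_cancel[where f = "\<lambda>n. mat_trace (A n - finite_section T n) / of_nat n"])
      (simp add: norm_divide)
  moreover have "(\<lambda>n. (\<Sum>i<n. entry T i i - f (int i)) / of_nat n) \<longlonglongrightarrow> 0"
    using cesaro_tendsto_0[OF f(2)]
    by (intro tendsto_norm_zero_cancel[where f = "\<lambda>n. (\<Sum>i<n. entry T i i - f (int i)) / of_nat n"])
      (simp add: norm_divide)
  \<comment> \<open>The normalised trace of \<open>A n\<close> splits into its deviation from the
    finite section of \<open>T\<close>, the deviation of the diagonal of \<open>T\<close> from
    \<open>f\<close>, and the average of \<open>f\<close>; only the last one survives.\<close>
  ultimately have "(\<lambda>n. mat_trace (A n - finite_section T n) / of_nat n +
      (\<Sum>i<n. entry T i i - f (int i)) / of_nat n + (\<Sum>r<n. f (int r)) / of_nat n)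
      \<longlonglongrightarrow> 0 + 0 + mean (D_ap (W A))"
    by (intro tendsto_add mean)
  moreover have "mat_trace (A n - finite_section T n) / of_nat n +
      (\<Sum>i<n. entry T i i - f (int i)) / of_nat n + (\<Sum>r<n. f (int r)) / of_nat n =
      sum_mset (eigenvalues (A n)) / of_nat n" for n
    using A(1)[of n]
    by (simp add: sum_eigenvalues_eq_trace[OF A(1)] mat_trace_def finite_section_def sum_subtractf
        flip: add_divide_distrib)
  ultimately show ?thesis by simp
qed

end
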